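(* Let $T\in(\mathbb{C}^{n+1})^{\otimes d}$. (1) If $\dim E(T)=0$, then $E(T)$ contains no $d+1$ collinear points. (2) Assume that $T$ is symmetric and let $f\in\mathbb{C}[x_0,\dots,x_n]_d$ be the corresponding homogeneous polynomial. Let $L\subseteq\mathbb{P}^n$ be any $k$-dimensional linear space. If $\dim E(f_{|L})=0$, then $$\deg(L\cap R(f))\le\deg(L\cap E(f))\le\frac{(d-1)^{k+1}-1}{d-2}.$$
   Context: A tensor $T=(T_{i_1\dots i_d})\in(\mathbb{C}^{n+1})^{\otimes d}$ determines forms $g_i=\sum T_{i\,i_2\dots i_d}x_{i_2}\cdots x_{i_d}$ of degree $d-1$ ($0\le i\le n$), and its eigenscheme $E(T)\subseteq\mathbb{P}^n$ is defined by the $2\times 2$ minors of $\begin{pmatrix}x_0&\cdots&x_n\\ g_0&\cdots&g_n\end{pmatrix}$. For a homogeneous polynomial $f$ of degree $d$ (symmetric tensor) one takes $g_i=\partial_i f=\partial f/\partial x_i$ and writes $E(f)$. $\mathrm{Sing}(f)$ is the subscheme defined by the ideal $(\partial_0f,\dots,\partial_nf)$. The regular eigenscheme $R(f)$ is the residue of $E(f)$ with respect to $\mathrm{Sing}(f)$, with ideal $I_{E(f)}:(I_{\mathrm{Sing}(f)})^\infty$. For a linear space $L$ of equations $x_{k+1}=\dots=x_n=0$, the restriction is $f_{|L}(x_0,\dots,x_k)=f(x_0,\dots,x_k,0,\dots,0)$, and $E(f_{|L})\subseteq L$ is its eigenscheme. For other $k$-dimensional linear spaces the convention is that an orthogonal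 change of coordinates (under which eigenschemes are invariant) brings $L$ to this form.
   Formalization: L ranges over linear spaces that a complex orthogonal change of coordinates brings to coordinate form (x_0²+…+x_n² nondegenerate on L); for other L, E(f|_L) is undefined. For d=2 the bound, literally 0/0, is read as k+1; d≥1 is assumed. *)

theory Defs
  imports
    Complex_Main
    "HOL-Library.Poly_Mapping"
    "HOL-Library.Multiset"
    "HOL-Library.Function_Algebras"
    "HOL-Library.Extended_Real"
    "HOL-Computational_Algebra.Polynomial"
    "HOL-Algebra.Ideal_Product"
begin

section \<open>Polynomials over the complex numbers\<close>

text \<open>
  The variables are indexed by the natural numbers. The ring \<open>\<complex>[x\<^sub>0,\<dots>,x\<^sub>n]\<close> is the
  subring \<open>coord_ring n\<close> of the polynomials in which only \<open>x\<^sub>0,\<dots>,x\<^sub>n\<close> occur, presented as a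
  ring of HOL-Algebra, so that the ideal theory of that library applies to it.
\<close>

type_synonym mpoly = "(nat \<Rightarrow>\<^sub>0 nat) \<Rightarrow>\<^sub>0 complex"

definition const :: "complex \<Rightarrow> mpoly" where
  "const c = Poly_Mapping.single 0 c"

definition pvar :: "nat \<Rightarrow> mpoly" where
  "pvar i = Poly_Mapping.single (Poly_Mapping.single i 1) 1"

definition mon_degree :: "(nat \<Rightarrow>\<^sub>0 nat) \<Rightarrow> nat" where
  "mon_degree m = (\<Sum>i\<in>Poly_Mapping.keys m. Poly_Mapping.lookup m i)"

definition coord_ring :: "nat \<Rightarrow> mpoly ring" where
  "coord_ring n = \<lparr> carrier = {p. \<forall>m\<in>Poly_Mapping.keys p. Poly_Mapping.keys m \<subseteq> {..n}},
           mult = (*), one = 1, zero = 0, add = (+) \<rparr>"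

definition forms :: "nat \<Rightarrow> nat \<Rightarrow> mpoly set" where
  "forms n e = {p \<in> carrier (coord_ring n). \<forall>m\<in>Poly_Mapping.keys p. mon_degree m = e}"

definition partial_deriv :: "nat \<Rightarrow> mpoly \<Rightarrow> mpoly" where
  "partial_deriv i p = (\<Sum>m\<in>Poly_Mapping.keys p.
     Poly_Mapping.single (m - Poly_Mapping.single i 1)
       (of_nat (Poly_Mapping.lookup m i) * Poly_Mapping.lookup p m))"

definition poly_eval :: "(nat \<Rightarrow> complex) \<Rightarrow> mpoly \<Rightarrow> complex" where
  "poly_eval v p = (\<Sum>m\<in>Poly_Mapping.keys p.
     Poly_Mapping.lookup p m * (\<Prod>i\<in>Poly_Mapping.keys m. v i ^ Poly_Mapping.lookup m i))"

definition substitute :: "(nat \<Rightarrow> mpoly) \<Rightarrow> mpoly \<Rightarrow> mpoly" where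
  "substitute \<sigma> p = (\<Sum>m\<in>Poly_Mapping.keys p.
     const (Poly_Mapping.lookup p m) *
       (\<Prod>i\<in>Poly_Mapping.keys m. \<sigma> i ^ Poly_Mapping.lookup m i))"

lemma coord_ring_simps [simp]:
  "mult (coord_ring n) = (*)" "one (coord_ring n) = 1" "zero (coord_ring n) = 0" "add (coord_ring n) = (+)"
  by (simp_all add: coord_ring_def)

lemma cring_coord_ring: "cring (coord_ring n)"
proof -
  have add: "p + q \<in> carrier (coord_ring n)" if "p \<in> carrier (coord_ring n)" "q \<in> carrier (coord_ring n)" for p q
    using that Poly_Mapping.keys_add[of p q] by (fastforce simp: coord_ring_def)
  have mult: "p * q \<in> carrier (coord_ring n)" if pq: "p \<in> carrier (coord_ring n)" "q \<in> carrier (coord_ring n)" for p q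
  proof -
    have "Poly_Mapping.keys m \<subseteq> {..n}" if m: "m \<in> Poly_Mapping.keys (p * q)" for m
    proof -
      obtain a b where "m = a + b" "a \<in> Poly_Mapping.keys p" "b \<in> Poly_Mapping.keys q"
        using m keys_mult[of p q] by blast
      then show ?thesis
        using pq Poly_Mapping.keys_add[of a b] by (fastforce simp: coord_ring_def)
    qed
    then show ?thesis by (simp add: coord_ring_def)
  qed
  have uminus: "- p \<in> carrier (coord_ring n)" if "p \<in> carrier (coord_ring n)" for p
    using that by (simp add: coord_ring_def)
  have zero: "0 \<in> carrier (coord_ring n)" and one: "1 \<in> carrier (coord_ring n)"
    by (simp_all add: coord_ring_def)
  show ?thesis
  proof (rule cringI)
    show "abelian_group (coord_ring n)"
    proof (rule abelian_groupI)
      fix p assume "p \<in> carrier (coord_ring n)"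
      then show "\<exists>q\<in>carrier (coord_ring n). q \<oplus>\<^bsub>coord_ring n\<^esub> p = \<zero>\<^bsub>coord_ring n\<^esub>"
        using uminus[of p] by (intro bexI[of _ "- p"]) simp_all
    qed (simp_all add: add zero algebra_simps)
    show "Group.comm_monoid (coord_ring n)"
      by (rule comm_monoidI) (simp_all add: mult one algebra_simps)
  qed (simp add: algebra_simps)
qed

section \<open>Linear algebra in \<open>\<complex>\<^sup>n\<^sup>+\<^sup>1\<close>\<close>

global_interpretation mpoly_vs: vector_space "\<lambda>c p. const c * p"
  by unfold_locales
    (simp_all add: const_def algebra_simps single_add mult_single flip: mult.assoc)

global_interpretation cvec: vector_space "\<lambda>(c::complex) (v :: nat \<Rightarrow> complex) i. c * v i"
  by unfold_locales (auto simp: fun_eq_iff algebra_simps)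

definition coord_space :: "nat \<Rightarrow> (nat \<Rightarrow> complex) set" where
  "coord_space k = {v. \<forall>i>k. v i = 0}"

text \<open>
  A \<open>k\<close>-dimensional linear space of \<open>\<P>\<^sup>n\<close> is given by the corresponding vector subspace of
  dimension \<open>k + 1\<close> of \<open>\<complex>\<^sup>n\<^sup>+\<^sup>1 = coord_space n\<close>. In particular the points of \<open>\<P>\<^sup>n\<close> are the
  sets \<open>P\<close> with \<open>linear_space n 0 P\<close>.
\<close>

definition linear_space :: "nat \<Rightarrow> nat \<Rightarrow> (nat \<Rightarrow> complex) set \<Rightarrow> bool" where
  "linear_space n k L \<longleftrightarrow> cvec.subspace L \<and> L \<subseteq> coord_space n \<and> cvec.dim L = k + 1"

definition collinear_points :: "nat \<Rightarrow> (nat \<Rightarrow> complex) set set \<Rightarrow> bool" where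
  "collinear_points n Q \<longleftrightarrow> (\<exists>M. linear_space n 1 M \<and> (\<forall>P\<in>Q. P \<subseteq> M))"

definition mat_apply :: "nat \<Rightarrow> (nat \<Rightarrow> nat \<Rightarrow> complex) \<Rightarrow> (nat \<Rightarrow> complex) \<Rightarrow> nat \<Rightarrow> complex" where
  "mat_apply n A v = (\<lambda>i. if i \<le> n then \<Sum>j\<le>n. A i j * v j else 0)"

text \<open>
  \<open>A\<^sup>T A = 1\<close> for the \<open>(n + 1) \<times> (n + 1)\<close> matrix \<open>A\<close>, without complex conjugation: these
  are the matrices preserving the quadratic form \<open>x\<^sub>0\<^sup>2 + \<dots> + x\<^sub>n\<^sup>2\<close>.
\<close>

definition complex_orthogonal :: "nat \<Rightarrow> (nat \<Rightarrow> nat \<Rightarrow> complex) \<Rightarrow> bool" where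
  "complex_orthogonal n A \<longleftrightarrow>
     (\<forall>i\<le>n. \<forall>j\<le>n. (\<Sum>l\<le>n. A l i * A l j) = (if i = j then 1 else 0))"

section \<open>Closed subschemes of projective space\<close>

text \<open>
  A closed subscheme of \<open>\<P>\<^sup>n\<close> is given by a homogeneous ideal of \<open>coord_ring n\<close>. The ideal need not
  be saturated; the notions below depend only on its saturation, that is, on the scheme.
  The scheme-theoretic intersection is given by the sum of the ideals.
\<close>

definition homogeneous_ideal :: "nat \<Rightarrow> mpoly set \<Rightarrow> bool" where
  "homogeneous_ideal n I \<longleftrightarrow> (\<exists>G \<subseteq> (\<Union>e. forms n e). I = genideal (coord_ring n) G)"

text \<open>The points of the scheme \<open>Proj (coord_ring n / I)\<close>.\<close>

definition proj_points :: "nat \<Rightarrow> mpoly set \<Rightarrow> mpoly set set" where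
  "proj_points n I =
     {P. primeideal P (coord_ring n) \<and> homogeneous_ideal n P \<and> I \<subseteq> P \<and> \<not> pvar ` {..n} \<subseteq> P}"

text \<open>
  Krull dimension. The irreducible closed subsets of a scheme are the closures of its points,
  so chains of them are chains of homogeneous primes (reversed). The empty scheme has
  dimension \<open>-\<infinity>\<close>.
\<close>

definition scheme_dim :: "nat \<Rightarrow> mpoly set \<Rightarrow> ereal" where
  "scheme_dim n I = Sup {ereal (real r) | r.
     \<exists>P :: nat \<Rightarrow> mpoly set. (\<forall>j\<le>r. P j \<in> proj_points n I) \<and> (\<forall>j<r. P j \<subset> P (Suc j))}"

text \<open>
  The points of \<open>\<P>\<^sup>n(\<complex>)\<close> on the scheme, as one-dimensional subspaces of \<open>\<complex>\<^sup>n\<^sup>+\<^sup>1\<close>.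
\<close>

definition closed_points :: "nat \<Rightarrow> mpoly set \<Rightarrow> (nat \<Rightarrow> complex) set set" where
  "closed_points n I = {P. linear_space n 0 P \<and> (\<forall>v\<in>P. \<forall>p\<in>I. poly_eval v p = 0)}"

definition hilbert_function :: "nat \<Rightarrow> mpoly set \<Rightarrow> nat \<Rightarrow> nat" where
  "hilbert_function n I e = mpoly_vs.dim (forms n e) - mpoly_vs.dim (I \<inter> forms n e)"

definition hilbert_poly :: "nat \<Rightarrow> mpoly set \<Rightarrow> real poly" where
  "hilbert_poly n I =
     (THE h. eventually (\<lambda>e. poly h (real e) = real (hilbert_function n I e)) sequentially)"

text \<open>
  For a scheme of dimension \<open>r\<close>, this is \<open>r!\<close> times the leading coefficient of the Hilbert
  polynomial. If \<open>r = 0\<close> it is the constant value of the Hilbert polynomial, and the empty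
  scheme has degree \<open>0\<close>.
\<close>

definition scheme_degree :: "nat \<Rightarrow> mpoly set \<Rightarrow> real" where
  "scheme_degree n I =
     fact (Polynomial.degree (hilbert_poly n I)) * lead_coeff (hilbert_poly n I)"

definition linear_space_ideal :: "nat \<Rightarrow> (nat \<Rightarrow> complex) set \<Rightarrow> mpoly set" where
  "linear_space_ideal n L = genideal (coord_ring n) {l \<in> forms n 1. \<forall>v\<in>L. poly_eval v l = 0}"

fun ideal_power :: "nat \<Rightarrow> mpoly set \<Rightarrow> nat \<Rightarrow> mpoly set" where
  "ideal_power n J 0 = carrier (coord_ring n)"
| "ideal_power n J (Suc N) = ideal_prod (coord_ring n) J (ideal_power n J N)"

definition colon_ideal :: "nat \<Rightarrow> mpoly set \<Rightarrow> mpoly set \<Rightarrow> mpoly set" where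
  "colon_ideal n I J = {p \<in> carrier (coord_ring n). \<forall>q\<in>J. p * q \<in> I}"

definition ideal_saturation :: "nat \<Rightarrow> mpoly set \<Rightarrow> mpoly set \<Rightarrow> mpoly set" where
  "ideal_saturation n I J = (\<Union>N. colon_ideal n I (ideal_power n J N))"

section \<open>Tensors and eigenschemes\<close>

text \<open>
  A tensor \<open>T \<in> (\<complex>\<^sup>n\<^sup>+\<^sup>1)\<^sup>\<otimes>\<^sup>d\<close> is given by its entries \<open>T [i\<^sub>1,\<dots>,i\<^sub>d]\<close> at the lists in
  \<open>multi_indices n d\<close>; values of \<open>T\<close> at other lists are never used.
\<close>

definition multi_indices :: "nat \<Rightarrow> nat \<Rightarrow> nat list set" where
  "multi_indices n d = {js. length js = d \<and> set js \<subseteq> {..n}}"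

definition tensor_forms :: "nat \<Rightarrow> nat \<Rightarrow> (nat list \<Rightarrow> complex) \<Rightarrow> nat \<Rightarrow> mpoly" where
  "tensor_forms n d T i =
     (\<Sum>js\<in>multi_indices n (d - 1). const (T (i # js)) * prod_list (map pvar js))"

definition symmetric_tensor :: "nat \<Rightarrow> nat \<Rightarrow> (nat list \<Rightarrow> complex) \<Rightarrow> bool" where
  "symmetric_tensor n d T \<longleftrightarrow>
     (\<forall>is\<in>multi_indices n d. \<forall>js\<in>multi_indices n d. mset is = mset js \<longrightarrow> T is = T js)"

definition tensor_poly :: "nat \<Rightarrow> nat \<Rightarrow> (nat list \<Rightarrow> complex) \<Rightarrow> mpoly" where
  "tensor_poly n d T = (\<Sum>js\<in>multi_indices n d. const (T js) * prod_list (map pvar js))"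

definition minors_ideal :: "nat \<Rightarrow> (nat \<Rightarrow> mpoly) \<Rightarrow> mpoly set" where
  "minors_ideal n g = genideal (coord_ring n) {pvar i * g j - pvar j * g i | i j. i \<le> n \<and> j \<le> n}"

definition tensor_eigenscheme :: "nat \<Rightarrow> nat \<Rightarrow> (nat list \<Rightarrow> complex) \<Rightarrow> mpoly set" where
  "tensor_eigenscheme n d T = minors_ideal n (tensor_forms n d T)"

definition eigenscheme :: "nat \<Rightarrow> mpoly \<Rightarrow> mpoly set" where
  "eigenscheme n f = minors_ideal n (\<lambda>i. partial_deriv i f)"

definition singular_scheme :: "nat \<Rightarrow> mpoly \<Rightarrow> mpoly set" where
  "singular_scheme n f = genideal (coord_ring n) ((\<lambda>i. partial_deriv i f) ` {..n})"

definition regular_eigenscheme :: "nat \<Rightarrow> mpoly \<Rightarrow> mpoly set" where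
  "regular_eigenscheme n f = ideal_saturation n (eigenscheme n f) (singular_scheme n f)"

text \<open>The polynomial \<open>f(A x)\<close>.\<close>

definition change_coords :: "nat \<Rightarrow> (nat \<Rightarrow> nat \<Rightarrow> complex) \<Rightarrow> mpoly \<Rightarrow> mpoly" where
  "change_coords n A f = substitute (\<lambda>i. \<Sum>j\<le>n. const (A i j) * pvar j) f"

text \<open>The polynomial \<open>f(x\<^sub>0,\<dots>,x\<^sub>k,0,\<dots>,0)\<close>, an element of \<open>coord_ring k\<close>.\<close>

definition restrict_coords :: "nat \<Rightarrow> mpoly \<Rightarrow> mpoly" where
  "restrict_coords k f = substitute (\<lambda>i. if i \<le> k then pvar i else 0) f"

text \<open>
  If the columns of an orthogonal \<open>A\<close> are such that \<open>x \<mapsto> A x\<close> takes the space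
  \<open>x\<^sub>k\<^sub>+\<^sub>1 = \<dots> = x\<^sub>n = 0\<close> to \<open>L\<close>, then in the coordinates given by \<open>A\<close> the restriction of \<open>f\<close> to \<open>L\<close>
  is \<open>f(A (x\<^sub>0,\<dots>,x\<^sub>k,0,\<dots>,0))\<close>. Two such \<open>A\<close> give restrictions that differ by an orthogonal
  change of the coordinates \<open>x\<^sub>0,\<dots>,x\<^sub>k\<close>.
  Such an \<open>A\<close> exists exactly if the form \<open>x\<^sub>0\<^sup>2 + \<dots> + x\<^sub>n\<^sup>2\<close> is nondegenerate on \<open>L\<close>.
\<close>

definition adapted_coords ::
    "nat \<Rightarrow> nat \<Rightarrow> (nat \<Rightarrow> complex) set \<Rightarrow> (nat \<Rightarrow> nat \<Rightarrow> complex) \<Rightarrow> bool" where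
  "adapted_coords n k L A \<longleftrightarrow> complex_orthogonal n A \<and> mat_apply n A ` coord_space k = L"

definition restriction :: "nat \<Rightarrow> nat \<Rightarrow> (nat \<Rightarrow> nat \<Rightarrow> complex) \<Rightarrow> mpoly \<Rightarrow> mpoly" where
  "restriction n k A f = restrict_coords k (change_coords n A f)"

end

theory Submission
  imports Defs "HOL-Computational_Algebra.Polynomial_FPS" "HOL-Computational_Algebra.Fundamental_Theorem_Algebra"
begin

text \<open>
  The first claim holds because the minors have degree \<open>d\<close>: if they vanish at \<open>d + 1\<close> points of
  a line, they vanish on the line, which is positive-dimensional.

  For the degree bound, the intersection of \<open>L\<close> with the eigenscheme of \<open>f\<close> is a subscheme of the
  eigenscheme of the restriction \<open>h\<close>, so it suffices to bound the Hilbert function of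
  \<open>S / I\<close>, where \<open>S\<close> is the polynomial ring in \<open>k + 1\<close> variables and \<open>I\<close> is generated by the minors
  \<open>x\<^sub>i g\<^sub>j - x\<^sub>j g\<^sub>i\<close> for any forms \<open>g\<^sub>i\<close> of degree \<open>D = d - 1\<close>. Replacing \<open>g\<^sub>i\<close> by
  \<open>g\<^sub>i - c l\<^sup>D\<^sup>-\<^sup>1 x\<^sub>i\<close> changes no minor, and for a general linear form \<open>l\<close> and scalar \<open>c\<close> it makes
  the \<open>g\<^sub>i\<close> a complete intersection, so that \<open>S / (g)\<close> has length \<open>D\<^sup>k\<^sup>+\<^sup>1\<close>. The rule \<open>x\<^sub>i \<mapsto> g\<^sub>i\<close>
  induces a surjection of degree \<open>D - 1\<close> from \<open>(x) / I\<close> to \<open>(g) / I\<close>. Summing the dimensions of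
  the graded pieces gives \<open>(D - 1) c + 1 \<le> D\<^sup>k\<^sup>+\<^sup>1\<close> for the eventual value \<open>c\<close> of the Hilbert
  function. This is void for \<open>D = 1\<close>, where a hyperplane section is computed instead.
\<close>

section \<open>Codimensions of subspaces\<close>

text \<open>Dimension zero enters in one form only: for any two indices i, j the ideal contains a
  nonzero binary form in x_i and x_j (\<open>brel\<close>). If it contained none, Zorn's lemma would
  give a homogeneous prime avoiding all of them, and this prime is not maximal among the relevant
  ones. Such relations leave finitely many candidates for zeros, and "general" always means avoiding
  the finitely many values that these candidates exclude. A bounded Hilbert function yields the same
  relations, so the argument also serves inside partial complete intersections. The length of
  \<open>S / (g)\<close> is found by comparison: the variables form a regular sequence, and
  exchanging members through common linear parameters carries regularity over to any equally long
  list of forms without common zero; the Hilbert series then depends on the degrees alone. In the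
  final count, the 1 is the Hilbert function in degree 0, which the surjection does not reach, and D
  - 1 is its shift of degrees. For D = 1 and general l, all products of two linear forms lie in
  \<open>I + (l)\<close>, so the Hilbert function never exceeds the bound k + 1 of degree 1.\<close>

context vector_space
begin

text \<open>An adapted basis: \<open>C\<close> represents a basis of the quotient of the span of
  \<open>V\<close> by \<open>W\<close>, so codimensions can be counted without quotient
  spaces.\<close>

lemma relative_basis:
  assumes "subspace W" "W \<subseteq> V" "finite B" "V \<subseteq> span B"
  obtains D C where "independent (D \<union> C)" "D \<inter> C = {}" "finite D" "finite C" "C \<subseteq> V" "span D = W"
    "V \<subseteq> span (D \<union> C)" "dim W = card D" "dim V = card D + card C"
proof -
  obtain D where D: "D \<subseteq> W" "independent D" "W \<subseteq> span D" "card D = dim W"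
    using basis_exists by blast
  obtain E where E: "D \<subseteq> E" "E \<subseteq> V" "independent E" "V \<subseteq> span E"
    using maximal_independent_subset_extend[of D V] D assms(2) by (metis order.trans)
  have "finite E"
    using independent_span_bound[OF assms(3) E(3)] E(2) assms(4) by blast
  moreover from this E(1) have "finite D" by (rule rev_finite_subset)
  moreover have "span D = W"
    using D assms(1) by (simp add: span_subspace)
  moreover have "dim V = card E"
    using basis_card_eq_dim[OF E(2,4,3)] by simp
  moreover have "card E = card D + card (E - D)"
    using \<open>finite E\<close> E(1) by (simp add: card_Diff_subset card_mono finite_subset)
  ultimately show thesis
    using E D by (intro that[of D "E - D"]) (auto simp: Un_absorb1)
qed

lemma dim_mono_finite:
  assumes "subspace W" "W \<subseteq> V" "finite B" "V \<subseteq> span B"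
  shows "dim W \<le> dim V"
  using relative_basis[OF assms] by (metis le_add1)

text \<open>\<open>T\<close> induces a surjection from \<open>V / V'\<close> to
  \<open>W / W'\<close>. A basis of \<open>W'\<close> and the images of a complementary basis of
  \<open>V'\<close> together span \<open>W\<close>.\<close>

lemma codim_le_of_image_covers:
  assumes T: "Vector_Spaces.linear scale scale T"
    and sub: "subspace V'" "V' \<subseteq> V" "subspace W'"
    and fin: "finite B" "V \<subseteq> span B" "finite B'" "W' \<subseteq> span B'"
    and cover: "\<And>w. w \<in> W \<Longrightarrow> \<exists>v\<in>V. \<exists>w'\<in>W'. w = T v + w'"
    and T': "\<And>v. v \<in> V' \<Longrightarrow> T v \<in> W'"
  shows "dim W - dim W' \<le> dim V - dim V'"
proof -
  obtain D C where DC: "finite C" "finite D" "span D = V'" "V \<subseteq> span (D \<union> C)" "dim V' = card D" "dim V = card D + card C"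
    using relative_basis[OF sub(1,2) fin(1,2)] by metis
  obtain E where E: "E \<subseteq> W'" "independent E" "W' \<subseteq> span E" "card E = dim W'"
    using basis_exists by blast
  have "finite E"
    using independent_span_bound[OF fin(3) E(2)] E(1) fin(4) by blast
  have eqE: "span E = W'" using E sub(3) by (simp add: span_subspace)
  interpret T: Vector_Spaces.linear scale scale T by fact
  have "W \<subseteq> span (E \<union> T ` C)"
  proof
    fix w assume "w \<in> W"
    then obtain v w' where v: "v \<in> V" "w' \<in> W'" "w = T v + w'" using cover by blast
    have "v \<in> span (D \<union> C)" using v DC by blast
    then obtain a b where ab: "v = a + b" "a \<in> span D" "b \<in> span C"
      unfolding span_Un by blast
    have "T a \<in> span E" using T' ab DC eqE by blast
    moreover have "T b \<in> span (T ` C)" using ab(3) T.span_image by blast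
    moreover have "w' \<in> span E" using v eqE by blast
    moreover have "w = (T a + w') + T b"
      using v ab by (simp add: T.add algebra_simps)
    ultimately show "w \<in> span (E \<union> T ` C)"
      using span_mono[of E "E \<union> T ` C"] span_mono[of "T ` C" "E \<union> T ` C"]
      by (auto intro!: span_add)
  qed
  then have "dim W \<le> card (E \<union> T ` C)"
    using \<open>finite E\<close> DC(1) by (intro dim_le_card) auto
  also have "\<dots> \<le> card E + card C"
    using card_Un_le[of E "T ` C"] card_image_le[OF DC(1), of T] by linarith
  finally show ?thesis using E DC by linarith
qed

text \<open>The dual count: \<open>T\<close> induces an injection from \<open>V / V'\<close> to
  \<open>W / W'\<close>.\<close>

lemma codim_le_of_preimage:
  assumes T: "Vector_Spaces.linear scale scale T"
    and sub: "subspace V'" "V' \<subseteq> V" "subspace V" "subspace W'" "W' \<subseteq> W"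
    and fin: "finite B" "V \<subseteq> span B" "finite B'" "W \<subseteq> span B'"
    and T': "\<And>v. v \<in> V \<Longrightarrow> T v \<in> W" "\<And>v. v \<in> V \<Longrightarrow> T v \<in> W' \<Longrightarrow> v \<in> V'"
  shows "dim V - dim V' \<le> dim W - dim W'"
proof -
  obtain D C where DC: "independent (D \<union> C)" "D \<inter> C = {}" "finite C" "finite D" "C \<subseteq> V" "span D = V'"
    "V \<subseteq> span (D \<union> C)" "dim V' = card D" "dim V = card D + card C"
    using relative_basis[OF sub(1,2) fin(1,2)] by metis
  obtain E where E: "E \<subseteq> W'" "independent E" "W' \<subseteq> span E" "card E = dim W'"
    using basis_exists by blast
  have finE: "finite E"
    using independent_span_bound[OF fin(3) E(2)] E(1) fin(4) sub(5) by blast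
  have eqE: "span E = W'" using E sub(4) by (simp add: span_subspace)
  interpret T: Vector_Spaces.linear scale scale T by fact
  \<comment> \<open>The complementary vectors are added one at a time. If \<open>T c\<close>
    depended on \<open>W'\<close> and the earlier images, then \<open>c - b\<close> would lie in
    \<open>V'\<close> for some \<open>b\<close> in the span of the earlier vectors, against the
    independence of \<open>D\<close> and \<open>C\<close>.\<close>
  have "independent (E \<union> T ` C0) \<and> card (E \<union> T ` C0) = card E + card C0" if "C0 \<subseteq> C" for C0
    using finite_subset[OF that DC(3)] that
  proof (induction C0 rule: finite_induct)
    case empty
    then show ?case using E by simp
  next
    case (insert c C0)
    have "T c \<notin> span (E \<union> T ` C0)"
    proof
      assume "T c \<in> span (E \<union> T ` C0)"
      then obtain w u where wu: "T c = w + u" "w \<in> span E" "u \<in> span (T ` C0)"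
        unfolding span_Un by blast
      then obtain b where b: "b \<in> span C0" "u = T b" using T.span_image by blast
      have "span C0 \<subseteq> V" using insert.prems DC(5) sub(3) by (intro span_minimal) auto
      then have "c - b \<in> V" using insert.prems DC(5) b sub(3) by (intro subspace_diff) auto
      moreover have "T (c - b) \<in> W'" using wu b eqE by (simp add: T.diff)
      ultimately have "c - b \<in> span D" using T' DC by blast
      then have "c - b + b \<in> span (D \<union> C0)"
        using b span_mono[of D "D \<union> C0"] span_mono[of C0 "D \<union> C0"] by (intro span_add) auto
      then have "c \<in> span (D \<union> C0)" by simp
      moreover have "D \<union> C0 \<subseteq> (D \<union> C) - {c}" using insert DC by auto
      ultimately have "c \<in> span ((D \<union> C) - {c})" using span_mono by blast
      moreover have "c \<in> D \<union> C" using insert by auto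
      ultimately show False using DC(1) unfolding dependent_def by (metis (no_types))
    qed
    moreover from this have "T c \<notin> E \<union> T ` C0" by (metis span_base)
    moreover have "independent (E \<union> T ` C0)" "card (E \<union> T ` C0) = card E + card C0"
      using insert.IH insert.prems by auto
    ultimately show ?case
      using insert.hyps finE independent_insertI[of "T c" "E \<union> T ` C0"] by simp
  qed
  from this[of C] have ind: "independent (E \<union> T ` C)" and card: "card (E \<union> T ` C) = card E + card C"
    by auto
  have "E \<union> T ` C \<subseteq> W" using E sub DC T' by blast
  then obtain F where F: "E \<union> T ` C \<subseteq> F" "F \<subseteq> W" "independent F" "W \<subseteq> span F"
    using maximal_independent_subset_extend[OF _ ind] by metis
  have "finite F" using independent_span_bound[OF fin(3) F(3)] F(2) fin(4) by blast
  then have "card (E \<union> T ` C) \<le> dim W"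
    using card_mono[OF _ F(1)] basis_card_eq_dim[OF F(2,4,3)] by simp
  then show ?thesis using card E DC by linarith
qed

end

section \<open>Polynomials\<close>

lemma const_simps [simp]: "const 0 = 0" "const 1 = 1"
  by (simp_all add: const_def)

lemma const_add: "const (a + b) = const a + const b"
  by (simp add: const_def single_add)

lemma const_mult: "const (a * b) = const a * const b"
  by (simp add: const_def mult_single)

lemma const_uminus: "const (- a) = - const a"
  by (simp add: const_def single_uminus)

lemma lookup_const_mult [simp]: "Poly_Mapping.lookup (const c * p) m = c * Poly_Mapping.lookup p m"
  by (simp add: const_def Poly_Mapping.map.rep_eq when_def flip: mult_map_scale_conv_mult)

lemma keys_const_mult: "Poly_Mapping.keys (const c * p) \<subseteq> Poly_Mapping.keys p"
  by (auto simp: in_keys_iff)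

lemma single_conv_const: "Poly_Mapping.single m c = const c * Poly_Mapping.single m 1"
  by (simp add: const_def mult_single)

lemma mpoly_sum_monomials:
  fixes p :: mpoly
  shows "(\<Sum>m\<in>Poly_Mapping.keys p. Poly_Mapping.single m (Poly_Mapping.lookup p m)) = p"
  by (rule poly_mapping_eqI) (auto simp: lookup_sum lookup_single when_def in_keys_iff)

lemma mpoly_induct [case_names single add]:
  fixes p :: mpoly
  assumes "\<And>m c. P (Poly_Mapping.single m c)" "\<And>p q. P p \<Longrightarrow> P q \<Longrightarrow> P (p + q)"
  shows "P p"
proof -
  have "P (\<Sum>m\<in>A. Poly_Mapping.single m (Poly_Mapping.lookup p m))" if "finite A" for A
    using that
  proof induction
    case empty
    then show ?case using assms(1)[of 0 0] by simp
  qed (simp add: assms)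
  from this[of "Poly_Mapping.keys p"] show ?thesis by (simp add: mpoly_sum_monomials)
qed

section \<open>Evaluation homomorphisms\<close>

definition monom_val :: "(nat \<Rightarrow> 'a::comm_monoid_mult) \<Rightarrow> (nat \<Rightarrow>\<^sub>0 nat) \<Rightarrow> 'a" where
  "monom_val v m = (\<Prod>i\<in>Poly_Mapping.keys m. v i ^ Poly_Mapping.lookup m i)"

lemma monom_val_superset:
  assumes "finite A" "Poly_Mapping.keys m \<subseteq> A"
  shows "monom_val v m = (\<Prod>i\<in>A. v i ^ Poly_Mapping.lookup m i)"
  unfolding monom_val_def using assms by (intro prod.mono_neutral_left) (auto simp: in_keys_iff)

lemma monom_val_add: "monom_val v (m + m') = monom_val v m * monom_val v m'"
proof -
  let ?A = "Poly_Mapping.keys m \<union> Poly_Mapping.keys m'"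
  have "Poly_Mapping.keys (m + m') \<subseteq> ?A" by (rule Poly_Mapping.keys_add)
  then show ?thesis
    using monom_val_superset[of ?A m v] monom_val_superset[of ?A m' v] monom_val_superset[of ?A "m + m'" v]
    by (simp add: lookup_add power_add prod.distrib)
qed

lemma monom_val_0 [simp]: "monom_val v 0 = 1"
  by (simp add: monom_val_def)

lemma monom_val_single [simp]: "monom_val v (Poly_Mapping.single i k) = v i ^ k"
  by (simp add: monom_val_def)

text \<open>Covers both \<open>poly_eval\<close> and \<open>substitute\<close>, and the restriction to a parametrised line.\<close>

definition meval :: "(complex \<Rightarrow> 'a::comm_ring_1) \<Rightarrow> (nat \<Rightarrow> 'a) \<Rightarrow> mpoly \<Rightarrow> 'a" where
  "meval h v p = (\<Sum>m\<in>Poly_Mapping.keys p. h (Poly_Mapping.lookup p m) * monom_val v m)"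

definition ring_map :: "('a::comm_ring_1 \<Rightarrow> 'b::comm_ring_1) \<Rightarrow> bool" where
  "ring_map h \<longleftrightarrow> h 1 = 1 \<and> (\<forall>a b. h (a + b) = h a + h b) \<and> (\<forall>a b. h (a * b) = h a * h b)"

lemma ring_map_simps:
  assumes "ring_map h"
  shows "h 1 = 1" "h (a + b) = h a + h b" "h (a * b) = h a * h b" "h 0 = 0" "h (a - b) = h a - h b"
    "h (- a) = - h a" "h (a ^ k) = h a ^ k" "h (sum f A) = (\<Sum>x\<in>A. h (f x))" "h (prod g B) = (\<Prod>x\<in>B. h (g x))"
proof -
  have add: "h (a + b) = h a + h b" and mult: "h (a * b) = h a * h b" for a b
    using assms by (auto simp: ring_map_def)
  show one: "h 1 = 1" using assms by (simp add: ring_map_def)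
  have zero: "h 0 = 0" using add[of 0 0] by simp
  have minus: "h (- a) = - h a" for a
    using add[of a "- a"] zero by (simp add: eq_neg_iff_add_eq_0 add.commute)
  show "h (a + b) = h a + h b" "h (a * b) = h a * h b" "h 0 = 0" "h (- a) = - h a" by fact+
  show "h (a - b) = h a - h b" using add[of a "- b"] minus by simp
  show "h (a ^ k) = h a ^ k" by (induction k) (simp_all add: one mult)
  show "h (sum f A) = (\<Sum>x\<in>A. h (f x))"
    by (induction A rule: infinite_finite_induct) (simp_all add: zero add)
  show "h (prod g B) = (\<Prod>x\<in>B. h (g x))"
    by (induction B rule: infinite_finite_induct) (simp_all add: one mult)
qed

lemma ring_map_id: "ring_map (\<lambda>x. x)" and ring_map_const: "ring_map const"
  by (simp_all add: ring_map_def const_add const_mult)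

lemma meval_superset:
  assumes "h 0 = 0" "finite A" "Poly_Mapping.keys p \<subseteq> A"
  shows "meval h v p = (\<Sum>m\<in>A. h (Poly_Mapping.lookup p m) * monom_val v m)"
  unfolding meval_def using assms by (intro sum.mono_neutral_left) (auto simp: in_keys_iff)

lemma meval_add:
  assumes "ring_map h"
  shows "meval h v (p + q) = meval h v p + meval h v q"
proof -
  let ?A = "Poly_Mapping.keys p \<union> Poly_Mapping.keys q"
  have "Poly_Mapping.keys (p + q) \<subseteq> ?A" by (rule Poly_Mapping.keys_add)
  then show ?thesis
    using meval_superset[of h ?A _ v] ring_map_simps[OF assms]
    by (simp add: lookup_add sum.distrib algebra_simps)
qed

lemma meval_single:
  assumes "ring_map h"
  shows "meval h v (Poly_Mapping.single m c) = h c * monom_val v m"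
  using meval_superset[of h "{m}" "Poly_Mapping.single m c" v] ring_map_simps[OF assms] by simp

lemma ring_map_meval:
  assumes "ring_map h"
  shows "ring_map (meval h v)"
proof -
  have "meval h v (p * q) = meval h v p * meval h v q" for p q
  proof (induction p rule: mpoly_induct)
    case (single m c)
    show ?case
    proof (induction q rule: mpoly_induct)
      case (single m' c')
      then show ?case
        by (simp add: meval_single[OF assms] mult_single ring_map_simps[OF assms] monom_val_add algebra_simps)
    qed (simp add: meval_add[OF assms] algebra_simps)
  qed (simp add: meval_add[OF assms] algebra_simps)
  moreover have "meval h v 1 = 1"
    using meval_single[OF assms, of v 0 1] ring_map_simps[OF assms] by simp
  ultimately show ?thesis by (simp add: ring_map_def meval_add[OF assms])
qed

lemma meval_pvar: "ring_map h \<Longrightarrow> meval h v (pvar i) = v i"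
  by (simp add: pvar_def meval_single ring_map_simps)

lemma meval_const: "ring_map h \<Longrightarrow> meval h v (const c) = h c"
  by (simp add: const_def meval_single)

lemma ring_map_comp_meval:
  assumes "ring_map H"
  shows "H (meval h v p) = meval (\<lambda>c. H (h c)) (\<lambda>i. H (v i)) p"
  by (simp add: meval_def monom_val_def ring_map_simps[OF assms])

lemma poly_eval_conv_meval: "poly_eval v = meval (\<lambda>x. x) v"
  by (simp add: fun_eq_iff poly_eval_def meval_def monom_val_def)

lemma substitute_conv_meval: "substitute \<sigma> = meval const \<sigma>"
  by (simp add: fun_eq_iff substitute_def meval_def monom_val_def)

lemma ring_map_poly_eval: "ring_map (poly_eval v)" and ring_map_substitute: "ring_map (substitute \<sigma>)"
  by (simp_all add: poly_eval_conv_meval substitute_conv_meval ring_map_meval ring_map_id ring_map_const)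

lemmas poly_eval_simps = ring_map_simps[OF ring_map_poly_eval]
lemmas substitute_simps = ring_map_simps[OF ring_map_substitute]

lemma poly_eval_pvar [simp]: "poly_eval v (pvar i) = v i"
  and poly_eval_const [simp]: "poly_eval v (const c) = c"
  by (simp_all add: poly_eval_conv_meval ring_map_id meval_pvar meval_const)

lemma substitute_pvar [simp]: "substitute \<sigma> (pvar i) = \<sigma> i"
  and substitute_const [simp]: "substitute \<sigma> (const c) = const c"
  by (simp_all add: substitute_conv_meval ring_map_const meval_pvar meval_const)

lemma monom_val_pvar: "monom_val pvar m = Poly_Mapping.single m 1"
proof -
  have *: "pvar i ^ k = Poly_Mapping.single (Poly_Mapping.single i k) 1" for i k
    by (induction k) (simp_all add: pvar_def mult_single flip: single_add)
  have "(\<Prod>i\<in>A. pvar i ^ f i) = Poly_Mapping.single (\<Sum>i\<in>A. Poly_Mapping.single i (f i)) 1"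
    if "finite A" for A and f :: "nat \<Rightarrow> nat"
    using that by induction (simp_all add: * mult_single)
  moreover have "m = (\<Sum>i\<in>Poly_Mapping.keys m. Poly_Mapping.single i (Poly_Mapping.lookup m i))"
    by (rule poly_mapping_eqI) (auto simp: lookup_sum lookup_single when_def in_keys_iff)
  ultimately show ?thesis by (simp add: monom_val_def)
qed

section \<open>Degrees of monomials and spaces of forms\<close>

lemma mon_degree_superset:
  assumes "finite A" "Poly_Mapping.keys m \<subseteq> A"
  shows "mon_degree m = (\<Sum>i\<in>A. Poly_Mapping.lookup m i)"
  unfolding mon_degree_def using assms by (intro sum.mono_neutral_left) (auto simp: in_keys_iff)

lemma mon_degree_add [simp]: "mon_degree (m + m') = mon_degree m + mon_degree m'"
proof -
  let ?A = "Poly_Mapping.keys m \<union> Poly_Mapping.keys m'"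
  have "Poly_Mapping.keys (m + m') \<subseteq> ?A" by (rule Poly_Mapping.keys_add)
  then show ?thesis
    using mon_degree_superset[of ?A] by (simp add: lookup_add sum.distrib)
qed

lemma mon_degree_0 [simp]: "mon_degree 0 = 0" and mon_degree_single [simp]: "mon_degree (Poly_Mapping.single i k) = k"
  by (simp_all add: mon_degree_def)

lemma mon_degree_eq_0_iff [simp]: "mon_degree m = 0 \<longleftrightarrow> m = 0"
  by (auto simp: mon_degree_def in_keys_iff intro: poly_mapping_eqI)

lemma lookup_le_mon_degree: "Poly_Mapping.lookup m i \<le> mon_degree m"
  by (cases "i \<in> Poly_Mapping.keys m") (auto simp: mon_degree_def in_keys_iff intro: member_le_sum)

lemma keys_add_nat: "Poly_Mapping.keys (m + m') = Poly_Mapping.keys m \<union> Poly_Mapping.keys (m' :: nat \<Rightarrow>\<^sub>0 nat)"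
  by (auto simp: in_keys_iff lookup_add)

definition exponents :: "nat \<Rightarrow> nat \<Rightarrow> (nat \<Rightarrow>\<^sub>0 nat) set" where
  "exponents n e = {m. Poly_Mapping.keys m \<subseteq> {..n} \<and> mon_degree m = e}"

lemma exponent_split:
  assumes "j \<in> Poly_Mapping.keys (m :: nat \<Rightarrow>\<^sub>0 nat)"
  shows "Poly_Mapping.single j 1 + (m - Poly_Mapping.single j 1) = m"
  using assms by (intro poly_mapping_eqI) (auto simp: lookup_add lookup_minus lookup_single when_def in_keys_iff)

lemma exponents_Suc:
  assumes "m \<in> exponents n (Suc e)"
  obtains j m' where "j \<le> n" "m' \<in> exponents n e" "m = Poly_Mapping.single j 1 + m'"
proof -
  have "m \<noteq> 0" using assms by (auto simp: exponents_def)
  then obtain j where j: "j \<in> Poly_Mapping.keys m" by (metis all_not_in_conv keys_eq_empty)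
  note split = exponent_split[OF j]
  show thesis
    using assms j arg_cong[OF split, of mon_degree] arg_cong[OF split, of Poly_Mapping.keys] split
    by (intro that[of j "m - Poly_Mapping.single j 1"])
      (auto simp: exponents_def keys_add_nat simp del: exponent_split)
qed

lemma finite_exponents: "finite (exponents n e)"
proof (induction e)
  case 0
  have "exponents n 0 = {0}" by (auto simp: exponents_def)
  then show ?case by simp
next
  case (Suc e)
  have "exponents n (Suc e) \<subseteq> (\<lambda>(j, m). Poly_Mapping.single j 1 + m) ` ({..n} \<times> exponents n e)"
    by (auto elim!: exponents_Suc)
  then show ?case using Suc by (meson finite_SigmaI finite_atMost finite_imageI finite_subset)
qed

lemma in_forms_iff: "p \<in> forms n e \<longleftrightarrow> Poly_Mapping.keys p \<subseteq> exponents n e"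
  by (auto simp: forms_def coord_ring_def exponents_def)

lemma subspace_forms: "mpoly_vs.subspace (forms n e)"
proof -
  have "p + q \<in> forms n e" if "p \<in> forms n e" "q \<in> forms n e" for p q
    using that Poly_Mapping.keys_add[of p q] by (auto simp: in_forms_iff)
  moreover have "const c * p \<in> forms n e" if "p \<in> forms n e" for c p
    using that keys_const_mult[of c p] by (auto simp: in_forms_iff)
  ultimately show ?thesis
    by (simp add: mpoly_vs.subspace_def) (simp add: in_forms_iff)
qed

lemma single_in_forms: "m \<in> exponents n e \<Longrightarrow> Poly_Mapping.single m c \<in> forms n e"
  by (auto simp: in_forms_iff)

lemma forms_subset_span: "forms n e \<subseteq> mpoly_vs.span ((\<lambda>m. Poly_Mapping.single m 1) ` exponents n e)"
proof
  fix p assume "p \<in> forms n e"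
  then have "(\<Sum>m\<in>Poly_Mapping.keys p. const (Poly_Mapping.lookup p m) * Poly_Mapping.single m 1)
    \<in> mpoly_vs.span ((\<lambda>m. Poly_Mapping.single m 1) ` exponents n e)"
    by (intro mpoly_vs.span_sum mpoly_vs.span_scale mpoly_vs.span_base) (auto simp: in_forms_iff)
  then show "p \<in> mpoly_vs.span ((\<lambda>m. Poly_Mapping.single m 1) ` exponents n e)"
    by (simp add: mpoly_sum_monomials flip: single_conv_const)
qed

lemma forms_fin_span: obtains B where "finite B" "forms n e \<subseteq> mpoly_vs.span B"
  using that[OF _ forms_subset_span] finite_exponents by simp

lemma subspace_forms_induct [consumes 1, case_names subspace monomial]:
  assumes "p \<in> forms n e" "mpoly_vs.subspace {p. P p}"
    "\<And>m. m \<in> exponents n e \<Longrightarrow> P (Poly_Mapping.single m 1)"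
  shows "P p"
  using mpoly_vs.span_induct[of p "(\<lambda>m. Poly_Mapping.single m 1) ` exponents n e" P]
    assms forms_subset_span by auto

lemma exponents_add: "m \<in> exponents n a \<Longrightarrow> m' \<in> exponents n b \<Longrightarrow> m + m' \<in> exponents n (a + b)"
  by (auto simp: exponents_def keys_add_nat)

lemma forms_mult:
  assumes "p \<in> forms n a" "q \<in> forms n b"
  shows "p * q \<in> forms n (a + b)"
  using keys_mult[of p q] assms exponents_add unfolding in_forms_iff by blast

lemma forms_carrier: "p \<in> forms n e \<Longrightarrow> p \<in> carrier (coord_ring n)"
  by (simp add: forms_def)

lemma pvar_in_forms: "i \<le> n \<Longrightarrow> pvar i \<in> forms n 1"
  unfolding pvar_def by (rule single_in_forms) (auto simp: exponents_def)

lemma const_in_forms: "const c \<in> forms n 0"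
  unfolding const_def by (rule single_in_forms) (auto simp: exponents_def)

lemma one_in_forms: "1 \<in> forms n 0" using const_in_forms[of 1] by simp

lemma forms_0: "p \<in> forms n 0 \<Longrightarrow> p = const (Poly_Mapping.lookup p 0)"
  by (rule poly_mapping_eqI) (auto simp: const_def lookup_single when_def in_forms_iff exponents_def in_keys_iff)

lemma forms_power: "p \<in> forms n a \<Longrightarrow> p ^ k \<in> forms n (k * a)"
  by (induction k) (auto simp: one_in_forms intro: forms_mult)

lemmas forms_add = mpoly_vs.subspace_add[OF subspace_forms]
lemmas forms_diff = mpoly_vs.subspace_diff[OF subspace_forms]
lemmas forms_scale = mpoly_vs.subspace_scale[OF subspace_forms]
lemmas forms_zero = mpoly_vs.subspace_0[OF subspace_forms]
lemmas forms_sum = mpoly_vs.subspace_sum[OF subspace_forms]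

section \<open>Homogeneous components\<close>

definition hcomp :: "nat \<Rightarrow> mpoly \<Rightarrow> mpoly" where
  "hcomp e p = (\<Sum>m\<in>{m \<in> Poly_Mapping.keys p. mon_degree m = e}. Poly_Mapping.single m (Poly_Mapping.lookup p m))"

lemma lookup_hcomp: "Poly_Mapping.lookup (hcomp e p) m = (if mon_degree m = e then Poly_Mapping.lookup p m else 0)"
  by (auto simp: hcomp_def lookup_sum lookup_single when_def in_keys_iff)

lemma hcomp_add: "hcomp e (p + q) = hcomp e p + hcomp e q"
  by (rule poly_mapping_eqI) (simp add: lookup_hcomp lookup_add)

lemma hcomp_0 [simp]: "hcomp e 0 = 0"
  by (rule poly_mapping_eqI) (simp add: lookup_hcomp)

lemma hcomp_single: "hcomp e (Poly_Mapping.single m c) = (if mon_degree m = e then Poly_Mapping.single m c else 0)"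
  by (rule poly_mapping_eqI) (auto simp: lookup_hcomp lookup_single when_def)

lemma hcomp_forms: "p \<in> forms n a \<Longrightarrow> hcomp e p = (if e = a then p else 0)"
  by (rule poly_mapping_eqI) (auto simp: lookup_hcomp in_forms_iff exponents_def in_keys_iff)

lemma hcomp_in_forms: "p \<in> carrier (coord_ring n) \<Longrightarrow> hcomp e p \<in> forms n e"
  by (auto simp: in_forms_iff exponents_def coord_ring_def in_keys_iff lookup_hcomp split: if_splits)

lemma hcomp_mult: "hcomp e (p * q) = (\<Sum>i\<le>e. hcomp i p * hcomp (e - i) q)"
proof (induction p rule: mpoly_induct)
  case (single m c)
  show ?case
  proof (induction q rule: mpoly_induct)
    case (single m' c')
    have "(\<Sum>i\<le>e. hcomp i (Poly_Mapping.single m c) * hcomp (e - i) (Poly_Mapping.single m' c')) =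
      (\<Sum>i\<le>e. if i = mon_degree m then Poly_Mapping.single m c * hcomp (e - mon_degree m) (Poly_Mapping.single m' c') else 0)"
      by (intro sum.cong) (auto simp: hcomp_single)
    also have "\<dots> = (if mon_degree m + mon_degree m' = e then Poly_Mapping.single m c * Poly_Mapping.single m' c' else 0)"
      by (auto simp: sum.delta hcomp_single)
    finally show ?case by (simp add: mult_single hcomp_single)
  qed (simp add: hcomp_add algebra_simps sum.distrib)
qed (simp add: hcomp_add algebra_simps sum.distrib)

lemma hcomp_eventually_0: "\<exists>D. \<forall>e>D. hcomp e p = 0"
proof (intro exI allI impI)
  fix e assume "e > Max (insert 0 (mon_degree ` Poly_Mapping.keys p))"
  then show "hcomp e p = 0"
    by (intro poly_mapping_eqI) (auto simp: lookup_hcomp in_keys_iff)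
qed

lemma sum_hcomp:
  assumes "\<And>e. e > D \<Longrightarrow> hcomp e p = 0"
  shows "(\<Sum>e\<le>D. hcomp e p) = p"
proof (rule poly_mapping_eqI)
  fix m
  have "Poly_Mapping.lookup p m = 0" if "mon_degree m > D"
    using arg_cong[OF assms[OF that], of "\<lambda>q. Poly_Mapping.lookup q m"] by (simp add: lookup_hcomp)
  then show "Poly_Mapping.lookup (\<Sum>e\<le>D. hcomp e p) m = Poly_Mapping.lookup p m"
    by (auto simp: lookup_sum lookup_hcomp sum.delta' not_le)
qed

text \<open>The tool for inductions on the degree: a statement about forms passes from
  \<open>q j\<close> to \<open>p\<close> once it is compatible with sums and with multiplication by
  a variable.\<close>

lemma forms_Suc_decompose:
  assumes "p \<in> forms n (Suc e)"
  obtains q where "\<And>j. j \<le> n \<Longrightarrow> q j \<in> forms n e" "p = (\<Sum>j\<le>n. pvar j * q j)"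
proof -
  let ?P = "\<lambda>p. \<exists>q. (\<forall>j\<le>n. q j \<in> forms n e) \<and> p = (\<Sum>j\<le>n. pvar j * q j)"
  have "?P p" using assms
  proof (induction rule: subspace_forms_induct)
    have "?P (p + p')" if "?P p" "?P p'" for p p'
    proof -
      obtain q q' where "\<forall>j\<le>n. q j \<in> forms n e" "p = (\<Sum>j\<le>n. pvar j * q j)"
        "\<forall>j\<le>n. q' j \<in> forms n e" "p' = (\<Sum>j\<le>n. pvar j * q' j)" using \<open>?P p\<close> \<open>?P p'\<close> by blast
      then show ?thesis by (intro exI[of _ "\<lambda>j. q j + q' j"]) (auto simp: forms_add algebra_simps sum.distrib)
    qed
    moreover have "?P (const c * p)" if "?P p" for c p
    proof -
      obtain q where "\<forall>j\<le>n. q j \<in> forms n e" "p = (\<Sum>j\<le>n. pvar j * q j)" using \<open>?P p\<close> by blast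
      then show ?thesis
        by (intro exI[of _ "\<lambda>j. const c * q j"]) (auto simp: forms_scale algebra_simps sum_distrib_left)
    qed
    moreover have "?P 0" by (rule exI[of _ "\<lambda>j. 0"]) (auto simp: forms_zero)
    ultimately show "mpoly_vs.subspace {p. ?P p}" by (auto simp: mpoly_vs.subspace_def)
  next
    case (monomial m)
    then obtain j m' where j: "j \<le> n" "m' \<in> exponents n e" "m = Poly_Mapping.single j 1 + m'"
      by (rule exponents_Suc)
    then have "Poly_Mapping.single m 1 = (\<Sum>l\<le>n. pvar l * (if l = j then Poly_Mapping.single m' 1 else 0))"
      by (simp add: if_distrib[of "\<lambda>q. _ * q"] cong: if_cong) (simp add: pvar_def mult_single)
    then show ?case using j
      by (intro exI[of _ "\<lambda>l. if l = j then Poly_Mapping.single m' 1 else 0"]) (auto simp: single_in_forms forms_zero)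
  qed
  then show thesis using that by blast
qed

section \<open>Linear maps prescribed on monomials\<close>

definition lin_ext :: "((nat \<Rightarrow>\<^sub>0 nat) \<Rightarrow> mpoly) \<Rightarrow> mpoly \<Rightarrow> mpoly" where
  "lin_ext F p = (\<Sum>m\<in>Poly_Mapping.keys p. const (Poly_Mapping.lookup p m) * F m)"

lemma lin_ext_superset:
  assumes "finite A" "Poly_Mapping.keys p \<subseteq> A"
  shows "lin_ext F p = (\<Sum>m\<in>A. const (Poly_Mapping.lookup p m) * F m)"
  unfolding lin_ext_def using assms by (intro sum.mono_neutral_left) (auto simp: in_keys_iff)

lemma lin_ext_single [simp]: "lin_ext F (Poly_Mapping.single m c) = const c * F m"
  using lin_ext_superset[of "{m}" "Poly_Mapping.single m c" F] by simp

abbreviation mpoly_linear :: "(mpoly \<Rightarrow> mpoly) \<Rightarrow> bool" where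
  "mpoly_linear \<equiv> Vector_Spaces.linear (\<lambda>c p. const c * p) (\<lambda>c p. const c * p)"

lemma mpoly_linearI:
  assumes "\<And>p q. T (p + q) = T p + T q" "\<And>c p. T (const c * p) = const c * T p"
  shows "mpoly_linear T"
  using assms by (simp add: Vector_Spaces.linear_iff mpoly_vs.vector_space_axioms)

lemma mpoly_linearD:
  assumes "mpoly_linear T"
  shows "T (p + q) = T p + T q" "T (const c * p) = const c * T p" "T 0 = 0" "T (p - q) = T p - T q"
    "T (sum f A) = (\<Sum>x\<in>A. T (f x))"
proof -
  interpret T: Vector_Spaces.linear "\<lambda>c p. const c * p" "\<lambda>c p. const c * p" T by fact
  show "T (p + q) = T p + T q" "T (const c * p) = const c * T p" "T 0 = 0" "T (p - q) = T p - T q"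
    "T (sum f A) = (\<Sum>x\<in>A. T (f x))"
    using T.add T.scale T.zero T.diff T.sum by auto
qed

lemma linear_lin_ext: "mpoly_linear (lin_ext F)"
proof (rule mpoly_linearI)
  fix p q :: mpoly and c
  let ?A = "Poly_Mapping.keys p \<union> Poly_Mapping.keys q"
  show "lin_ext F (p + q) = lin_ext F p + lin_ext F q"
    using Poly_Mapping.keys_add[of p q]
    by (simp add: lin_ext_superset[of ?A p] lin_ext_superset[of ?A q] lin_ext_superset[of ?A "p + q"]
        lookup_add const_add distrib_right sum.distrib)
  show "lin_ext F (const c * p) = const c * lin_ext F p"
    unfolding lin_ext_superset[OF finite_keys keys_const_mult, of F c p] lookup_const_mult const_mult
    unfolding lin_ext_def sum_distrib_left by (simp only: mult.assoc)
qed

lemma linear_mult: "mpoly_linear (\<lambda>p. f * p)"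
  by (rule mpoly_linearI) (auto simp: algebra_simps)

section \<open>Graded ideals\<close>

text \<open>Homogeneous ideals are handled through the families of their graded pieces.\<close>

definition gideal :: "nat \<Rightarrow> (nat \<Rightarrow> mpoly set) \<Rightarrow> bool" where
  "gideal n J \<longleftrightarrow> (\<forall>e. mpoly_vs.subspace (J e) \<and> J e \<subseteq> forms n e) \<and>
     (\<forall>e a p q. p \<in> J e \<longrightarrow> q \<in> forms n a \<longrightarrow> q * p \<in> J (a + e))"

lemma gidealD:
  assumes "gideal n J"
  shows "mpoly_vs.subspace (J e)" "J e \<subseteq> forms n e" "p \<in> J e \<Longrightarrow> q \<in> forms n a \<Longrightarrow> q * p \<in> J (a + e)"
    "p \<in> J e \<Longrightarrow> q \<in> forms n a \<Longrightarrow> q * p \<in> J (e + a)"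
    "p \<in> J e \<Longrightarrow> p \<in> forms n e" "0 \<in> J e" "p \<in> J e \<Longrightarrow> q \<in> J e \<Longrightarrow> p + q \<in> J e"
    "p \<in> J e \<Longrightarrow> q \<in> J e \<Longrightarrow> p - q \<in> J e" "p \<in> J e \<Longrightarrow> const c * p \<in> J e"
    "(\<And>x. x \<in> A \<Longrightarrow> f x \<in> J e) \<Longrightarrow> sum f A \<in> J e"
proof -
  show sub: "mpoly_vs.subspace (J e)" and "J e \<subseteq> forms n e"
    and "p \<in> J e \<Longrightarrow> q \<in> forms n a \<Longrightarrow> q * p \<in> J (a + e)"
    using assms unfolding gideal_def by blast+
  then show "p \<in> J e \<Longrightarrow> q \<in> forms n a \<Longrightarrow> q * p \<in> J (e + a)" "p \<in> J e \<Longrightarrow> p \<in> forms n e"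
    by (auto simp: add.commute)
  show "0 \<in> J e" "p \<in> J e \<Longrightarrow> q \<in> J e \<Longrightarrow> p + q \<in> J e"
    "p \<in> J e \<Longrightarrow> q \<in> J e \<Longrightarrow> p - q \<in> J e" "p \<in> J e \<Longrightarrow> const c * p \<in> J e"
    "(\<And>x. x \<in> A \<Longrightarrow> f x \<in> J e) \<Longrightarrow> sum f A \<in> J e"
    using mpoly_vs.subspace_add[OF sub] mpoly_vs.subspace_diff[OF sub] mpoly_vs.subspace_scale[OF sub]
      mpoly_vs.subspace_0[OF sub] mpoly_vs.subspace_sum[OF sub, of A f] by blast+
qed

text \<open>The degree \<open>e\<close> piece of the shifted ring S(-a). The case distinction guards
  against truncated subtraction, which would turn degrees below \<open>a\<close> into degree
  0.\<close>

definition shifted_forms :: "nat \<Rightarrow> nat \<Rightarrow> nat \<Rightarrow> mpoly set" where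
  "shifted_forms n e a = (if a \<le> e then forms n (e - a) else {0})"

lemma subspace_shifted_forms: "mpoly_vs.subspace (shifted_forms n e a)"
  by (auto simp: shifted_forms_def subspace_forms)

lemma shifted_forms_mult:
  "q \<in> shifted_forms n e a \<Longrightarrow> p \<in> forms n b \<Longrightarrow> p * q \<in> shifted_forms n (b + e) a"
  using forms_mult[of p n b q "e - a"] by (auto simp: shifted_forms_def forms_zero split: if_splits)

lemma mult_shifted_forms:
  "q \<in> shifted_forms n e a \<Longrightarrow> f \<in> forms n a \<Longrightarrow> f * q \<in> forms n e"
  using forms_mult[of f n a q "e - a"] by (auto simp: shifted_forms_def forms_zero split: if_splits)

text \<open>The graded pieces of the ideal \<open>J + (f)\<close> for a form \<open>f\<close> of
  degree \<open>a\<close>.\<close>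

definition gsum :: "nat \<Rightarrow> (nat \<Rightarrow> mpoly set) \<Rightarrow> nat \<Rightarrow> mpoly \<Rightarrow> nat \<Rightarrow> mpoly set" where
  "gsum n J a f e = {p + f * q | p q. p \<in> J e \<and> q \<in> shifted_forms n e a}"

lemma gsumI: "p \<in> J e \<Longrightarrow> q \<in> shifted_forms n e a \<Longrightarrow> r = p + f * q \<Longrightarrow> r \<in> gsum n J a f e"
  by (auto simp: gsum_def)

lemma gsumE:
  assumes "r \<in> gsum n J a f e"
  obtains p q where "p \<in> J e" "q \<in> shifted_forms n e a" "r = p + f * q"
  using assms by (auto simp: gsum_def)

lemma gideal_gsum:
  assumes J: "gideal n J" and f: "f \<in> forms n a"
  shows "gideal n (gsum n J a f)"
  unfolding gideal_def
proof (intro conjI allI impI)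
  fix e
  show "gsum n J a f e \<subseteq> forms n e"
    using mult_shifted_forms[OF _ f] gidealD[OF J] forms_add by (auto elim!: gsumE)
  interpret L: Vector_Spaces.linear "\<lambda>c p. const c * p" "\<lambda>c p. const c * p" "\<lambda>q. f * q" by (rule linear_mult)
  have "mpoly_vs.subspace {x + y | x y. x \<in> J e \<and> y \<in> (\<lambda>q. f * q) ` shifted_forms n e a}"
    using mpoly_vs.subspace_sums[OF gidealD(1)[OF J, of e] L.subspace_image[OF subspace_shifted_forms]] .
  moreover have "{x + y | x y. x \<in> J e \<and> y \<in> (\<lambda>q. f * q) ` shifted_forms n e a} = gsum n J a f e"
    by (auto simp: gsum_def)
  ultimately show "mpoly_vs.subspace (gsum n J a f e)" by simp
next
  fix e b p q assume p: "p \<in> gsum n J a f e" and q: "q \<in> forms n b"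
  then obtain x y where xy: "x \<in> J e" "y \<in> shifted_forms n e a" "p = x + f * y" by (elim gsumE)
  show "q * p \<in> gsum n J a f (b + e)"
    using gidealD(3)[OF J xy(1) q] shifted_forms_mult[OF xy(2) q] xy(3)
    by (intro gsumI[of "q * x" _ _ "q * y"]) (auto simp: algebra_simps)
qed

lemma gsum_upper: "p \<in> J e \<Longrightarrow> p \<in> gsum n J a f e"
  using mpoly_vs.subspace_0[OF subspace_shifted_forms] by (intro gsumI[of p J e 0]) auto

lemma gsum_gen:
  assumes "gideal n J"
  shows "q \<in> forms n e \<Longrightarrow> f * q \<in> gsum n J a f (a + e)"
  using gidealD(6)[OF assms] by (intro gsumI[of 0 J _ q]) (auto simp: shifted_forms_def)

lemma gsum_gen1: "gideal n J \<Longrightarrow> f \<in> gsum n J a f a"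
  using gsum_gen[of n J 1 0 f a] one_in_forms by simp

lemma gsum_least:
  assumes "gideal n Y" "\<And>p. p \<in> J e \<Longrightarrow> p \<in> Y e" "f \<in> Y a" "p \<in> gsum n J a f e"
  shows "p \<in> Y e"
proof -
  obtain x y where xy: "x \<in> J e" "y \<in> shifted_forms n e a" "p = x + f * y" using assms(4) by (elim gsumE)
  have "f * y \<in> Y e"
    using xy(2) gidealD(3)[OF assms(1,3), of y "e - a"] gidealD(6)[OF assms(1)]
    by (auto simp: shifted_forms_def algebra_simps split: if_splits)
  then show ?thesis using xy assms(1,2) gidealD(7) by blast
qed

lemma gsum_mono: "(\<And>e p. p \<in> J e \<Longrightarrow> p \<in> J' e) \<Longrightarrow> p \<in> gsum n J a f e \<Longrightarrow> p \<in> gsum n J' a f e"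
  by (auto simp: gsum_def)

lemma gsum_commute: "gsum n (gsum n J a f) b g = gsum n (gsum n J b g) a f"
proof -
  have "gsum n (gsum n J a f) b g e \<subseteq> gsum n (gsum n J b g) a f e" for a b f g e
  proof
    fix r assume "r \<in> gsum n (gsum n J a f) b g e"
    then obtain x y z where "x \<in> J e" "y \<in> shifted_forms n e a" "z \<in> shifted_forms n e b" "r = x + f * y + g * z"
      by (auto elim!: gsumE)
    then show "r \<in> gsum n (gsum n J b g) a f e"
      by (intro gsumI[of "x + g * z" _ _ y] gsumI[of x _ _ z]) (auto simp: algebra_simps)
  qed
  then show ?thesis by (intro ext subset_antisym)
qed

text \<open>The ideal generated by a list of forms, each tagged with its degree because the zero
  form has no degree of its own. The recursion exposes the ideal of the tail, modulo which the head
  will be tested for regularity.\<close>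

fun gen :: "nat \<Rightarrow> (nat \<times> mpoly) list \<Rightarrow> nat \<Rightarrow> mpoly set" where
  "gen n [] = (\<lambda>e. {0})"
| "gen n ((a, f) # fs) = gsum n (gen n fs) a f"

definition form_list :: "nat \<Rightarrow> (nat \<times> mpoly) list \<Rightarrow> bool" where
  "form_list n fs \<longleftrightarrow> (\<forall>(a, f)\<in>set fs. f \<in> forms n a)"

lemma form_list_simps [simp]: "form_list n []" "form_list n ((a, f) # fs) \<longleftrightarrow> f \<in> forms n a \<and> form_list n fs"
  "form_list n (fs @ gs) \<longleftrightarrow> form_list n fs \<and> form_list n gs"
  by (auto simp: form_list_def)

lemma gideal_gen: "form_list n fs \<Longrightarrow> gideal n (gen n fs)"
proof (induction fs)
  case Nil
  then show ?case by (auto simp: gideal_def forms_zero)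
qed (auto intro: gideal_gsum)

lemma gen_least:
  assumes "gideal n Y" "\<And>a f. (a, f) \<in> set fs \<Longrightarrow> f \<in> Y a" "p \<in> gen n fs e"
  shows "p \<in> Y e"
  using assms(2,3)
proof (induction fs arbitrary: p e)
  case Nil
  then show ?case using gidealD(6)[OF assms(1)] by simp
next
  case (Cons x fs)
  then show ?case using gsum_least[OF assms(1), of "gen n fs" e "snd x" "fst x" p] by (cases x) auto
qed

text \<open>Works within a single degree, for targets that are only linear, such as the preimage of
  an ideal under \<open>phi\<close>, which is not a ring homomorphism.\<close>

lemma gen_least_subspace:
  assumes "mpoly_vs.subspace Y" "\<And>a f q. (a, f) \<in> set fs \<Longrightarrow> q \<in> shifted_forms n e a \<Longrightarrow> f * q \<in> Y"
    "p \<in> gen n fs e"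
  shows "p \<in> Y"
  using assms(2,3)
proof (induction fs arbitrary: p)
  case Nil
  then show ?case using mpoly_vs.subspace_0[OF assms(1)] by simp
next
  case (Cons x fs)
  obtain a f where x: "x = (a, f)" by (cases x)
  then obtain y q where y: "y \<in> gen n fs e" "q \<in> shifted_forms n e a" "p = y + f * q"
    using Cons.prems by (auto elim: gsumE)
  then have "y \<in> Y" "f * q \<in> Y" using Cons x by auto
  then show ?case using y mpoly_vs.subspace_add[OF assms(1)] by blast
qed

lemma gen_generator: "form_list n fs \<Longrightarrow> (a, f) \<in> set fs \<Longrightarrow> f \<in> gen n fs a"
proof (induction fs)
  case (Cons x fs)
  then show ?case using gsum_gen1[OF gideal_gen, of n fs] gsum_upper[of f "gen n fs" a n]
    by (cases x) auto
qed simp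

lemma gen_move: "gen n (as @ z # cs) = gen n (z # as @ cs)"
proof (induction as)
  case (Cons x as)
  obtain a f b g where "x = (a, f)" "z = (b, g)" by (cases x, cases z)
  then show ?case using Cons by (simp add: gsum_commute[of n _ a f b g])
qed simp

text \<open>For a graded ideal this expresses that its projective scheme is empty.\<close>

definition eventually_full :: "nat \<Rightarrow> (nat \<Rightarrow> mpoly set) \<Rightarrow> bool" where
  "eventually_full n J \<longleftrightarrow> (\<exists>N. \<forall>e\<ge>N. forms n e \<subseteq> J e)"

text \<open>Pigeonhole: a monomial whose degree exceeds the sum of the exponents \<open>N i\<close>
  is divisible by one of the powers \<open>pvar i ^ N i\<close>.\<close>

lemma eventually_fullI:
  assumes J: "gideal n J" and pw: "\<And>i. i \<le> n \<Longrightarrow> \<exists>N. pvar i ^ N \<in> J N"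
  shows "eventually_full n J"
proof -
  obtain N where N: "\<And>i. i \<le> n \<Longrightarrow> pvar i ^ N i \<in> J (N i)" using pw by metis
  have "forms n e \<subseteq> J e" if e: "e \<ge> Suc (\<Sum>i\<le>n. N i)" for e
  proof
    fix p assume "p \<in> forms n e"
    then show "p \<in> J e"
    proof (induction rule: subspace_forms_induct)
      show "mpoly_vs.subspace {p. p \<in> J e}" using gidealD(1)[OF J] by simp
    next
      case (monomial m)
      have deg: "(\<Sum>i\<le>n. Poly_Mapping.lookup m i) = e"
        using monomial mon_degree_superset[of "{..n}" m] by (auto simp: exponents_def)
      have "\<exists>i\<le>n. Poly_Mapping.lookup m i \<ge> N i"
      proof (rule ccontr)
        assume "\<not> ?thesis"
        then have "(\<Sum>i\<le>n. Poly_Mapping.lookup m i) \<le> (\<Sum>i\<le>n. N i)" by (intro sum_mono) auto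
        then show False using deg e by simp
      qed
      then obtain i where i: "i \<le> n" "Poly_Mapping.lookup m i \<ge> N i" by blast
      obtain m' where m: "m = m' + Poly_Mapping.single i (N i)"
      proof
        show "m = m - Poly_Mapping.single i (N i) + Poly_Mapping.single i (N i)"
          using i by (intro poly_mapping_eqI) (auto simp: lookup_add lookup_minus lookup_single when_def)
      qed
      have "m' \<in> exponents n (e - N i)"
        using monomial by (auto simp: exponents_def m keys_add_nat)
      then have "Poly_Mapping.single m' 1 * pvar i ^ N i \<in> J (e - N i + N i)"
        using single_in_forms gidealD(3)[OF J N] i by blast
      moreover have "Poly_Mapping.single m' 1 * pvar i ^ N i = Poly_Mapping.single m 1"
        using monom_val_add[of pvar m' "Poly_Mapping.single i (N i)"]
        by (simp add: m monom_val_pvar del: monom_val_single) (simp add: monom_val_pvar flip: monom_val_single)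
      moreover have "N i \<le> e" using i lookup_le_mon_degree[of m i] monomial by (auto simp: exponents_def)
      ultimately show ?case by simp
    qed
  qed
  then show ?thesis unfolding eventually_full_def by blast
qed

lemma eventually_full_mono: "eventually_full n J \<Longrightarrow> (\<And>e p. p \<in> J e \<Longrightarrow> p \<in> J' e) \<Longrightarrow> eventually_full n J'"
  unfolding eventually_full_def by blast

section \<open>Homogeneous primes\<close>

text \<open>Primality is tested on forms only; \<open>primeideal_tot\<close> extends it to arbitrary
  polynomials.\<close>

definition gprime :: "nat \<Rightarrow> (nat \<Rightarrow> mpoly set) \<Rightarrow> bool" where
  "gprime n P \<longleftrightarrow> gideal n P \<and> 1 \<notin> P 0 \<and>
     (\<forall>a b p q. p \<in> forms n a \<longrightarrow> q \<in> forms n b \<longrightarrow> p * q \<in> P (a + b) \<longrightarrow> p \<in> P a \<or> q \<in> P b)"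

lemma gprime_power:
  assumes "gprime n P" "p \<in> forms n a" "p ^ k \<in> P (k * a)"
  shows "p \<in> P a"
  using assms(3)
proof (induction k)
  case 0
  then show ?case using assms(1) by (simp add: gprime_def)
next
  case (Suc k)
  then show ?case using assms(1,2) forms_power[OF assms(2), of k] by (auto simp: gprime_def)
qed

text \<open>The usual prime avoidance, in graded form: a graded ideal that is maximal among those
  disjoint from a multiplicative set is prime.\<close>

lemma gprime_exists:
  assumes J: "gideal n J"
    and U: "\<And>e u. (e, u) \<in> U \<Longrightarrow> u \<in> forms n e" "(0, 1) \<in> U"
      "\<And>e u e' u'. (e, u) \<in> U \<Longrightarrow> (e', u') \<in> U \<Longrightarrow> (e + e', u * u') \<in> U"
    and avoid: "\<And>e u. (e, u) \<in> U \<Longrightarrow> u \<notin> J e"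
  obtains P where "gprime n P" "\<And>e p. p \<in> J e \<Longrightarrow> p \<in> P e" "\<And>e u. (e, u) \<in> U \<Longrightarrow> u \<notin> P e"
proof -
  \<comment> \<open>A graded family is encoded as the set of its pairs of degree and element, so
    that Zorn's lemma applies to plain inclusion.\<close>
  define slice :: "(nat \<times> mpoly) set \<Rightarrow> nat \<Rightarrow> mpoly set" where "slice Z e = {p. (e, p) \<in> Z}" for Z e
  define A where "A = {Z. gideal n (slice Z) \<and> (\<forall>e. J e \<subseteq> slice Z e) \<and> Z \<inter> U = {}}"
  have "\<exists>M\<in>A. \<forall>X\<in>A. M \<subseteq> X \<longrightarrow> X = M"
  proof (rule subset_Zorn_nonempty)
    have "slice {(e, p). p \<in> J e} = J" by (auto simp: slice_def)
    then have "{(e, p). p \<in> J e} \<in> A" using J avoid by (auto simp: A_def)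
    then show "A \<noteq> {}" by blast
  next
    fix C assume C: "C \<noteq> {}" "subset.chain A C"
    then have CA: "\<And>Z. Z \<in> C \<Longrightarrow> Z \<in> A" by (auto simp: subset_chain_def)
    have two: "\<exists>Z\<in>C. x \<in> Z \<and> y \<in> Z" if "x \<in> \<Union>C" "y \<in> \<Union>C" for x y
    proof -
      obtain X Y where "X \<in> C" "x \<in> X" "Y \<in> C" "y \<in> Y" using \<open>x \<in> \<Union>C\<close> \<open>y \<in> \<Union>C\<close> by blast
      moreover from this have "X \<subseteq> Y \<or> Y \<subseteq> X" using C(2) by (auto simp: subset_chain_def)
      ultimately show ?thesis by blast
    qed
    obtain Z0 where Z0: "Z0 \<in> C" using C by blast
    have "gideal n (slice (\<Union>C))"
      unfolding gideal_def
    proof (intro conjI allI impI)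
      fix e
      show "slice (\<Union>C) e \<subseteq> forms n e"
        using CA gidealD(2) by (fastforce simp: slice_def A_def)
      show "mpoly_vs.subspace (slice (\<Union>C) e)"
        unfolding mpoly_vs.subspace_def
      proof (intro conjI ballI allI)
        have "0 \<in> slice Z0 e" using CA[OF Z0] gidealD(6) by (auto simp: A_def)
        then show "0 \<in> slice (\<Union>C) e" using Z0 by (auto simp: slice_def)
      next
        fix x y assume "x \<in> slice (\<Union>C) e" "y \<in> slice (\<Union>C) e"
        then obtain Z where Z: "Z \<in> C" "x \<in> slice Z e" "y \<in> slice Z e"
          using two[of "(e, x)" "(e, y)"] by (auto simp: slice_def)
        then have "x + y \<in> slice Z e" using CA[OF Z(1)] gidealD(7)[of n "slice Z" x e y] by (auto simp: A_def)
        then show "x + y \<in> slice (\<Union>C) e" using Z by (auto simp: slice_def)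
      next
        fix c x assume "x \<in> slice (\<Union>C) e"
        then obtain Z where Z: "Z \<in> C" "x \<in> slice Z e" by (auto simp: slice_def)
        then have "const c * x \<in> slice Z e" using CA[OF Z(1)] gidealD(9)[of n "slice Z" x e c] by (auto simp: A_def)
        then show "const c * x \<in> slice (\<Union>C) e" using Z by (auto simp: slice_def)
      qed
    next
      fix e a p q assume "p \<in> slice (\<Union>C) e" and q: "q \<in> forms n a"
      then obtain Z where Z: "Z \<in> C" "p \<in> slice Z e" by (auto simp: slice_def)
      then have "q * p \<in> slice Z (a + e)" using CA[OF Z(1)] gidealD(3)[of n "slice Z" p e q a] q by (auto simp: A_def)
      then show "q * p \<in> slice (\<Union>C) (a + e)" using Z by (auto simp: slice_def)
    qed
    moreover have "J e \<subseteq> slice (\<Union>C) e" for e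
      using CA[OF Z0] Z0 by (fastforce simp: A_def slice_def)
    moreover have "\<Union>C \<inter> U = {}" using CA by (auto simp: A_def)
    ultimately show "\<Union>C \<in> A" by (simp add: A_def)
  qed
  then obtain M where M: "M \<in> A" "\<And>X. X \<in> A \<Longrightarrow> M \<subseteq> X \<Longrightarrow> X = M" by blast
  define P where "P = slice M"
  have P: "gideal n P" "\<And>e p. p \<in> J e \<Longrightarrow> p \<in> P e" "\<And>e u. (e, u) \<in> U \<Longrightarrow> u \<notin> P e"
    using M(1) by (auto simp: A_def P_def slice_def)
  \<comment> \<open>By maximality, adjoining any form outside \<open>P\<close> produces an element
    of \<open>U\<close>. If neither \<open>p\<close> nor \<open>q\<close> were in \<open>P\<close>,
    the product of two such elements would lie in \<open>P + (p q) = P\<close> and in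
    \<open>U\<close>.\<close>
  have hit: "\<exists>e u. (e, u) \<in> U \<and> u \<in> gsum n P a p e" if p: "p \<in> forms n a" "p \<notin> P a" for a p
  proof (rule ccontr)
    assume none: "\<not> ?thesis"
    let ?X = "{(e, q). q \<in> gsum n P a p e}"
    have "slice ?X = gsum n P a p" by (auto simp: slice_def)
    then have "?X \<in> A"
      using gideal_gsum[OF P(1) p(1)] P(2) none gsum_upper[of _ P] by (auto simp: A_def)
    moreover have "M \<subseteq> ?X" using gsum_upper[of _ P _ n a p] by (auto simp: P_def slice_def)
    ultimately have "?X = M" by (rule M(2))
    then show False using gsum_gen1[OF P(1), of p a] p(2) by (auto simp: P_def slice_def)
  qed
  have "p \<in> P a \<or> q \<in> P b" if pq: "p \<in> forms n a" "q \<in> forms n b" "p * q \<in> P (a + b)" for a b p q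
  proof (rule ccontr)
    assume "\<not> ?thesis"
    then obtain e u e' u' where u: "(e, u) \<in> U" "u \<in> gsum n P a p e" "(e', u') \<in> U" "u' \<in> gsum n P b q e'"
      using hit[OF pq(1)] hit[OF pq(2)] by metis
    obtain x y where xy: "x \<in> P e" "y \<in> shifted_forms n e a" "u = x + p * y"
      using u(2) by (elim gsumE)
    obtain x' y' where xy': "x' \<in> P e'" "y' \<in> shifted_forms n e' b" "u' = x' + q * y'"
      using u(4) by (elim gsumE)
    have "u * u' = x * u' + p * y * x' + p * q * (y * y')"
      by (simp add: xy(3) xy'(3) algebra_simps)
    moreover have "u' * x \<in> P (e' + e)" using gidealD(3)[OF P(1) xy(1) U(1)[OF u(3)]] .
    moreover have "(p * y) * x' \<in> P (e + e')"
      using gidealD(3)[OF P(1) xy'(1) mult_shifted_forms[OF xy(2) pq(1)]] .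
    moreover have "(y * y') * (p * q) \<in> P (e + e')"
    proof (cases "a \<le> e \<and> b \<le> e'")
      case True
      then have "y * y' \<in> forms n (e - a + (e' - b))"
        using xy xy' by (intro forms_mult) (auto simp: shifted_forms_def)
      then have "(y * y') * (p * q) \<in> P (e - a + (e' - b) + (a + b))"
        by (rule gidealD(3)[OF P(1) pq(3)])
      then show ?thesis using True by (simp add: algebra_simps)
    next
      case False
      then have "y * y' = 0" using xy xy' by (auto simp: shifted_forms_def)
      then show ?thesis using gidealD(6)[OF P(1)] by auto
    qed
    ultimately have "u * u' \<in> P (e + e')"
      using gidealD(7)[OF P(1)] by (simp add: mult.commute add.commute)
    then show False using P(3) U(3)[OF u(1,3)] by blast
  qed
  then have "gprime n P" using P U(2) by (auto simp: gprime_def)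
  then show thesis using P that by blast
qed

section \<open>From graded families to ideals of the coordinate ring\<close>

definition tot :: "nat \<Rightarrow> (nat \<Rightarrow> mpoly set) \<Rightarrow> mpoly set" where
  "tot n J = {p \<in> carrier (coord_ring n). \<forall>e. hcomp e p \<in> J e}"

lemma coord_ring_closed:
  assumes "p \<in> carrier (coord_ring n)" "q \<in> carrier (coord_ring n)"
  shows "p + q \<in> carrier (coord_ring n)" "p * q \<in> carrier (coord_ring n)" "- p \<in> carrier (coord_ring n)"
proof -
  interpret cring "coord_ring n" by (rule cring_coord_ring)
  show "p + q \<in> carrier (coord_ring n)" using a_closed[OF assms] by simp
  show "p * q \<in> carrier (coord_ring n)" using m_closed[OF assms] by simp
  show "- p \<in> carrier (coord_ring n)" using assms(1) by (simp add: coord_ring_def)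
qed

lemma coord_ring_a_inv:
  assumes "p \<in> carrier (coord_ring n)"
  shows "\<ominus>\<^bsub>coord_ring n\<^esub> p = - p"
proof -
  interpret cring "coord_ring n" by (rule cring_coord_ring)
  show ?thesis
    using minus_equality[of "- p" p] assms coord_ring_closed(3)[OF assms assms] by simp
qed

lemma idealI_coord_ring:
  assumes "I \<subseteq> carrier (coord_ring n)" "0 \<in> I" "\<And>p q. p \<in> I \<Longrightarrow> q \<in> I \<Longrightarrow> p + q \<in> I"
    "\<And>p q. p \<in> I \<Longrightarrow> q \<in> carrier (coord_ring n) \<Longrightarrow> q * p \<in> I"
  shows "ideal I (coord_ring n)"
proof -
  interpret cring "coord_ring n" by (rule cring_coord_ring)
  have "- p \<in> I" if "p \<in> I" for p
    using assms(4)[OF that, of "- 1"] by (simp add: coord_ring_def)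
  note uminus = this
  show ?thesis
  proof (rule idealI[OF ring_axioms])
    have sub: "p \<in> carrier (coord_ring n)" if "p \<in> I" for p using assms(1) that by blast
    show "subgroup I (add_monoid (coord_ring n))"
    proof (rule add.subgroupI)
      show "I \<subseteq> carrier (coord_ring n)" "I \<noteq> {}" using assms(1,2) by auto
      show "\<ominus>\<^bsub>coord_ring n\<^esub> a \<in> I" if "a \<in> I" for a
        using coord_ring_a_inv[OF sub[OF that]] uminus[OF that] by simp
      show "a \<oplus>\<^bsub>coord_ring n\<^esub> b \<in> I" if "a \<in> I" "b \<in> I" for a b
        using assms(3)[OF that] by simp
    qed
    show "x \<otimes>\<^bsub>coord_ring n\<^esub> a \<in> I" "a \<otimes>\<^bsub>coord_ring n\<^esub> x \<in> I"
      if "a \<in> I" "x \<in> carrier (coord_ring n)" for a x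
      using assms(4)[OF that] by (simp_all add: mult.commute)
  qed
qed

lemma ideal_coord_ringD:
  assumes "ideal I (coord_ring n)"
  shows "I \<subseteq> carrier (coord_ring n)" "0 \<in> I" "p \<in> I \<Longrightarrow> q \<in> I \<Longrightarrow> p + q \<in> I"
    "p \<in> I \<Longrightarrow> q \<in> I \<Longrightarrow> p - q \<in> I"
    "p \<in> I \<Longrightarrow> q \<in> carrier (coord_ring n) \<Longrightarrow> q * p \<in> I" "p \<in> I \<Longrightarrow> const c * p \<in> I"
proof -
  interpret ideal I "coord_ring n" by fact
  show "I \<subseteq> carrier (coord_ring n)" by (rule a_subset)
  show "0 \<in> I" using additive_subgroup.zero_closed[OF additive_subgroup_axioms] by simp
  show add: "p \<in> I \<Longrightarrow> q \<in> I \<Longrightarrow> p + q \<in> I" for p q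
    using additive_subgroup.a_closed[OF additive_subgroup_axioms] by simp
  show mult: "p \<in> I \<Longrightarrow> q \<in> carrier (coord_ring n) \<Longrightarrow> q * p \<in> I" for p q using I_l_closed by simp
  show c: "p \<in> I \<Longrightarrow> const c * p \<in> I" for c p
    by (rule mult[OF _ forms_carrier[OF const_in_forms]])
  show "p \<in> I \<Longrightarrow> q \<in> I \<Longrightarrow> p - q \<in> I" using add[of p "- q"] c[of q "-1"] by (simp add: const_uminus)
qed

lemma ideal_tot:
  assumes J: "gideal n J"
  shows "ideal (tot n J) (coord_ring n)"
proof (rule idealI_coord_ring)
  show "tot n J \<subseteq> carrier (coord_ring n)" by (auto simp: tot_def)
  show "0 \<in> tot n J" using gidealD(6)[OF J] by (auto simp: tot_def coord_ring_def)
  show "p + q \<in> tot n J" if "p \<in> tot n J" "q \<in> tot n J" for p q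
    using that gidealD(7)[OF J] coord_ring_closed by (auto simp: tot_def hcomp_add)
  fix p q assume p: "p \<in> tot n J" and q: "q \<in> carrier (coord_ring n)"
  have "hcomp i q * hcomp (e - i) p \<in> J e" if "i \<le> e" for i e
    using gidealD(3)[OF J _ hcomp_in_forms[OF q, of i], of "hcomp (e - i) p" "e - i"] that p
    by (auto simp: tot_def)
  then have "hcomp e (q * p) \<in> J e" for e
    unfolding hcomp_mult by (intro gidealD(10)[OF J]) auto
  then show "q * p \<in> tot n J"
    using p q coord_ring_closed by (auto simp: tot_def)
qed

lemma tot_forms_iff:
  assumes "gideal n J" "p \<in> forms n e"
  shows "p \<in> tot n J \<longleftrightarrow> p \<in> J e"
  using assms hcomp_forms[OF assms(2)] gidealD(6)[OF assms(1)] forms_carrier[OF assms(2)]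
  by (auto simp: tot_def)

lemma homogeneous_tot:
  assumes J: "gideal n J"
  shows "homogeneous_ideal n (tot n J)"
proof -
  interpret R: cring "coord_ring n" by (rule cring_coord_ring)
  let ?G = "tot n J \<inter> (\<Union>e. forms n e)"
  have G: "?G \<subseteq> carrier (coord_ring n)" using forms_carrier by blast
  have id: "ideal (genideal (coord_ring n) ?G) (coord_ring n)" by (rule R.genideal_ideal[OF G])
  have "tot n J \<subseteq> genideal (coord_ring n) ?G"
  proof
    fix p assume p: "p \<in> tot n J"
    obtain D where D: "\<And>e. e > D \<Longrightarrow> hcomp e p = 0" using hcomp_eventually_0[of p] by blast
    have "hcomp e p \<in> ?G" for e
    proof -
      have "p \<in> carrier (coord_ring n)" "hcomp e p \<in> J e" using p by (auto simp: tot_def)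
      then show ?thesis using tot_forms_iff[OF J hcomp_in_forms] hcomp_in_forms by blast
    qed
    then have mem: "hcomp e p \<in> genideal (coord_ring n) ?G" for e
      using R.genideal_self[OF G] by blast
    have "(\<Sum>e\<in>A. hcomp e p) \<in> genideal (coord_ring n) ?G" if "finite A" for A
      using that by (induction A) (simp_all add: mem ideal_coord_ringD(2,3)[OF id])
    then show "p \<in> genideal (coord_ring n) ?G" using sum_hcomp[OF D] by (metis finite_atMost)
  qed
  moreover have "genideal (coord_ring n) ?G \<subseteq> tot n J"
    by (rule R.genideal_minimal[OF ideal_tot[OF J]]) blast
  ultimately show ?thesis unfolding homogeneous_ideal_def by blast
qed

text \<open>A leading-term argument: take the highest components of \<open>p\<close> and
  \<open>q\<close> outside \<open>P\<close>, in degrees a and b. In degree a + b of the product,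
  every summand but the product of these two lies in \<open>P\<close>, so that product would lie in
  \<open>P\<close> as well.\<close>

lemma primeideal_tot:
  assumes "gprime n P"
  shows "primeideal (tot n P) (coord_ring n)"
proof -
  have P: "gideal n P" "1 \<notin> P 0"
    and prime: "\<And>a b p q. p \<in> forms n a \<Longrightarrow> q \<in> forms n b \<Longrightarrow> p * q \<in> P (a + b) \<Longrightarrow> p \<in> P a \<or> q \<in> P b"
    using assms by (auto simp: gprime_def)
  have top: "\<exists>e. hcomp e p \<notin> P e \<and> (\<forall>e'>e. hcomp e' p \<in> P e')"
    if p: "p \<in> carrier (coord_ring n)" "p \<notin> tot n P" for p
  proof -
    obtain D where D: "\<And>e. e > D \<Longrightarrow> hcomp e p = 0" using hcomp_eventually_0[of p] by blast
    let ?S = "{e. hcomp e p \<notin> P e}"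
    have "?S \<subseteq> {..D}" using D gidealD(6)[OF P(1)] by (metis (mono_tags) atMost_iff mem_Collect_eq not_le subsetI)
    then have fin: "finite ?S" by (rule finite_subset) simp
    have "?S \<noteq> {}" using p by (auto simp: tot_def)
    then have "Max ?S \<in> ?S" "\<forall>e'>Max ?S. e' \<notin> ?S" using Max_in[OF fin] Max_ge[OF fin] by (auto simp flip: not_less)
    then show ?thesis by blast
  qed
  show ?thesis
  proof (rule primeidealI[OF ideal_tot[OF P(1)] cring_coord_ring])
    have "1 \<notin> tot n P" using tot_forms_iff[OF P(1) one_in_forms] P(2) by blast
    moreover have "1 \<in> carrier (coord_ring n)" using one_in_forms forms_carrier by blast
    ultimately show "carrier (coord_ring n) \<noteq> tot n P" by blast
  next
    fix p q assume p: "p \<in> carrier (coord_ring n)" and q: "q \<in> carrier (coord_ring n)"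
      and "p \<otimes>\<^bsub>coord_ring n\<^esub> q \<in> tot n P"
    then have pq: "p * q \<in> tot n P" by simp
    show "p \<in> tot n P \<or> q \<in> tot n P"
    proof (rule ccontr)
      assume "\<not> ?thesis"
      then obtain a b where a: "hcomp a p \<notin> P a" "\<And>e. e > a \<Longrightarrow> hcomp e p \<in> P e"
        and b: "hcomp b q \<notin> P b" "\<And>e. e > b \<Longrightarrow> hcomp e q \<in> P e"
        using top[OF p] top[OF q] by metis
      have "hcomp i p * hcomp (a + b - i) q \<in> P (a + b)" if "i \<in> {..a + b} - {a}" for i
      proof (cases "i > a")
        case True
        then show ?thesis
          using gidealD(4)[OF P(1) a(2) hcomp_in_forms[OF q, of "a + b - i"], of i] that by (simp add: mult.commute)
      next
        case False
        then have "a + b - i > b" using that by auto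
        then show ?thesis
          using gidealD(3)[OF P(1) b(2) hcomp_in_forms[OF p, of i], of "a + b - i"] that by simp
      qed
      then have rest: "(\<Sum>i\<in>{..a + b} - {a}. hcomp i p * hcomp (a + b - i) q) \<in> P (a + b)"
        by (rule gidealD(10)[OF P(1)])
      have "hcomp (a + b) (p * q) = hcomp a p * hcomp b q + (\<Sum>i\<in>{..a + b} - {a}. hcomp i p * hcomp (a + b - i) q)"
        unfolding hcomp_mult by (subst sum.remove[of _ a]) auto
      moreover have "hcomp (a + b) (p * q) \<in> P (a + b)" using pq by (auto simp: tot_def)
      ultimately have "hcomp a p * hcomp b q \<in> P (a + b)"
        using gidealD(8)[OF P(1) _ rest, of "hcomp (a + b) (p * q)"] by simp
      then show False using prime hcomp_in_forms p q a b by blast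
    qed
  qed
qed

section \<open>Hilbert functions\<close>

text \<open>Integer-valued, so that differences of Hilbert functions are not truncated.\<close>

definition hf :: "nat \<Rightarrow> (nat \<Rightarrow> mpoly set) \<Rightarrow> nat \<Rightarrow> int" where
  "hf n J e = int (mpoly_vs.dim (forms n e)) - int (mpoly_vs.dim (J e))"

lemma dim_mono_forms:
  assumes "mpoly_vs.subspace W" "W \<subseteq> V" "V \<subseteq> forms n e"
  shows "mpoly_vs.dim W \<le> mpoly_vs.dim V"
proof -
  obtain B where "finite B" "forms n e \<subseteq> mpoly_vs.span B" by (rule forms_fin_span)
  then show ?thesis using assms by (intro mpoly_vs.dim_mono_finite[of W V B]) auto
qed

lemma hf_nonneg: "gideal n J \<Longrightarrow> 0 \<le> hf n J e"
  using dim_mono_forms[of "J e" "forms n e" n e] gidealD by (simp add: hf_def)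

lemma hf_mono:
  assumes "gideal n J" "gideal n J'" "J e \<subseteq> J' e"
  shows "hf n J' e \<le> hf n J e"
  using dim_mono_forms[of "J e" "J' e" n e] gidealD(1,2)[OF assms(1)] gidealD(2)[OF assms(2)] assms(3)
  by (simp add: hf_def)

lemma hf_eventually_full: "gideal n J \<Longrightarrow> forms n e \<subseteq> J e \<Longrightarrow> hf n J e = 0"
  using gidealD(2)[of n J e] by (simp add: hf_def subset_antisym)

lemma codim_forms_image_covers:
  assumes T: "mpoly_linear T"
    and V: "mpoly_vs.subspace V'" "V' \<subseteq> V" "V \<subseteq> forms n a"
    and W: "mpoly_vs.subspace W'" "W' \<subseteq> W" "W \<subseteq> forms n' b"
    and cover: "\<And>w. w \<in> W \<Longrightarrow> \<exists>v\<in>V. \<exists>w'\<in>W'. w = T v + w'"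
    and T': "\<And>v. v \<in> V' \<Longrightarrow> T v \<in> W'"
  shows "int (mpoly_vs.dim W) - int (mpoly_vs.dim W') \<le> int (mpoly_vs.dim V) - int (mpoly_vs.dim V')"
proof -
  obtain B where B: "finite B" "forms n a \<subseteq> mpoly_vs.span B" by (rule forms_fin_span)
  obtain B' where B': "finite B'" "forms n' b \<subseteq> mpoly_vs.span B'" by (rule forms_fin_span)
  have "mpoly_vs.dim W - mpoly_vs.dim W' \<le> mpoly_vs.dim V - mpoly_vs.dim V'"
    using assms B B' by (intro mpoly_vs.codim_le_of_image_covers[of T V' V W' B B' W]) auto
  then show ?thesis using dim_mono_forms[OF V] dim_mono_forms[OF W] by linarith
qed

lemma codim_forms_preimage:
  assumes T: "mpoly_linear T"
    and V: "mpoly_vs.subspace V'" "V' \<subseteq> V" "V \<subseteq> forms n a" "mpoly_vs.subspace V"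
    and W: "mpoly_vs.subspace W'" "W' \<subseteq> W" "W \<subseteq> forms n' b"
    and T': "\<And>v. v \<in> V \<Longrightarrow> T v \<in> W" "\<And>v. v \<in> V \<Longrightarrow> T v \<in> W' \<Longrightarrow> v \<in> V'"
  shows "int (mpoly_vs.dim V) - int (mpoly_vs.dim V') \<le> int (mpoly_vs.dim W) - int (mpoly_vs.dim W')"
proof -
  obtain B where B: "finite B" "forms n a \<subseteq> mpoly_vs.span B" by (rule forms_fin_span)
  obtain B' where B': "finite B'" "forms n' b \<subseteq> mpoly_vs.span B'" by (rule forms_fin_span)
  have "mpoly_vs.dim V - mpoly_vs.dim V' \<le> mpoly_vs.dim W - mpoly_vs.dim W'"
    using assms B B' by (intro mpoly_vs.codim_le_of_preimage[of T V' V W' W B B']) auto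
  then show ?thesis using dim_mono_forms[OF V(1-3)] dim_mono_forms[OF W] by linarith
qed

lemma hf_gsum_small: "e < a \<Longrightarrow> hf n (gsum n J a f) e = hf n J e"
proof -
  assume "e < a"
  then have "gsum n J a f e = J e" by (auto simp: gsum_def shifted_forms_def)
  then show ?thesis by (simp add: hf_def)
qed

text \<open>The cokernel of multiplication by \<open>f\<close> on S/J is the quotient by
  \<open>J + (f)\<close>.\<close>

lemma hf_le_gsum:
  assumes J: "gideal n J" and f: "f \<in> forms n a" and "a \<le> e"
  shows "hf n J e \<le> hf n (gsum n J a f) e + hf n J (e - a)"
proof -
  note gs = gideal_gsum[OF J f]
  have "int (mpoly_vs.dim (gsum n J a f e)) - int (mpoly_vs.dim (J e))
      \<le> int (mpoly_vs.dim (forms n (e - a))) - int (mpoly_vs.dim (J (e - a)))"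
  proof (rule codim_forms_image_covers[of "\<lambda>q. f * q" _ _ n "e - a" _ _ n e])
    show "J e \<subseteq> gsum n J a f e" using gsum_upper by blast
    show "\<exists>v\<in>forms n (e - a). \<exists>w'\<in>J e. w = f * v + w'" if "w \<in> gsum n J a f e" for w
    proof -
      obtain p q where "p \<in> J e" "q \<in> forms n (e - a)" "w = p + f * q"
        using \<open>w \<in> gsum n J a f e\<close> \<open>a \<le> e\<close> by (auto elim!: gsumE simp: shifted_forms_def)
      then show ?thesis by (intro bexI[of _ q] bexI[of _ p]) simp_all
    qed
    show "f * v \<in> J e" if "v \<in> J (e - a)" for v
      using gidealD(3)[OF J that f] \<open>a \<le> e\<close> by simp
  qed (use linear_mult gidealD[OF J] gidealD[OF gs] in auto)
  then show ?thesis by (simp add: hf_def)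
qed

text \<open>\<open>f\<close> is a nonzerodivisor modulo \<open>J\<close>; the sequence behind
  \<open>hf_le_gsum\<close> is then exact on the left and the inequality becomes an
  equality.\<close>

definition nzd :: "nat \<Rightarrow> (nat \<Rightarrow> mpoly set) \<Rightarrow> nat \<Rightarrow> mpoly \<Rightarrow> bool" where
  "nzd n J a f \<longleftrightarrow> (\<forall>e. \<forall>p\<in>forms n e. f * p \<in> J (a + e) \<longrightarrow> p \<in> J e)"

lemma hf_gsum_nzd:
  assumes J: "gideal n J" and f: "f \<in> forms n a" and "a \<le> e" and nz: "nzd n J a f"
  shows "hf n (gsum n J a f) e = hf n J e - hf n J (e - a)"
proof -
  note gs = gideal_gsum[OF J f]
  have "int (mpoly_vs.dim (forms n (e - a))) - int (mpoly_vs.dim (J (e - a)))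
     \<le> int (mpoly_vs.dim (gsum n J a f e)) - int (mpoly_vs.dim (J e))"
  proof (rule codim_forms_preimage[of "\<lambda>q. f * q" _ _ n "e - a" _ _ n e])
    show "J e \<subseteq> gsum n J a f e" using gsum_upper by blast
    show "f * v \<in> gsum n J a f e" if "v \<in> forms n (e - a)" for v
      using gsum_gen[OF J that, of f a] \<open>a \<le> e\<close> by simp
    show "v \<in> J (e - a)" if "v \<in> forms n (e - a)" "f * v \<in> J e" for v
      using nz that \<open>a \<le> e\<close> unfolding nzd_def by force
  qed (use linear_mult gidealD[OF J] gidealD[OF gs] subspace_forms in auto)
  then show ?thesis using hf_le_gsum[OF J f \<open>a \<le> e\<close>] by (simp add: hf_def)
qed

lemma gideal_unscale:
  assumes "gideal n J" "const c * p \<in> J e" "c \<noteq> 0"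
  shows "p \<in> J e"
proof -
  have "const (inverse c) * (const c * p) = const (inverse c * c) * p"
    by (simp only: const_mult mult.assoc)
  also have "\<dots> = p" using assms(3) by simp
  finally have "const (inverse c) * (const c * p) = p" .
  then show ?thesis using gidealD(9)[OF assms(1,2), of "inverse c"] by (simp only:)
qed

text \<open>In large degrees multiplication by \<open>f\<close> is onto modulo \<open>J\<close>, so
  the Hilbert function does not grow in steps of \<open>a\<close>. The sum of the first N + a values
  therefore dominates all others.\<close>

lemma hf_bounded:
  assumes J: "gideal n J" and f: "f \<in> forms n a" and "a \<ge> 1" and cof: "eventually_full n (gsum n J a f)"
  shows "\<exists>C. \<forall>e. hf n J e \<le> C"
proof -
  obtain N where N: "\<And>e. e \<ge> N \<Longrightarrow> forms n e \<subseteq> gsum n J a f e" using cof by (auto simp: eventually_full_def)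
  define C where "C = (\<Sum>j<N + a. hf n J j)"
  have "hf n J e \<le> C" for e
  proof (induction e rule: less_induct)
    case (less e)
    show ?case
    proof (cases "e < N + a")
      case True
      then show ?thesis
        unfolding C_def using hf_nonneg[OF J] by (intro member_le_sum) auto
    next
      case False
      then have "hf n J e \<le> hf n (gsum n J a f) e + hf n J (e - a)" by (intro hf_le_gsum[OF J f]) auto
      also have "hf n (gsum n J a f) e = 0" using False by (intro hf_eventually_full gideal_gsum J f N) auto
      also have "hf n J (e - a) \<le> C" using less[of "e - a"] False \<open>a \<ge> 1\<close> by simp
      finally show ?thesis by simp
    qed
  qed
  then show ?thesis by blast
qed

section \<open>Binary relations\<close>

text \<open>For \<open>degree r\<close> at most \<open>e\<close> this is the binary form obtained by
  clearing denominators in \<open>x_i^e r(x_j / x_i)\<close>.\<close>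

definition homog :: "nat \<Rightarrow> nat \<Rightarrow> nat \<Rightarrow> complex poly \<Rightarrow> mpoly" where
  "homog i j e r = (\<Sum>a\<le>e. const (coeff r a) * (pvar j ^ a * pvar i ^ (e - a)))"

lemma homog_0 [simp]: "homog i j e 0 = 0" by (simp add: homog_def)

lemma homog_add: "homog i j e (r + s) = homog i j e r + homog i j e s"
  by (simp add: homog_def const_add distrib_right sum.distrib)

lemma homog_smult: "homog i j e (smult c r) = const c * homog i j e r"
  unfolding homog_def sum_distrib_left by (simp only: coeff_smult const_mult mult.assoc)

lemma homog_pCons: "homog i j (Suc e) (pCons c r) = const c * pvar i ^ Suc e + pvar j * homog i j e r"
proof -
  have "homog i j (Suc e) (pCons c r) = const c * pvar i ^ Suc e +
     (\<Sum>a\<le>e. const (coeff r a) * (pvar j * pvar j ^ a * pvar i ^ (e - a)))"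
    unfolding homog_def by (subst sum.atMost_Suc_shift) simp
  also have "(\<Sum>a\<le>e. const (coeff r a) * (pvar j * pvar j ^ a * pvar i ^ (e - a))) = pvar j * homog i j e r"
    unfolding homog_def sum_distrib_left by (intro sum.cong refl) (simp only: ac_simps)
  finally show ?thesis .
qed

lemma homog_Suc_degree:
  assumes "degree r \<le> e"
  shows "homog i j (Suc e) r = pvar i * homog i j e r"
proof -
  have "homog i j (Suc e) r = (\<Sum>a\<le>e. const (coeff r a) * (pvar j ^ a * pvar i ^ (Suc e - a)))"
    unfolding homog_def using assms by (simp add: coeff_eq_0)
  also have "\<dots> = pvar i * homog i j e r"
    unfolding homog_def sum_distrib_left
    by (intro sum.cong) (auto simp: Suc_diff_le algebra_simps)
  finally show ?thesis .
qed

lemma homog_add_degree: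
  "degree r \<le> e \<Longrightarrow> homog i j (k + e) r = pvar i ^ k * homog i j e r"
  by (induction k) (simp_all add: homog_Suc_degree mult.assoc)

lemma homog_const: "homog i j e [:c:] = const c * pvar i ^ e"
  using homog_add_degree[of "[:c:]" 0 i j e] by (simp add: homog_def mult.commute)

lemma homog_mult:
  assumes "degree r \<le> e" "degree s \<le> e'"
  shows "homog i j e r * homog i j e' s = homog i j (e + e') (r * s)"
  using assms(1)
proof (induction r arbitrary: e)
  case 0
  then show ?case by simp
next
  case (pCons c r)
  show ?case
  proof (cases "r = 0")
    case True
    then show ?thesis
      using homog_add_degree[OF assms(2), of i j e] by (simp add: homog_const homog_smult mult.assoc)
  next
    case False
    then obtain e0 where e: "e = Suc e0" "degree r \<le> e0" using pCons.prems by (cases e) auto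
    have "homog i j e (pCons c r) * homog i j e' s
      = const c * (pvar i ^ e * homog i j e' s) + pvar j * (homog i j e0 r * homog i j e' s)"
      by (simp add: e homog_pCons algebra_simps)
    also have "\<dots> = homog i j (e + e') (smult c s) + homog i j (e + e') (pCons 0 (r * s))"
      using homog_add_degree[OF assms(2), of i j e] pCons.IH[OF e(2)] homog_pCons[of i j "e0 + e'" 0]
      by (simp add: e homog_smult)
    also have "\<dots> = homog i j (e + e') (pCons c r * s)"
      by (simp add: homog_add)
    finally show ?thesis .
  qed
qed

lemma homog_in_forms:
  assumes "i \<le> n" "j \<le> n"
  shows "homog i j e r \<in> forms n e"
  unfolding homog_def
proof (intro forms_sum forms_scale)
  fix a assume "a \<in> {..e}"
  then show "pvar j ^ a * pvar i ^ (e - a) \<in> forms n e"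
    using forms_mult[OF forms_power[OF pvar_in_forms[OF assms(2)], of a] forms_power[OF pvar_in_forms[OF assms(1)], of "e - a"]]
    by simp
qed

lemma homog_eval: "poly_eval v (homog i j e r) = (\<Sum>a\<le>e. coeff r a * (v j ^ a * v i ^ (e - a)))"
  by (simp add: homog_def poly_eval_simps)

lemma homog_eval_poly:
  assumes "degree r \<le> e" "v i \<noteq> 0"
  shows "poly_eval v (homog i j e r) = v i ^ e * poly r (v j / v i)"
proof -
  have "poly r (v j / v i) = (\<Sum>a\<le>e. coeff r a * (v j / v i) ^ a)"
    unfolding poly_altdef using assms(1)
    by (intro sum.mono_neutral_left) (auto simp: coeff_eq_0)
  then show ?thesis
    unfolding homog_eval using assms(2)
    by (auto simp: sum_distrib_left power_divide power_diff intro!: sum.cong)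
qed

text \<open>The degree condition prevents truncation in \<open>homog\<close>, so for distinct i, j
  the form is nonzero. It confines the ratio x_j / x_i at zeros with nonzero x_i to the roots of
  \<open>r\<close>.\<close>

definition brel :: "nat \<Rightarrow> (nat \<Rightarrow> mpoly set) \<Rightarrow> nat \<Rightarrow> nat \<Rightarrow> bool" where
  "brel n J i j \<longleftrightarrow> (\<exists>e r. r \<noteq> 0 \<and> degree r \<le> e \<and> homog i j e r \<in> J e)"

lemma independent_monomials: "mpoly_vs.independent ((\<lambda>m. Poly_Mapping.single m 1) ` S)"
proof -
  have "finite A \<Longrightarrow> A \<subseteq> (\<lambda>m. Poly_Mapping.single m 1) ` S \<Longrightarrow> mpoly_vs.independent A" for A :: "mpoly set"
  proof (rule mpoly_vs.independent_if_scalars_zero)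
    fix f :: "mpoly \<Rightarrow> complex" and x
    assume fin: "finite A" and A: "A \<subseteq> (\<lambda>m. Poly_Mapping.single m 1) ` S"
      and sum: "(\<Sum>x\<in>A. const (f x) * x) = 0" and x: "x \<in> A"
    then obtain m where m: "x = Poly_Mapping.single m 1" by blast
    have "Poly_Mapping.lookup y m = (if y = x then 1 else 0)" if "y \<in> A" for y
      using A that m by (auto simp: lookup_single when_def)
    then have "Poly_Mapping.lookup (\<Sum>x\<in>A. const (f x) * x) m = (\<Sum>y\<in>A. if y = x then f y else 0)"
      unfolding lookup_sum lookup_const_mult by (intro sum.cong) auto
    also have "\<dots> = f x" using fin x by simp
    finally show "f x = 0" using sum by simp
  qed
  then show ?thesis
    unfolding mpoly_vs.independent_explicit_finite_subsets
    by (smt (verit, best) mpoly_vs.independent_explicit_finite_subsets order.refl)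
qed

lemma dim_zero: "mpoly_vs.dim {0 :: mpoly} = 0"
  using mpoly_vs.dim_le_card[of "{0}" "{}"] by simp

text \<open>Without a relation, the binary forms of degree e embed into S/J. They span a space of
  dimension e + 1, which outgrows any bound.\<close>

lemma brel_of_bounded:
  assumes J: "gideal n J" and bd: "\<And>e. hf n J e \<le> C" and ij: "i \<le> n" "j \<le> n" "i \<noteq> j"
  shows "brel n J i j"
proof (rule ccontr)
  assume no: "\<not> brel n J i j"
  \<comment> \<open>The choice makes e + 1 exceed \<open>C\<close>, also for negative
    \<open>C\<close>.\<close>
  define e where "e = nat C"
  define M where "M a = Poly_Mapping.single j a + Poly_Mapping.single i (e - a)" for a
  define B where "B = (\<lambda>a. Poly_Mapping.single (M a) (1::complex)) ` {..e}"
  define V where "V = {homog i j e r | r. degree r \<le> e}"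
  have M: "Poly_Mapping.single (M a) 1 = pvar j ^ a * pvar i ^ (e - a)" for a
    using monom_val_add[of pvar "Poly_Mapping.single j a" "Poly_Mapping.single i (e - a)"]
    by (simp add: M_def monom_val_pvar del: monom_val_single) (simp add: monom_val_pvar flip: monom_val_single)
  have "inj_on (\<lambda>a. Poly_Mapping.single (M a) (1::complex)) {..e}"
  proof (rule inj_onI)
    fix a b assume "Poly_Mapping.single (M a) (1::complex) = Poly_Mapping.single (M b) 1"
    then have "M a = M b" by (metis keys_single one_neq_zero singleton_inject)
    then have "Poly_Mapping.lookup (M a) j = Poly_Mapping.lookup (M b) j" by simp
    then show "a = b" using ij by (simp add: M_def lookup_add lookup_single)
  qed
  then have cardB: "card B = Suc e" by (simp add: B_def card_image)
  have indB: "mpoly_vs.independent B"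
    using independent_monomials[of "M ` {..e}"] by (simp add: B_def image_image)
  have subV: "mpoly_vs.subspace V"
    unfolding mpoly_vs.subspace_def
  proof (intro conjI ballI allI)
    show "0 \<in> V" unfolding V_def by (auto intro!: exI[of _ 0])
    show "x + y \<in> V" if "x \<in> V" "y \<in> V" for x y
      using that unfolding V_def by (auto simp flip: homog_add intro: degree_add_le)
    show "const c * x \<in> V" if "x \<in> V" for c x
      using that unfolding V_def by (auto simp flip: homog_smult intro: order.trans[OF degree_smult_le])
  qed
  have VF: "V \<subseteq> forms n e" using ij homog_in_forms by (auto simp: V_def)
  have "homog i j e (Polynomial.monom 1 a) = Poly_Mapping.single (M a) 1" if "a \<le> e" for a
    using that unfolding homog_def M by (simp add: if_distrib[of const] if_distrib[of "\<lambda>q. q * _"] cong: if_cong)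
  then have "B \<subseteq> V" unfolding B_def V_def
    by (smt (verit) atMost_iff degree_monom_le image_subset_iff mem_Collect_eq order.trans)
  moreover have "V \<subseteq> mpoly_vs.span B"
  proof
    fix x assume "x \<in> V"
    then obtain r where "x = (\<Sum>a\<le>e. const (coeff r a) * Poly_Mapping.single (M a) 1)"
      by (auto simp: V_def homog_def M)
    moreover have "Poly_Mapping.single (M a) 1 \<in> mpoly_vs.span B" if "a \<le> e" for a
      using that by (intro mpoly_vs.span_base) (auto simp: B_def)
    ultimately show "x \<in> mpoly_vs.span B"
      by (auto intro: mpoly_vs.span_sum mpoly_vs.span_scale)
  qed
  ultimately have "mpoly_vs.dim V = Suc e"
    using mpoly_vs.basis_card_eq_dim[OF _ _ indB] cardB by simp
  moreover have "int (mpoly_vs.dim V) - int (mpoly_vs.dim {0::mpoly}) \<le> hf n J e"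
    unfolding hf_def
  proof (rule codim_forms_preimage[of "\<lambda>x. x" "{0}" V n e "J e" "forms n e" n e])
    show "mpoly_linear (\<lambda>x. x)" by (rule mpoly_linearI) auto
    show "v \<in> {0}" if v: "v \<in> V" "v \<in> J e" for v
    proof -
      obtain r where r: "v = homog i j e r" "degree r \<le> e" using v by (auto simp: V_def)
      then have "r = 0" using no v(2) by (auto simp: brel_def)
      then show ?thesis using r by simp
    qed
  qed (use subV VF gidealD(1,2)[OF J] mpoly_vs.subspace_0[OF subV] mpoly_vs.subspace_single_0 in auto)
  moreover have "hf n J e \<le> C" by (rule bd)
  ultimately show False unfolding e_def dim_zero by linarith
qed

text \<open>Nonzero binary forms are multiplicatively closed, so some homogeneous prime
  \<open>P0\<close> containing \<open>J\<close> avoids them all, in particular x_i and x_j.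
  Adjoining x_j still leaves a nonempty scheme, and a relevant prime \<open>P1\<close> over the
  enlarged ideal gives a chain of length one.\<close>

lemma scheme_dim_ne_0:
  assumes J: "gideal n J" and I: "I \<subseteq> tot n J" and ij: "i \<le> n" "j \<le> n" "i \<noteq> j" and no: "\<not> brel n J i j"
  shows "scheme_dim n I \<noteq> 0"
proof -
  define U where "U = {(e, homog i j e r) | e r. r \<noteq> 0 \<and> degree r \<le> e}"
  obtain P0 where P0: "gprime n P0" "\<And>e p. p \<in> J e \<Longrightarrow> p \<in> P0 e" "\<And>e u. (e, u) \<in> U \<Longrightarrow> u \<notin> P0 e"
  proof (rule gprime_exists[OF J, of U])
    show "u \<in> forms n e" if "(e, u) \<in> U" for e u using that ij homog_in_forms by (auto simp: U_def)
    have "1 = homog i j 0 [:1:]" by (simp add: homog_const)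
    then show "(0, 1) \<in> U" unfolding U_def by (intro CollectI exI[of _ 0] exI[of _ "[:1:]"]) auto
    show "(e + e', u * u') \<in> U" if u: "(e, u) \<in> U" "(e', u') \<in> U" for e u e' u'
    proof -
      obtain r s where "u = homog i j e r" "u' = homog i j e' s" "r \<noteq> 0" "s \<noteq> 0" "degree r \<le> e" "degree s \<le> e'"
        using u by (auto simp: U_def)
      then show ?thesis
        unfolding U_def by (intro CollectI exI[of _ "e + e'"] exI[of _ "r * s"])
          (auto simp: homog_mult degree_mult_eq)
    qed
    show "u \<notin> J e" if "(e, u) \<in> U" for e u using that no by (auto simp: U_def brel_def)
  qed blast
  have gP0: "gideal n P0" using P0(1) by (simp add: gprime_def)
  have notin: "homog i j 1 [:0, 1:] \<notin> P0 1" "homog i j 1 [:1:] \<notin> P0 1"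
    using P0(3)[of 1 "homog i j 1 [:0, 1:]"] P0(3)[of 1 "homog i j 1 [:1:]"] by (fastforce simp: U_def)+
  have x: "pvar j \<notin> P0 1" "pvar i \<notin> P0 1"
    using notin homog_const[of i j 1 1] homog_pCons[of i j 0 0 "[:1:]"] by (simp_all add: homog_const)
  let ?J1 = "gsum n P0 1 (pvar j)"
  have J1: "gideal n ?J1" by (rule gideal_gsum[OF gP0 pvar_in_forms[OF ij(2)]])
  \<comment> \<open>If \<open>P0 + (x_j)\<close> were irrelevant, the Hilbert function of
    \<open>P0\<close> would be bounded, which forces a binary form into \<open>P0\<close>.\<close>
  have "\<not> eventually_full n ?J1"
  proof
    assume "eventually_full n ?J1"
    then obtain C where "\<And>e. hf n P0 e \<le> C" using hf_bounded[OF gP0 pvar_in_forms[OF ij(2)]] by blast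
    then have "brel n P0 i j" by (rule brel_of_bounded[OF gP0 _ ij])
    then show False using P0(3) by (auto simp: U_def brel_def)
  qed
  then obtain l where l: "l \<le> n" "\<And>N. pvar l ^ N \<notin> ?J1 N" using eventually_fullI[OF J1] by blast
  obtain P1 where P1: "gprime n P1" "\<And>e p. p \<in> ?J1 e \<Longrightarrow> p \<in> P1 e" "\<And>N. pvar l ^ N \<notin> P1 N"
  proof (rule gprime_exists[OF J1, of "{(N, pvar l ^ N) | N. True}"])
    show "u \<in> forms n e" if "(e, u) \<in> {(N, pvar l ^ N) | N. True}" for e u
      using that forms_power[OF pvar_in_forms[OF l(1)], of e] by auto
  qed (use l in \<open>auto simp: power_add\<close>)
  have gP1: "gideal n P1" using P1(1) by (simp add: gprime_def)
  have P01: "P0 e \<subseteq> P1 e" for e using P1(2) gsum_upper by blast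
  have tots: "tot n P0 \<subseteq> tot n P1" using P01 by (auto simp: tot_def)
  have I0: "I \<subseteq> tot n P0" using I P0(2) by (auto simp: tot_def)
  have "pvar i \<notin> tot n P0" using tot_forms_iff[OF gP0 pvar_in_forms] x ij by blast
  then have p0: "tot n P0 \<in> proj_points n I"
    using primeideal_tot[OF P0(1)] homogeneous_tot[OF gP0] I0 ij by (auto simp: proj_points_def)
  have "pvar l \<notin> tot n P1" using tot_forms_iff[OF gP1 pvar_in_forms] P1(3)[of 1] l(1) by auto
  then have p1: "tot n P1 \<in> proj_points n I"
    using primeideal_tot[OF P1(1)] homogeneous_tot[OF gP1] I0 tots l(1) by (auto simp: proj_points_def)
  have "pvar j \<in> tot n P1"
    using tot_forms_iff[OF gP1 pvar_in_forms] P1(2)[OF gsum_gen1[OF gP0]] ij by blast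
  moreover have "pvar j \<notin> tot n P0" using tot_forms_iff[OF gP0 pvar_in_forms] x ij by blast
  ultimately have "tot n P0 \<subset> tot n P1" using tots by blast
  then have "\<exists>P. (\<forall>k\<le>1. P k \<in> proj_points n I) \<and> (\<forall>k<1. P k \<subset> P (Suc k))"
    using p0 p1 by (intro exI[of _ "\<lambda>k. if k = 0 then tot n P0 else tot n P1"]) auto
  then have "ereal (real 1) \<le> scheme_dim n I"
    unfolding scheme_dim_def by (intro Sup_upper) blast
  then show ?thesis by auto
qed

section \<open>Finite zero sets\<close>

text \<open>A binary form splits into linear factors over the complex numbers, and a prime contains
  one of them. No factor is x_i itself, because x_i lies outside the prime; this also excludes
  constant \<open>r\<close>.\<close>

lemma gprime_root:
  assumes P: "gprime n P" and ij: "i \<le> n" "j \<le> n" and x: "pvar i \<notin> P 1"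
    and "r \<noteq> 0" "degree r \<le> e" "homog i j e r \<in> P e"
  shows "\<exists>\<alpha>. poly r \<alpha> = 0 \<and> pvar j - const \<alpha> * pvar i \<in> P 1"
  using assms(5-)
proof (induction "degree r" arbitrary: r e)
  case 0
  have gP: "gideal n P" using P by (simp add: gprime_def)
  from 0 obtain c where c: "r = [:c:]" "c \<noteq> 0" by (metis degree_eq_zeroE pCons_0_0)
  then have "pvar i ^ e \<in> P (e * 1)"
    using 0(4) gideal_unscale[OF gP _ c(2)] by (simp add: homog_const)
  then have "pvar i \<in> P 1" by (rule gprime_power[OF P pvar_in_forms[OF ij(1)]])
  then show ?case using x by simp
next
  case (Suc d)
  then have "\<not> constant (poly r)" by (simp add: constant_degree)
  then obtain \<alpha> where \<alpha>: "poly r \<alpha> = 0" using fundamental_theorem_of_algebra by blast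
  then obtain s where s: "r = [:-\<alpha>, 1:] * s" by (auto simp: poly_eq_0_iff_dvd)
  then have s0: "s \<noteq> 0" using Suc.prems by auto
  then have deg: "degree r = Suc (degree s)" unfolding s by (subst degree_mult_eq) auto
  then obtain e' where e: "e = Suc e'" "degree s \<le> e'" using Suc.prems by (cases e) auto
  have h1: "homog i j 1 [:-\<alpha>, 1:] = pvar j - const \<alpha> * pvar i"
    using homog_pCons[of i j 0 "-\<alpha>" "[:1:]"] by (simp add: homog_const const_uminus)
  have "homog i j 1 [:-\<alpha>, 1:] * homog i j e' s = homog i j (1 + e') r"
    unfolding s by (rule homog_mult) (use e in auto)
  then have "(pvar j - const \<alpha> * pvar i) * homog i j e' s \<in> P (1 + e')"
    using Suc.prems e h1 by simp
  moreover have "pvar j - const \<alpha> * pvar i \<in> forms n 1"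
    using ij by (intro forms_diff forms_scale pvar_in_forms)
  ultimately consider "pvar j - const \<alpha> * pvar i \<in> P 1" | "homog i j e' s \<in> P e'"
    using P homog_in_forms[OF ij] unfolding gprime_def by blast
  then show ?case
  proof cases
    case 1
    then show ?thesis using \<alpha> by blast
  next
    case 2
    then have "\<exists>\<alpha>. poly s \<alpha> = 0 \<and> pvar j - const \<alpha> * pvar i \<in> P 1"
      using Suc.hyps(1)[of s e'] Suc.hyps(2) deg s0 e by simp
    then show ?thesis by (auto simp: s)
  qed
qed

text \<open>Modulo \<open>P\<close> each x_j equals v_j x_i, so only multiples of powers of x_i
  survive.\<close>

lemma eval_congruence:
  assumes P: "gideal n P" and i: "i \<le> n" and v: "\<And>j. j \<le> n \<Longrightarrow> pvar j - const (v j) * pvar i \<in> P 1"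
    and p: "p \<in> forms n e"
  shows "p - const (poly_eval v p) * pvar i ^ e \<in> P e"
  using p
proof (induction e arbitrary: p)
  case 0
  then have "p = const (Poly_Mapping.lookup p 0)" by (rule forms_0)
  then have "p = const (poly_eval v p)" by (metis poly_eval_const)
  then show ?case using gidealD(6)[OF P] by simp
next
  case (Suc e)
  obtain q where q: "\<And>j. j \<le> n \<Longrightarrow> q j \<in> forms n e" "p = (\<Sum>j\<le>n. pvar j * q j)"
    using forms_Suc_decompose[OF Suc.prems] by metis
  have "pvar j * q j - const (v j * poly_eval v (q j)) * pvar i ^ Suc e \<in> P (Suc e)" if j: "j \<le> n" for j
  proof -
    have "q j * (pvar j - const (v j) * pvar i) \<in> P (e + 1)"
      by (rule gidealD(3)[OF P v[OF j] q(1)[OF j]])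
    moreover have "(const (v j) * pvar i) * (q j - const (poly_eval v (q j)) * pvar i ^ e) \<in> P (1 + e)"
      by (intro gidealD(3)[OF P Suc.IH[OF q(1)[OF j]]] forms_scale pvar_in_forms i)
    ultimately have "q j * (pvar j - const (v j) * pvar i)
       + (const (v j) * pvar i) * (q j - const (poly_eval v (q j)) * pvar i ^ e) \<in> P (Suc e)"
      using gidealD(7)[OF P] by simp
    then show ?thesis by (simp add: const_mult algebra_simps)
  qed
  then have "(\<Sum>j\<le>n. pvar j * q j - const (v j * poly_eval v (q j)) * pvar i ^ Suc e) \<in> P (Suc e)"
    by (intro gidealD(10)[OF P]) auto
  also have "(\<Sum>j\<le>n. pvar j * q j - const (v j * poly_eval v (q j)) * pvar i ^ Suc e)
      = p - const (poly_eval v p) * pvar i ^ Suc e"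
    unfolding q(2) by (simp add: sum_subtractf poly_eval_simps sum_distrib_right ring_map_simps[OF ring_map_const])
  finally show ?case .
qed

text \<open>A projective Nullstellensatz above \<open>J0\<close>, with a finite supply
  \<open>X\<close> of zeros that does not depend on \<open>J\<close>. A prime over \<open>J\<close>
  that avoids the powers of some x_i contains \<open>x_j - alpha_j x_i\<close> for roots alpha_j of
  the given relations; the zero is normalised by v_i = 1.\<close>

lemma finite_zero_directions:
  assumes J0: "gideal n J0" and rel: "\<And>i j. i \<le> n \<Longrightarrow> j \<le> n \<Longrightarrow> i \<noteq> j \<Longrightarrow> brel n J0 i j"
  shows "\<exists>X. finite X \<and> (\<forall>v\<in>X. \<exists>i\<le>n. v i \<noteq> 0) \<and>
    (\<forall>J. gideal n J \<longrightarrow> (\<forall>e. J0 e \<subseteq> J e) \<longrightarrow> \<not> eventually_full n J \<longrightarrow>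
      (\<exists>v\<in>X. \<forall>e. \<forall>p\<in>J e. poly_eval v p = 0))"
proof -
  have "\<exists>r. \<forall>i\<le>n. \<forall>j\<le>n. i \<noteq> j \<longrightarrow> r i j \<noteq> 0 \<and> (\<exists>e. degree (r i j) \<le> e \<and> homog i j e (r i j) \<in> J0 e)"
    using rel unfolding brel_def by metis
  then obtain r where r: "\<And>i j. i \<le> n \<Longrightarrow> j \<le> n \<Longrightarrow> i \<noteq> j \<Longrightarrow>
      r i j \<noteq> 0 \<and> (\<exists>e. degree (r i j) \<le> e \<and> homog i j e (r i j) \<in> J0 e)"
    by blast
  \<comment> \<open>The value 1 serves the normalised coordinate, the roots serve the
    others.\<close>
  define R where "R = {1} \<union> (\<Union>(i, j)\<in>{(i, j). i \<le> n \<and> j \<le> n \<and> i \<noteq> j}. {\<alpha>. poly (r i j) \<alpha> = 0})"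
  define X where "X = {v. (\<forall>j. (j \<in> {..n} \<longrightarrow> v j \<in> R) \<and> (j \<notin> {..n} \<longrightarrow> v j = 0)) \<and> (\<exists>i\<le>n. v i \<noteq> 0)}"
  have "finite {(i, j). i \<le> n \<and> j \<le> n \<and> i \<noteq> j}"
    by (rule finite_subset[of _ "{..n} \<times> {..n}"]) auto
  then have "finite R" unfolding R_def using r poly_roots_finite by auto
  then have "finite X" unfolding X_def
    by (intro finite_subset[OF _ finite_set_of_finite_funs[of "{..n}" R 0]]) auto
  moreover have "\<exists>v\<in>X. \<forall>e. \<forall>p\<in>J e. poly_eval v p = 0"
    if J: "gideal n J" and sub: "\<forall>e. J0 e \<subseteq> J e" and nc: "\<not> eventually_full n J" for J
  proof -
    obtain i where i: "i \<le> n" "\<And>N. pvar i ^ N \<notin> J N" using eventually_fullI[OF J] nc by blast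
    obtain P where P: "gprime n P" "\<And>e p. p \<in> J e \<Longrightarrow> p \<in> P e" "\<And>N. pvar i ^ N \<notin> P N"
    proof (rule gprime_exists[OF J, of "{(N, pvar i ^ N) | N. True}"])
      show "u \<in> forms n e" if "(e, u) \<in> {(N, pvar i ^ N) | N. True}" for e u
        using that forms_power[OF pvar_in_forms[OF i(1)], of e] by auto
    qed (use i in \<open>auto simp: power_add\<close>)
    have gP: "gideal n P" using P(1) by (simp add: gprime_def)
    have x: "pvar i \<notin> P 1" using P(3)[of 1] by simp
    have "\<exists>\<alpha>. poly (r i j) \<alpha> = 0 \<and> pvar j - const \<alpha> * pvar i \<in> P 1" if j: "j \<le> n" "j \<noteq> i" for j
      using r[of i j] gprime_root[OF P(1) i(1) j(1) x] sub P(2) i(1) j by (metis subsetD)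
    then obtain \<alpha> where \<alpha>: "\<And>j. j \<le> n \<Longrightarrow> j \<noteq> i \<Longrightarrow> poly (r i j) (\<alpha> j) = 0 \<and> pvar j - const (\<alpha> j) * pvar i \<in> P 1"
      by metis
    define v where "v j = (if j = i then 1 else if j \<le> n then \<alpha> j else 0)" for j
    have "v \<in> X" unfolding X_def v_def R_def using \<alpha> i(1) by (auto split: if_splits)
    moreover have "poly_eval v p = 0" if p: "p \<in> J e" for e p
    proof (rule ccontr)
      assume nz: "poly_eval v p \<noteq> 0"
      have "pvar j - const (v j) * pvar i \<in> P 1" if "j \<le> n" for j
        using \<alpha> that gidealD(6)[OF gP] by (auto simp: v_def)
      then have "p - const (poly_eval v p) * pvar i ^ e \<in> P e"
        using eval_congruence[OF gP i(1)] gidealD(5)[OF J p] by blast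
      then have "p - (p - const (poly_eval v p) * pvar i ^ e) \<in> P e"
        using gidealD(8)[OF gP] P(2) p by blast
      then have "pvar i ^ e \<in> P e" using gideal_unscale[OF gP _ nz] by simp
      then show False using P(3) by blast
    qed
    ultimately show ?thesis by blast
  qed
  moreover have "\<exists>i\<le>n. v i \<noteq> 0" if "v \<in> X" for v using that by (simp add: X_def)
  ultimately show ?thesis by (intro exI[of _ X] conjI ballI allI impI)
qed

text \<open>The coefficient vectors (1, t, ..., t^n) suffice: for fixed \<open>v\<close> the value
  of the form is a nonzero polynomial in t, so each \<open>v\<close> excludes finitely many
  t.\<close>

lemma generic_linear_form:
  assumes "finite X" "\<And>v. v \<in> X \<Longrightarrow> \<exists>i\<le>n. v i \<noteq> 0"
  obtains l where "l \<in> forms n 1" "\<And>v. v \<in> X \<Longrightarrow> poly_eval v l \<noteq> 0"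
proof -
  define q where "q v = (\<Sum>i\<le>n. Polynomial.monom (v i) i)" for v :: "nat \<Rightarrow> complex"
  have coeff: "coeff (q v) i = v i" if "i \<le> n" for v i
    using that by (simp add: q_def coeff_sum)
  have "finite {t. poly (q v) t = 0}" if "v \<in> X" for v
  proof -
    have "q v \<noteq> 0" using assms(2)[OF that] coeff by (metis coeff_0)
    then show ?thesis by (rule poly_roots_finite)
  qed
  then have "finite (\<Union>v\<in>X. {t. poly (q v) t = 0})" using assms(1) by blast
  then obtain t where t: "t \<notin> (\<Union>v\<in>X. {t. poly (q v) t = 0})"
    using ex_new_if_finite[OF infinite_UNIV_char_0] by blast
  show thesis
  proof
    show "(\<Sum>i\<le>n. const (t ^ i) * pvar i) \<in> forms n 1"
      by (intro forms_sum forms_scale pvar_in_forms) auto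
    show "poly_eval v (\<Sum>i\<le>n. const (t ^ i) * pvar i) \<noteq> 0" if "v \<in> X" for v
    proof -
      have "poly_eval v (\<Sum>i\<le>n. const (t ^ i) * pvar i) = poly (q v) t"
        by (simp add: poly_eval_simps q_def poly_sum poly_monom mult.commute)
      then show ?thesis using t that by auto
    qed
  qed
qed

text \<open>A single form making \<open>J\<close> irrelevant bounds the Hilbert function and so
  leaves finitely many zeros. A linear form avoiding the zeros of both ideals is a parameter for
  both.\<close>

lemma common_linear_parameter:
  assumes J: "gideal n J" "gideal n J'" and f: "f \<in> forms n a" "f' \<in> forms n a'" "a \<ge> 1" "a' \<ge> 1"
    and cof: "eventually_full n (gsum n J a f)" "eventually_full n (gsum n J' a' f')"
  obtains z where "z \<in> forms n 1" "eventually_full n (gsum n J 1 z)" "eventually_full n (gsum n J' 1 z)"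
proof -
  have *: "\<exists>X. finite X \<and> (\<forall>v\<in>X. \<exists>i\<le>n. v i \<noteq> 0) \<and>
     (\<forall>z\<in>forms n 1. (\<forall>v\<in>X. poly_eval v z \<noteq> 0) \<longrightarrow> eventually_full n (gsum n J 1 z))"
    if J: "gideal n J" and f: "f \<in> forms n a" "a \<ge> 1" and cof: "eventually_full n (gsum n J a f)" for J a f
  proof -
    obtain C where C: "\<And>e. hf n J e \<le> C" using hf_bounded[OF J f cof] by blast
    have rel: "\<And>i j. i \<le> n \<Longrightarrow> j \<le> n \<Longrightarrow> i \<noteq> j \<Longrightarrow> brel n J i j"
      by (rule brel_of_bounded[OF J C])
    obtain X where X: "finite X" "\<forall>v\<in>X. \<exists>i\<le>n. v i \<noteq> 0"
      "\<forall>J'. gideal n J' \<longrightarrow> (\<forall>e. J e \<subseteq> J' e) \<longrightarrow> \<not> eventually_full n J' \<longrightarrow>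
        (\<exists>v\<in>X. \<forall>e. \<forall>p\<in>J' e. poly_eval v p = 0)"
      using finite_zero_directions[OF J rel] by blast
    have "eventually_full n (gsum n J 1 z)" if z: "z \<in> forms n 1" "\<forall>v\<in>X. poly_eval v z \<noteq> 0" for z
    proof (rule ccontr)
      assume "\<not> ?thesis"
      moreover have "\<forall>e. J e \<subseteq> gsum n J 1 z e" using gsum_upper by blast
      ultimately obtain v where "v \<in> X" "\<forall>e. \<forall>p\<in>gsum n J 1 z e. poly_eval v p = 0"
        using X(3) gideal_gsum[OF J z(1)] by blast
      then show False using gsum_gen1[OF J, of z 1] z(2) by blast
    qed
    then show ?thesis using X(1,2) by blast
  qed
  obtain X where X: "finite X" "\<forall>v\<in>X. \<exists>i\<le>n. v i \<noteq> 0"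
    "\<forall>z\<in>forms n 1. (\<forall>v\<in>X. poly_eval v z \<noteq> 0) \<longrightarrow> eventually_full n (gsum n J 1 z)"
    using *[OF J(1) f(1,3) cof(1)] by blast
  obtain X' where X': "finite X'" "\<forall>v\<in>X'. \<exists>i\<le>n. v i \<noteq> 0"
    "\<forall>z\<in>forms n 1. (\<forall>v\<in>X'. poly_eval v z \<noteq> 0) \<longrightarrow> eventually_full n (gsum n J' 1 z)"
    using *[OF J(2) f(2,4) cof(2)] by blast
  obtain z where "z \<in> forms n 1" "\<And>v. v \<in> X \<union> X' \<Longrightarrow> poly_eval v z \<noteq> 0"
    using generic_linear_form[of "X \<union> X'" n] X(1,2) X'(1,2) by (metis Un_iff finite_UnI)
  then show thesis using that X(3) X'(3) by blast
qed

section \<open>Regular sequences of forms\<close>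

text \<open>The sequence is read from the end of the list: each entry is regular modulo the entries
  behind it.\<close>

fun regseq :: "nat \<Rightarrow> (nat \<times> mpoly) list \<Rightarrow> bool" where
  "regseq n [] \<longleftrightarrow> True"
| "regseq n ((a, f) # fs) \<longleftrightarrow> nzd n (gen n fs) a f \<and> regseq n fs"

definition pos_form_list :: "nat \<Rightarrow> (nat \<times> mpoly) list \<Rightarrow> bool" where
  "pos_form_list n fs \<longleftrightarrow> (\<forall>(a, f)\<in>set fs. 1 \<le> a \<and> f \<in> forms n a)"

lemma pos_form_list_simps [simp]: "pos_form_list n []"
  "pos_form_list n ((a, f) # fs) \<longleftrightarrow> 1 \<le> a \<and> f \<in> forms n a \<and> pos_form_list n fs"
  "pos_form_list n (fs @ gs) \<longleftrightarrow> pos_form_list n fs \<and> pos_form_list n gs"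
  by (auto simp: pos_form_list_def)

lemma pos_form_list_gideal: "pos_form_list n fs \<Longrightarrow> gideal n (gen n fs)"
  by (rule gideal_gen) (auto simp: pos_form_list_def form_list_def)

lemma nzdD: "nzd n J a f \<Longrightarrow> p \<in> forms n e \<Longrightarrow> f * p \<in> J (a + e) \<Longrightarrow> p \<in> J e"
  by (auto simp: nzd_def)

text \<open>Homogeneous regular sequences can be permuted. For the first claim, \<open>g p\<close>
  in \<open>J\<close> gives \<open>p = x + f q\<close> with x in \<open>J\<close>, and then
  \<open>g q\<close> is in \<open>J\<close>. As \<open>f\<close> has positive degree, q has smaller
  degree than p, and the descent ends.\<close>

lemma nzd_swap:
  assumes J: "gideal n J" and f: "f \<in> forms n a" and g: "g \<in> forms n b" and "1 \<le> a"
    and nf: "nzd n J a f" and ng: "nzd n (gsum n J a f) b g"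
  shows "nzd n J b g" "nzd n (gsum n J b g) a f"
proof -
  have "p \<in> J e" if "p \<in> forms n e" "g * p \<in> J (b + e)" for e p
    using that
  proof (induction e arbitrary: p rule: less_induct)
    case (less e)
    then have "p \<in> gsum n J a f e"
      using nzdD[OF ng] gsum_upper by blast
    then obtain x q where xq: "x \<in> J e" "q \<in> shifted_forms n e a" "p = x + f * q" by (elim gsumE)
    show ?case
    proof (cases "a \<le> e")
      case False
      then show ?thesis using xq by (simp add: shifted_forms_def)
    next
      case True
      then have q: "q \<in> forms n (e - a)" using xq by (simp add: shifted_forms_def)
      have "g * p - g * x \<in> J (b + e)"
        using gidealD(8)[OF J less.prems(2)] gidealD(3)[OF J xq(1) g] by blast
      then have "f * (g * q) \<in> J (a + (b + (e - a)))"
        using True by (simp add: xq(3) algebra_simps)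
      then have "g * q \<in> J (b + (e - a))" by (rule nzdD[OF nf forms_mult[OF g q]])
      then have "q \<in> J (e - a)" using less.IH[OF _ q] True \<open>1 \<le> a\<close> by simp
      then have "f * q \<in> J (a + (e - a))" by (rule gidealD(3)[OF J _ f])
      then show ?thesis using True xq gidealD(7)[OF J xq(1)] by simp
    qed
  qed
  then show "nzd n J b g" by (auto simp: nzd_def)
  show "nzd n (gsum n J b g) a f"
    unfolding nzd_def
  proof (intro allI ballI impI)
    fix e p assume p: "p \<in> forms n e" "f * p \<in> gsum n J b g (a + e)"
    then obtain x q where xq: "x \<in> J (a + e)" "q \<in> shifted_forms n (a + e) b" "f * p = x + g * q" by (elim gsumE)
    show "p \<in> gsum n J b g e"
    proof (cases "b \<le> a + e")
      case False
      then have "f * p \<in> J (a + e)" using xq by (simp add: shifted_forms_def)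
      then have "p \<in> J e" by (rule nzdD[OF nf p(1)])
      then show ?thesis by (rule gsum_upper)
    next
      case True
      then have q: "q \<in> forms n (a + e - b)" using xq by (simp add: shifted_forms_def)
      \<comment> \<open>From \<open>f p = x + g q\<close> it follows that q lies in
        \<open>J + (f)\<close>, say \<open>q = x' + f q'\<close>. Then \<open>f (p - g q')\<close>
        lies in \<open>J\<close>, and cancelling f shows that p lies in
        \<open>J + (g)\<close>.\<close>
      have "g * q = - x + f * p" using xq(3) by simp
      moreover have "- x \<in> J (a + e)" using gidealD(9)[OF J xq(1), of "-1"] by (simp add: const_uminus)
      ultimately have "g * q \<in> gsum n J a f (b + (a + e - b))"
        using True p(1) by (intro gsumI[of "- x" _ _ p]) (auto simp: shifted_forms_def)
      then have "q \<in> gsum n J a f (a + e - b)" by (rule nzdD[OF ng q])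
      then obtain x' q' where xq': "x' \<in> J (a + e - b)" "q' \<in> shifted_forms n (a + e - b) a" "q = x' + f * q'"
        by (elim gsumE)
      have gx: "g * x' \<in> J (a + e)" using gidealD(3)[OF J xq'(1) g] True by simp
      have "f * (p - g * q') = x + g * x'"
        using xq(3) xq'(3) by (simp add: algebra_simps)
      then have fp: "f * (p - g * q') \<in> J (a + e)" using gidealD(7)[OF J xq(1) gx] by simp
      have q': "q' \<in> shifted_forms n e b"
        using xq'(2) True by (auto simp: shifted_forms_def forms_zero split: if_splits)
      then have "p - g * q' \<in> forms n e"
        using p(1) mult_shifted_forms[OF q' g] by (intro forms_diff)
      then have "p - g * q' \<in> J e" using fp by (rule nzdD[OF nf])
      then show ?thesis using q' by (intro gsumI[of "p - g * q'" _ _ q']) auto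
    qed
  qed
qed

lemma regseq_swap:
  assumes "pos_form_list n (x # y # fs)" "regseq n (x # y # fs)"
  shows "regseq n (y # x # fs)"
proof -
  obtain a f b g where xy: "x = (b, g)" "y = (a, f)" by (cases x, cases y)
  have J: "gideal n (gen n fs)" using assms by (auto simp: xy intro: pos_form_list_gideal)
  show ?thesis
    using nzd_swap[OF J, of f a g b] assms by (simp add: xy)
qed

lemma regseq_move:
  assumes "pos_form_list n (as @ z # cs)"
  shows "regseq n (as @ z # cs) \<longleftrightarrow> regseq n (z # as @ cs)"
  using assms
proof (induction as)
  case Nil
  then show ?case by simp
next
  case (Cons x as)
  obtain a f where x: "x = (a, f)" by (cases x)
  obtain b g where z: "z = (b, g)" by (cases z)
  have pos: "pos_form_list n (x # z # as @ cs)" "pos_form_list n (z # x # as @ cs)"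
    using Cons.prems by (auto simp: x z)
  have "regseq n ((x # as) @ z # cs) \<longleftrightarrow> regseq n (x # z # as @ cs)"
    using Cons gen_move[of n as z cs] by (simp add: x)
  also have "\<dots> \<longleftrightarrow> regseq n (z # x # as @ cs)"
    using regseq_swap pos by blast
  finally show ?case by simp
qed

text \<open>If \<open>f\<close> completes \<open>J\<close> to an irrelevant ideal, then a power of \<open>z\<close> is a multiple of \<open>f\<close> modulo \<open>J\<close>.\<close>

lemma nzd_exchange:
  assumes J: "gideal n J" and z: "z \<in> forms n b" "1 \<le> b" "nzd n J b z"
    and f: "f \<in> forms n a" and full: "eventually_full n (gsum n J a f)"
  shows "nzd n J a f"
  unfolding nzd_def
proof (intro allI ballI impI)
  fix e p assume p: "p \<in> forms n e" "f * p \<in> J (a + e)"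
  obtain N where N: "\<And>e. e \<ge> N \<Longrightarrow> forms n e \<subseteq> gsum n J a f e" using full by (auto simp: eventually_full_def)
  \<comment> \<open>The power has degree N b, which is at least N as \<open>b\<close> is
    positive.\<close>
  have "z ^ N \<in> gsum n J a f (N * b)"
    using N[of "N * b"] forms_power[OF z(1), of N] z(2) by auto
  then obtain x u where xu: "x \<in> J (N * b)" "u \<in> shifted_forms n (N * b) a" "z ^ N = x + f * u" by (elim gsumE)
  have "u * (f * p) \<in> J (N * b + e)"
  proof (cases "a \<le> N * b")
    case True
    then have "u \<in> forms n (N * b - a)" using xu by (simp add: shifted_forms_def)
    then have "u * (f * p) \<in> J (N * b - a + (a + e))" by (rule gidealD(3)[OF J p(2)])
    then show ?thesis using True by (simp add: algebra_simps)
  next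
    case False
    then show ?thesis using xu gidealD(6)[OF J] by (simp add: shifted_forms_def)
  qed
  moreover have "p * x \<in> J (N * b + e)" using gidealD(4)[OF J xu(1) p(1)] .
  ultimately have "z ^ N * p \<in> J (N * b + e)"
    using gidealD(7)[OF J] xu(3) by (simp add: algebra_simps)
  moreover have "p \<in> J e" if "z ^ k * p \<in> J (k * b + e)" for k
    using that
  proof (induction k)
    case (Suc k)
    have "z * (z ^ k * p) \<in> J (b + (k * b + e))" using Suc.prems by (simp add: algebra_simps)
    then have "z ^ k * p \<in> J (k * b + e)"
      by (rule nzdD[OF z(3) forms_mult[OF forms_power[OF z(1)] p(1)]])
    then show ?case by (rule Suc.IH)
  qed simp
  ultimately show "p \<in> J e" by blast
qed

text \<open>An exchange argument. The heads of both lists are traded for one linear form z that is a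
  parameter modulo both remainders. Regularity goes from the first head to z, then z is moved into
  the common tail for the induction hypothesis, and finally it goes from z to the second head. This
  is why the tail \<open>cs\<close> is left arbitrary in the induction.\<close>

theorem regseq_of_eventually_full:
  assumes "length as = length bs" "pos_form_list n (as @ cs)" "pos_form_list n (bs @ cs)"
    "regseq n (as @ cs)" "eventually_full n (gen n (as @ cs))" "eventually_full n (gen n (bs @ cs))"
  shows "regseq n (bs @ cs)"
  using assms
proof (induction as bs arbitrary: cs rule: list_induct2)
  case Nil
  then show ?case by simp
next
  case (Cons x as y bs)
  obtain a f where x: "x = (a, f)" by (cases x)
  obtain b g where y: "y = (b, g)" by (cases y)
  have pos: "pos_form_list n (as @ cs)" "f \<in> forms n a" "1 \<le> a" "pos_form_list n (bs @ cs)" "g \<in> forms n b" "1 \<le> b"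
    using Cons.prems by (auto simp: x y)
  note J = pos_form_list_gideal[OF pos(1)] pos_form_list_gideal[OF pos(4)]
  obtain z where z: "z \<in> forms n 1" "eventually_full n (gsum n (gen n (as @ cs)) 1 z)"
    "eventually_full n (gsum n (gen n (bs @ cs)) 1 z)"
    using common_linear_parameter[OF J pos(2,5,3,6)] Cons.prems(4,5) by (auto simp: x y)
  have "nzd n (gen n (as @ cs)) 1 z"
    using nzd_exchange[OF J(1) pos(2,3) _ z(1,2)] Cons.prems(3) by (simp add: x)
  then have "regseq n ((1, z) # as @ cs)" using Cons.prems(3) by (simp add: x)
  then have "regseq n (as @ (1, z) # cs)"
    using regseq_move[of n as "(1, z)" cs] pos z by simp
  moreover have "eventually_full n (gen n (as @ (1, z) # cs))" "eventually_full n (gen n (bs @ (1, z) # cs))"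
    using z by (simp_all add: gen_move)
  ultimately have "regseq n (bs @ (1, z) # cs)"
    using Cons.IH[of "(1, z) # cs"] pos z by simp
  then have "regseq n ((1, z) # bs @ cs)"
    using regseq_move[of n bs "(1, z)" cs] pos z by simp
  then show ?case
    using nzd_exchange[OF J(2) z(1) _ _ pos(5)] Cons.prems(5) by (simp add: y)
qed

section \<open>Bezout's theorem for complete intersections\<close>

definition hseries :: "nat \<Rightarrow> (nat \<Rightarrow> mpoly set) \<Rightarrow> int fps" where
  "hseries n J = Abs_fps (hf n J)"

lemma hseries_gsum:
  assumes "gideal n J" "f \<in> forms n a" "nzd n J a f"
  shows "hseries n (gsum n J a f) = (1 - fps_X ^ a) * hseries n J"
proof (rule fps_ext)
  fix e
  have "fps_nth ((1 - fps_X ^ a) * hseries n J) e = hf n J e - (if e < a then 0 else hf n J (e - a))"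
    by (simp add: left_diff_distrib fps_X_power_mult_nth hseries_def)
  also have "\<dots> = hf n (gsum n J a f) e"
    using hf_gsum_nzd[OF assms(1,2) _ assms(3), of e] hf_gsum_small[of e a n J f] by auto
  finally show "fps_nth (hseries n (gsum n J a f)) e = fps_nth ((1 - fps_X ^ a) * hseries n J) e"
    by (simp only: hseries_def fps_nth_Abs_fps)
qed

lemma hseries_regseq:
  assumes "pos_form_list n fs" "regseq n fs" "\<And>a f. (a, f) \<in> set fs \<Longrightarrow> a = D"
  shows "hseries n (gen n fs) = (1 - fps_X ^ D) ^ length fs * hseries n (gen n [])"
  using assms
proof (induction fs)
  case Nil
  then show ?case by simp
next
  case (Cons x fs)
  obtain f where x: "x = (D, f)" using Cons.prems(3) by (cases x) auto
  have "hseries n (gen n (x # fs)) = (1 - fps_X ^ D) * hseries n (gen n fs)"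
    using Cons.prems(1,2) by (simp add: x hseries_gsum pos_form_list_gideal)
  also have "hseries n (gen n fs) = (1 - fps_X ^ D) ^ length fs * hseries n (gen n [])"
  proof (rule Cons.IH)
    show "b = D" if "(b, g) \<in> set fs" for b g using Cons.prems(3)[of b g] that by simp
  qed (use Cons.prems(1,2) in \<open>simp_all add: x\<close>)
  finally show ?case by (simp add: mult.assoc)
qed

section \<open>The variables as a regular sequence\<close>

lemma lookup_single_mult:
  "Poly_Mapping.lookup (Poly_Mapping.single k 1 * p) (k + m) = Poly_Mapping.lookup (p :: mpoly) m"
  by (induction p rule: mpoly_induct)
    (simp_all add: mult_single lookup_single when_def lookup_add distrib_left)

definition var_list :: "nat list \<Rightarrow> (nat \<times> mpoly) list" where
  "var_list is = map (\<lambda>i. (1, pvar i)) is"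

lemma pos_form_list_var_list: "set is \<subseteq> {..n} \<Longrightarrow> pos_form_list n (var_list is)"
  using pvar_in_forms by (auto simp: pos_form_list_def var_list_def)

text \<open>Membership in this monomial ideal is decided exponent by exponent, which makes every
  further variable visibly a nonzerodivisor.\<close>

lemma gen_var_list:
  assumes "set is \<subseteq> {..n}"
  shows "gen n (var_list is) e = {p \<in> forms n e. \<forall>m\<in>Poly_Mapping.keys p. Poly_Mapping.keys m \<inter> set is \<noteq> {}}"
proof -
  define Y where "Y e = {p \<in> forms n e. \<forall>m\<in>Poly_Mapping.keys p. Poly_Mapping.keys m \<inter> set is \<noteq> {}}" for e
  have gY: "gideal n Y"
    unfolding gideal_def
  proof (intro conjI allI impI)
    fix e
    show "Y e \<subseteq> forms n e" by (auto simp: Y_def)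
    have "p + q \<in> Y e" if "p \<in> Y e" "q \<in> Y e" for p q
      using that Poly_Mapping.keys_add[of p q] by (auto simp: Y_def forms_add)
    moreover have "const c * p \<in> Y e" if "p \<in> Y e" for c p
      using that keys_const_mult[of c p] by (auto simp: Y_def forms_scale)
    moreover have "0 \<in> Y e" by (auto simp: Y_def forms_zero)
    ultimately show "mpoly_vs.subspace (Y e)" by (auto simp: mpoly_vs.subspace_def)
    fix a p q assume pq: "p \<in> Y e" "q \<in> forms n a"
    have "Poly_Mapping.keys m \<inter> set is \<noteq> {}" if m: "m \<in> Poly_Mapping.keys (q * p)" for m
    proof -
      obtain x y where "m = x + y" "y \<in> Poly_Mapping.keys p" using m keys_mult[of q p] by blast
      then show ?thesis using pq by (auto simp: Y_def keys_add_nat)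
    qed
    then show "q * p \<in> Y (a + e)" using pq forms_mult by (auto simp: Y_def)
  qed
  have "gen n (var_list is) e \<subseteq> Y e"
  proof
    fix p assume "p \<in> gen n (var_list is) e"
    then show "p \<in> Y e"
    proof (rule gen_least[OF gY, rotated])
      show "f \<in> Y a" if "(a, f) \<in> set (var_list is)" for a f
        using that assms pvar_in_forms by (auto simp: var_list_def Y_def) (auto simp: pvar_def)
    qed
  qed
  moreover have "Y e \<subseteq> gen n (var_list is) e"
  proof
    fix p assume p: "p \<in> Y e"
    note gg = pos_form_list_gideal[OF pos_form_list_var_list[OF assms]]
    have "Poly_Mapping.single m (Poly_Mapping.lookup p m) \<in> gen n (var_list is) e"
      if m: "m \<in> Poly_Mapping.keys p" for m
    proof -
      obtain i where i: "i \<in> Poly_Mapping.keys m" "i \<in> set is" using p m by (auto simp: Y_def)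
      have me: "m \<in> exponents n e" using p m by (auto simp: Y_def in_forms_iff)
      obtain m' where m': "m = Poly_Mapping.single i 1 + m'" using exponent_split[OF i(1)] by metis
      then have "m' \<in> exponents n (e - 1)" "1 \<le> e" using me by (auto simp: exponents_def keys_add_nat)
      moreover have "pvar i \<in> gen n (var_list is) 1"
        using i pos_form_list_var_list[OF assms]
        by (intro gen_generator) (auto simp: var_list_def pos_form_list_def form_list_def)
      ultimately have "Poly_Mapping.single m' (Poly_Mapping.lookup p m) * pvar i \<in> gen n (var_list is) (e - 1 + 1)"
        using gidealD(3)[OF gg _ single_in_forms] by blast
      then show ?thesis
        using \<open>1 \<le> e\<close> by (simp add: pvar_def mult_single m' add.commute)
    qed
    then have "(\<Sum>m\<in>Poly_Mapping.keys p. Poly_Mapping.single m (Poly_Mapping.lookup p m)) \<in> gen n (var_list is) e"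
      by (rule gidealD(10)[OF gg])
    then show "p \<in> gen n (var_list is) e" by (simp add: mpoly_sum_monomials)
  qed
  ultimately show ?thesis by (auto simp: Y_def)
qed

lemma regseq_var_list:
  "distinct is \<Longrightarrow> set is \<subseteq> {..n} \<Longrightarrow> regseq n (var_list is)"
proof (induction "is")
  case Nil
  then show ?case by (simp add: var_list_def)
next
  case (Cons i "is")
  then have sub: "set is \<subseteq> {..n}" by simp
  have "nzd n (gen n (var_list is)) 1 (pvar i)"
    unfolding nzd_def
  proof (intro allI ballI impI)
    fix e p assume p: "p \<in> forms n e" "pvar i * p \<in> gen n (var_list is) (1 + e)"
    have "Poly_Mapping.keys m \<inter> set is \<noteq> {}" if "m \<in> Poly_Mapping.keys p" for m
    proof -
      have "Poly_Mapping.single i 1 + m \<in> Poly_Mapping.keys (pvar i * p)"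
        using that by (simp only: pvar_def in_keys_iff lookup_single_mult) auto
      then have "Poly_Mapping.keys (Poly_Mapping.single i 1 + m) \<inter> set is \<noteq> {}"
        using p(2) unfolding gen_var_list[OF sub] by blast
      then show ?thesis using Cons.prems(1) by (auto simp: keys_add_nat)
    qed
    then show "p \<in> gen n (var_list is) e" using p(1) by (simp add: gen_var_list[OF sub])
  qed
  then show ?case using Cons by (simp add: var_list_def)
qed

lemma dim_forms_0: "mpoly_vs.dim (forms n 0) = 1"
proof -
  have "forms n 0 \<subseteq> mpoly_vs.span {1}"
  proof
    fix p assume "p \<in> forms n 0"
    then have "p = const (Poly_Mapping.lookup p 0) * 1" using forms_0 by simp
    then show "p \<in> mpoly_vs.span {1}" by (metis mpoly_vs.span_base mpoly_vs.span_scale singletonI)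
  qed
  then show ?thesis
    using mpoly_vs.basis_card_eq_dim[of "{1}" "forms n 0"] one_in_forms by simp
qed

text \<open>The quotient by all variables is the base field. With regularity this determines the
  Hilbert series of S implicitly, through \<open>(1 - X)^(n+1) H = 1\<close>, and no monomials have
  to be counted.\<close>

lemma hseries_all_vars: "hseries n (gen n (var_list [0..<Suc n])) = 1"
  and eventually_full_all_vars: "eventually_full n (gen n (var_list [0..<Suc n]))"
proof -
  let ?J = "gen n (var_list [0..<Suc n])"
  have set: "set [0..<Suc n] = {..n}" by auto
  then have sub: "set [0..<Suc n] \<subseteq> {..n}" by simp
  note gg = pos_form_list_gideal[OF pos_form_list_var_list[OF sub]]
  have J: "?J e = {p \<in> forms n e. \<forall>m\<in>Poly_Mapping.keys p. Poly_Mapping.keys m \<inter> {..n} \<noteq> {}}" for e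
    using gen_var_list[OF sub] by (simp only: set)
  have big: "forms n e \<subseteq> ?J e" if "e \<ge> 1" for e
  proof
    fix p assume p: "p \<in> forms n e"
    have "Poly_Mapping.keys m \<inter> {..n} \<noteq> {}" if "m \<in> Poly_Mapping.keys p" for m
    proof -
      have "m \<in> exponents n e" using p that by (auto simp: in_forms_iff)
      then have "m \<noteq> 0" "Poly_Mapping.keys m \<subseteq> {..n}" using \<open>e \<ge> 1\<close> by (auto simp: exponents_def)
      then show ?thesis by (metis Int_absorb2 keys_eq_empty)
    qed
    then show "p \<in> ?J e" using p by (simp add: J del: upt_Suc)
  qed
  then show "eventually_full n ?J" unfolding eventually_full_def by blast
  have "?J 0 = {0}"
  proof -
    have "p = 0" if "p \<in> ?J 0" for p
    proof -
      have "Poly_Mapping.keys p \<subseteq> exponents n 0" "\<forall>m\<in>Poly_Mapping.keys p. m \<noteq> 0"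
        using that by (auto simp: J in_forms_iff simp del: upt_Suc)
      then have "Poly_Mapping.keys p = {}" by (auto simp: exponents_def simp del: keys_eq_empty)
      then show ?thesis by simp
    qed
    then show ?thesis using gidealD(6)[OF gg, of 0] by blast
  qed
  then have "hf n ?J 0 = 1" by (simp only: hf_def dim_forms_0 dim_zero)
  moreover have "hf n ?J e = 0" if "e \<ge> 1" for e using hf_eventually_full[OF gg big[OF that]] .
  ultimately have "hf n ?J e = (if e = 0 then 1 else 0)" for e by (cases e) (auto simp del: upt_Suc)
  then show "hseries n ?J = 1"
    by (intro fps_ext) (simp add: hseries_def del: upt_Suc)
qed

text \<open>The Hilbert series of the quotient is the polynomial
  \<open>(1 + X + ... + X^(D-1))^(n+1)\<close>. Its coefficients are nonnegative, so partial sums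
  are at most its value at 1.\<close>

theorem bezout:
  assumes fs: "pos_form_list n fs" "length fs = Suc n" "\<And>a f. (a, f) \<in> set fs \<Longrightarrow> a = D"
    and full: "eventually_full n (gen n fs)"
  shows "(\<Sum>e\<le>E. hf n (gen n fs) e) \<le> int D ^ Suc n"
proof -
  let ?vs = "var_list [0..<Suc n]"
  have sub: "set [0..<Suc n] \<subseteq> {..n}" by auto
  have pos: "pos_form_list n ?vs" by (rule pos_form_list_var_list[OF sub])
  have regv: "regseq n ?vs" by (rule regseq_var_list[OF distinct_upt sub])
  have len: "length ?vs = Suc n" by (simp add: var_list_def)
  have "regseq n (fs @ [])"
    by (rule regseq_of_eventually_full[of ?vs])
      (use len fs(1,2) pos regv full eventually_full_all_vars in \<open>simp_all del: upt_Suc\<close>)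
  then have "hseries n (gen n fs) = (1 - fps_X ^ D) ^ Suc n * hseries n (gen n [])"
    using hseries_regseq[OF fs(1) _ fs(3)] fs(2) by (simp only: append_Nil2)
  moreover have "1 = (1 - fps_X ^ 1) ^ Suc n * hseries n (gen n [])"
    using hseries_regseq[OF pos regv, of 1] hseries_all_vars[of n] len by (auto simp: var_list_def simp del: upt_Suc)
  \<comment> \<open>Factoring 1 - X out of each 1 - X^D lets the unknown series of S cancel against
    \<open>(1 - X)^(n+1)\<close>.\<close>
  moreover have "1 - fps_X ^ D = (\<Sum>i<D. fps_X ^ i) * (1 - fps_X ^ 1 :: int fps)"
    using one_diff_power_eq[of "fps_X :: int fps" D] by (simp add: mult.commute)
  ultimately have "hseries n (gen n fs) = (\<Sum>i<D. fps_X ^ i) ^ Suc n * 1"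
    by (simp only: power_mult_distrib mult.assoc)
  then have hs: "hseries n (gen n fs) = (\<Sum>i<D. fps_X ^ i) ^ Suc n" by (simp only: mult_1_right)
  define Q :: "int poly" where "Q = (\<Sum>i<D. Polynomial.monom 1 i) ^ Suc n"
  have "fps_of_poly Q = hseries n (gen n fs)"
    unfolding hs Q_def by (simp add: fps_of_poly_power fps_of_poly_sum fps_of_poly_monom fps_of_poly_mult)
  then have coeff: "coeff Q e = hf n (gen n fs) e" for e
    by (metis fps_of_poly_nth hseries_def fps_nth_Abs_fps)
  have nonneg: "coeff Q e \<ge> 0" for e using hf_nonneg[OF pos_form_list_gideal[OF fs(1)]] coeff by simp
  have "(\<Sum>e\<le>E. hf n (gen n fs) e) = (\<Sum>e\<le>E. coeff Q e)" by (simp add: coeff)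
  also have "\<dots> \<le> (\<Sum>e\<le>max E (degree Q). coeff Q e)"
    using nonneg by (intro sum_mono2) auto
  also have "\<dots> = (\<Sum>e\<le>degree Q. coeff Q e)"
    by (intro sum.mono_neutral_right) (auto simp: coeff_eq_0)
  also have "\<dots> = poly Q 1" by (simp add: poly_altdef)
  also have "\<dots> = int D ^ Suc n" by (simp add: Q_def poly_sum poly_monom)
  finally show ?thesis .
qed

section \<open>The ideal of the eigenscheme\<close>

definition minor_list :: "nat \<Rightarrow> nat \<Rightarrow> (nat \<Rightarrow> mpoly) \<Rightarrow> (nat \<times> mpoly) list" where
  "minor_list n D g = map (\<lambda>(i, j). (Suc D, pvar i * g j - pvar j * g i)) (List.product [0..<Suc n] [0..<Suc n])"

definition entry_list :: "nat \<Rightarrow> nat \<Rightarrow> (nat \<Rightarrow> mpoly) \<Rightarrow> (nat \<times> mpoly) list" where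
  "entry_list n D g = map (\<lambda>i. (D, g i)) [0..<Suc n]"

abbreviation "eig n D g \<equiv> gen n (minor_list n D g)"
abbreviation "entries n D g \<equiv> gen n (entry_list n D g)"

lemma set_minor_list: "(a, f) \<in> set (minor_list n D g) \<longleftrightarrow>
    a = Suc D \<and> (\<exists>i j. i \<le> n \<and> j \<le> n \<and> f = pvar i * g j - pvar j * g i)"
  by (fastforce simp: minor_list_def less_Suc_eq_le simp del: upt_Suc)

lemma set_entry_list: "(a, f) \<in> set (entry_list n D g) \<longleftrightarrow> a = D \<and> (\<exists>i\<le>n. f = g i)"
  by (fastforce simp: entry_list_def less_Suc_eq_le simp del: upt_Suc)

lemma minor_in_forms:
  assumes "\<And>i. i \<le> n \<Longrightarrow> g i \<in> forms n D" "i \<le> n" "j \<le> n"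
  shows "pvar i * g j - pvar j * g i \<in> forms n (Suc D)"
  using forms_diff[OF forms_mult[OF pvar_in_forms[OF assms(2)] assms(1)[OF assms(3)]]
    forms_mult[OF pvar_in_forms[OF assms(3)] assms(1)[OF assms(2)]]] by simp

lemma form_list_minor_list:
  assumes "\<And>i. i \<le> n \<Longrightarrow> g i \<in> forms n D"
  shows "form_list n (minor_list n D g)"
  using minor_in_forms[of n g D, OF assms] by (auto simp: form_list_def set_minor_list)

lemma form_list_entry_list:
  assumes "\<And>i. i \<le> n \<Longrightarrow> g i \<in> forms n D"
  shows "form_list n (entry_list n D g)"
  using assms by (auto simp: form_list_def set_entry_list)

text \<open>Arbitrary forms of one degree, so that the results apply to tensors, to gradients and to
  the modified forms \<open>g'\<close> in \<open>eig_degree_bound\<close>.\<close>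

locale eigen_tensor =
  fixes n D :: nat and g :: "nat \<Rightarrow> mpoly"
  assumes g: "\<And>i. i \<le> n \<Longrightarrow> g i \<in> forms n D"
begin

lemma gideal_eig: "gideal n (eig n D g)" and gideal_entries: "gideal n (entries n D g)"
  using form_list_minor_list form_list_entry_list g by (auto intro: gideal_gen)

lemma minor_in_eig: "i \<le> n \<Longrightarrow> j \<le> n \<Longrightarrow> pvar i * g j - pvar j * g i \<in> eig n D g (Suc D)"
  using form_list_minor_list[of n g D, OF g] by (intro gen_generator) (auto simp: set_minor_list)

lemma entry_in_entries: "i \<le> n \<Longrightarrow> g i \<in> entries n D g D"
  using form_list_entry_list[of n g D, OF g] by (intro gen_generator) (auto simp: set_entry_list)

lemma eig_subset_entries: "eig n D g e \<subseteq> entries n D g e"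
proof
  fix p assume "p \<in> eig n D g e"
  then show "p \<in> entries n D g e"
  proof (rule gen_least[OF gideal_entries, rotated])
    fix a f assume "(a, f) \<in> set (minor_list n D g)"
    then obtain i j where ij: "a = Suc D" "i \<le> n" "j \<le> n" "f = pvar i * g j - pvar j * g i"
      by (auto simp: set_minor_list)
    show "f \<in> entries n D g a"
      using gidealD(8)[OF gideal_entries gidealD(3)[OF gideal_entries entry_in_entries[OF ij(3)] pvar_in_forms[OF ij(2)]]
          gidealD(3)[OF gideal_entries entry_in_entries[OF ij(2)] pvar_in_forms[OF ij(3)]]] ij by simp
  qed
qed

text \<open>
  Modulo the minors, replacing a factor \<open>x\<^sub>i\<close> by \<open>g\<^sub>i\<close> does not depend on the chosen factor.
  This map realises the division \<open>g\<^sub>i / x\<^sub>i\<close>, whose value at an eigenvector is the eigenvalue.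
\<close>

definition phi :: "mpoly \<Rightarrow> mpoly" where
  "phi = lin_ext (\<lambda>m. if m = 0 then 0 else
     g (Min (Poly_Mapping.keys m)) * Poly_Mapping.single (m - Poly_Mapping.single (Min (Poly_Mapping.keys m)) 1) 1)"

lemma linear_phi: "mpoly_linear phi"
  unfolding phi_def by (rule linear_lin_ext)

lemma phi_single:
  assumes "k = Min (Poly_Mapping.keys (Poly_Mapping.single i 1 + m))" "Poly_Mapping.single i 1 + m = Poly_Mapping.single k 1 + m'"
  shows "phi (Poly_Mapping.single (Poly_Mapping.single i 1 + m) 1) = g k * Poly_Mapping.single m' 1"
proof -
  have "i \<in> Poly_Mapping.keys (Poly_Mapping.single i 1 + m)" by (simp add: keys_add_nat)
  then have "Poly_Mapping.single i 1 + m \<noteq> 0" by (metis empty_iff keys_zero)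
  moreover have "Poly_Mapping.single i 1 + m - Poly_Mapping.single k 1 = m'"
    using assms(2) by (simp only: add_diff_cancel_left')
  ultimately show ?thesis
    unfolding phi_def lin_ext_single assms(1)[symmetric] by (simp only: const_simps mult_1 if_False)
qed

text \<open>\<open>phi\<close> replaces the variable of least index k. If k is not i, the monomial
  is \<open>x_i x_k m'\<close> and the difference is m' times the minor
  \<open>x_i g_k - x_k g_i\<close>.\<close>

lemma phi_var:
  assumes "q \<in> forms n e" and i: "i \<le> n"
  shows "phi (pvar i * q) - g i * q \<in> eig n D g (D + e)"
  using assms(1)
proof (induction rule: subspace_forms_induct)
  case subspace
  have "(phi (pvar i * (p + q)) - g i * (p + q)) = (phi (pvar i * p) - g i * p) + (phi (pvar i * q) - g i * q)" for p q
    by (simp add: distrib_left mpoly_linearD(1)[OF linear_phi])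
  moreover have "(phi (pvar i * (const c * p)) - g i * (const c * p)) = const c * (phi (pvar i * p) - g i * p)" for c p
    using mpoly_linearD(2)[OF linear_phi, of c "pvar i * p"] by (simp add: algebra_simps)
  ultimately show ?case
    using gidealD(6,7,9)[OF gideal_eig] by (simp add: mpoly_vs.subspace_def mpoly_linearD(3)[OF linear_phi])
next
  case (monomial m)
  let ?m = "Poly_Mapping.single i 1 + m"
  define k where "k = Min (Poly_Mapping.keys ?m)"
  have x: "pvar i * Poly_Mapping.single m 1 = Poly_Mapping.single ?m 1"
    by (simp add: pvar_def mult_single)
  have "k \<in> Poly_Mapping.keys ?m" unfolding k_def by (intro Min_in) (auto simp: keys_add_nat)
  then have k: "k = i \<or> k \<in> Poly_Mapping.keys m" by (auto simp: keys_add_nat)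
  show ?case
  proof (cases "k = i")
    case True
    then have "phi (pvar i * Poly_Mapping.single m 1) = g i * Poly_Mapping.single m 1"
      unfolding x by (intro phi_single) (auto simp: k_def)
    then show ?thesis using gidealD(6)[OF gideal_eig] by simp
  next
    case False
    obtain m' where m': "m = Poly_Mapping.single k 1 + m'" using k False exponent_split by metis
    then have kn: "k \<le> n" and m'e: "m' \<in> exponents n (e - 1)" "1 \<le> e"
      using monomial by (auto simp: exponents_def keys_add_nat)
    have "phi (pvar i * Poly_Mapping.single m 1) = g k * Poly_Mapping.single (Poly_Mapping.single i 1 + m') 1"
      unfolding x by (rule phi_single[OF k_def]) (subst m', rule add.left_commute)
    also have "Poly_Mapping.single (Poly_Mapping.single i 1 + m') 1 = pvar i * Poly_Mapping.single m' 1"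
      by (simp add: pvar_def mult_single)
    finally have "phi (pvar i * Poly_Mapping.single m 1) - g i * Poly_Mapping.single m 1
        = Poly_Mapping.single m' 1 * (pvar i * g k - pvar k * g i)"
      by (simp add: m' pvar_def mult_single algebra_simps)
    moreover have "Poly_Mapping.single m' 1 * (pvar i * g k - pvar k * g i) \<in> eig n D g (e - 1 + Suc D)"
      by (rule gidealD(3)[OF gideal_eig minor_in_eig[OF i kn] single_in_forms[OF m'e(1)]])
    ultimately show ?thesis using m'e(2) by (simp add: add.commute)
  qed
qed

text \<open>Applied to \<open>(x_i g_j - x_j g_i) q\<close>, the map gives
  \<open>g_i g_j q - g_j g_i q = 0\<close> modulo the minors.\<close>

lemma phi_eig:
  assumes "p \<in> eig n D g (Suc e)"
  shows "phi p \<in> eig n D g (D + e)"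
proof -
  let ?Y = "{p. phi p \<in> eig n D g (D + e)}"
  have "p \<in> ?Y" using _ _ assms
  proof (rule gen_least_subspace)
    show "mpoly_vs.subspace ?Y"
      using gidealD(6,7,9)[OF gideal_eig] by (simp add: mpoly_vs.subspace_def mpoly_linearD(1-3)[OF linear_phi])
    fix a f q assume "(a, f) \<in> set (minor_list n D g)" and q: "q \<in> shifted_forms n (Suc e) a"
    then obtain i j where ij: "a = Suc D" "i \<le> n" "j \<le> n" "f = pvar i * g j - pvar j * g i"
      by (auto simp: set_minor_list)
    show "f * q \<in> ?Y"
    proof (cases "D \<le> e")
      case False
      then show ?thesis using q ij(1) gidealD(6)[OF gideal_eig]
        by (simp add: shifted_forms_def mpoly_linearD(3)[OF linear_phi])
    next
      case True
      then have "q \<in> forms n (e - D)" using q ij(1) by (simp add: shifted_forms_def)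
      then have gq: "g i * q \<in> forms n e" "g j * q \<in> forms n e"
        using forms_mult[OF g] ij True by (metis le_add_diff_inverse)+
      have "phi (f * q) = phi (pvar i * (g j * q) - pvar j * (g i * q))"
        by (simp add: ij(4) algebra_simps)
      also have "\<dots> = (phi (pvar i * (g j * q)) - g i * (g j * q)) - (phi (pvar j * (g i * q)) - g j * (g i * q))"
        by (simp add: mpoly_linearD(4)[OF linear_phi] algebra_simps)
      also have "\<dots> \<in> eig n D g (D + e)"
        by (intro gidealD(8)[OF gideal_eig] phi_var gq ij)
      finally show ?thesis by simp
    qed
  qed
  then show ?thesis by simp
qed

text \<open>A multiple \<open>g_i q\<close> is the image of \<open>x_i q\<close> modulo the
  minors.\<close>

lemma entries_covered:
  assumes "w \<in> entries n D g (D + e)"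
  shows "\<exists>v\<in>forms n (Suc e). \<exists>w'\<in>eig n D g (D + e). w = phi v + w'"
proof -
  let ?Y = "{x + y | x y. x \<in> phi ` forms n (Suc e) \<and> y \<in> eig n D g (D + e)}"
  have "w \<in> ?Y" using _ _ assms
  proof (rule gen_least_subspace)
    interpret L: Vector_Spaces.linear "\<lambda>c p. const c * p" "\<lambda>c p. const c * p" phi by (rule linear_phi)
    show "mpoly_vs.subspace ?Y"
      by (rule mpoly_vs.subspace_sums[OF L.subspace_image[OF subspace_forms] gidealD(1)[OF gideal_eig]])
    fix a f q assume "(a, f) \<in> set (entry_list n D g)" and q: "q \<in> shifted_forms n (D + e) a"
    then obtain i where i: "a = D" "i \<le> n" "f = g i" by (auto simp: set_entry_list)
    then have q: "q \<in> forms n e" using q by (simp add: shifted_forms_def)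
    have "pvar i * q \<in> forms n (Suc e)" using forms_mult[OF pvar_in_forms[OF i(2)] q] by simp
    moreover have "0 - (phi (pvar i * q) - g i * q) \<in> eig n D g (D + e)"
      by (intro gidealD(8)[OF gideal_eig] gidealD(6)[OF gideal_eig] phi_var q i)
    moreover have "f * q = phi (pvar i * q) + (0 - (phi (pvar i * q) - g i * q))" by (simp add: i)
    ultimately show "f * q \<in> ?Y" by blast
  qed
  then show ?thesis by blast
qed

text \<open>With I the ideal of minors, S/I is composed of \<open>S / (g)\<close> and
  \<open>(g) / I\<close>, and \<open>phi\<close> maps degree e + 1 of S/I onto degree D + e of
  \<open>(g) / I\<close>.\<close>

lemma hf_eig_step: "hf n (eig n D g) (D + e) \<le> hf n (entries n D g) (D + e) + hf n (eig n D g) (Suc e)"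
proof -
  have "int (mpoly_vs.dim (entries n D g (D + e))) - int (mpoly_vs.dim (eig n D g (D + e)))
     \<le> int (mpoly_vs.dim (forms n (Suc e))) - int (mpoly_vs.dim (eig n D g (Suc e)))"
    by (rule codim_forms_image_covers[OF linear_phi, of _ _ n "Suc e" _ _ n "D + e"])
      (use gidealD(1,2)[OF gideal_eig] gidealD(2)[OF gideal_entries] eig_subset_entries entries_covered phi_eig in auto)
  then show ?thesis by (simp add: hf_def)
qed

lemma hf_eig_0: "hf n (eig n D g) 0 = 1"
proof -
  have "p = 0" if "p \<in> eig n D g 0" for p
    using gen_least_subspace[of "{0}" "minor_list n D g" n 0 p] that
    by (auto simp: set_minor_list shifted_forms_def mpoly_vs.subspace_single_0)
  then have "eig n D g 0 = {0}" using gidealD(6)[OF gideal_eig] by blast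
  then show ?thesis by (simp add: hf_def dim_forms_0 dim_zero)
qed

lemma hf_eig_le_entries_small:
  assumes "e < D"
  shows "hf n (eig n D g) e \<le> hf n (entries n D g) e"
proof -
  have "p = 0" if "p \<in> entries n D g e" for p
    using gen_least_subspace[of "{0}" "entry_list n D g" n e p] that assms
    by (auto simp: set_entry_list shifted_forms_def mpoly_vs.subspace_single_0)
  then have "entries n D g e \<subseteq> eig n D g e" using gidealD(6)[OF gideal_eig] by blast
  then show ?thesis by (rule hf_mono[OF gideal_entries gideal_eig])
qed

text \<open>Writing F and G for the Hilbert functions of S/I and \<open>S / (g)\<close>, the steps
  \<open>F(D + e) <= G(D + e) + F(e + 1)\<close> are added up; below degree D, F is bounded by G
  directly. \<open>bezout\<close> bounds the sum of G.\<close>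

lemma eig_bound_of_entries_full:
  assumes "1 \<le> D" and full: "eventually_full n (entries n D g)"
    and c: "\<And>e. e \<ge> N \<Longrightarrow> hf n (eig n D g) e = c"
  shows "(int D - 1) * c + 1 \<le> int D ^ Suc n"
proof -
  let ?F = "hf n (eig n D g)" and ?G = "hf n (entries n D g)"
  have "(\<Sum>j<D + E. ?F j) \<le> (\<Sum>j<D + E. ?G j) + (\<Sum>e<E. ?F (Suc e))" for E
  proof (induction E)
    case 0
    then show ?case using hf_eig_le_entries_small by (auto intro: sum_mono)
  next
    case (Suc E)
    then show ?case using hf_eig_step[of E] by simp
  qed
  from this[of N] have "(\<Sum>j<D + N. ?F j) \<le> (\<Sum>j<D + N. ?G j) + (\<Sum>e<N. ?F (Suc e))" .
  \<comment> \<open>After cancelling F(1), ..., F(N) there remain F(0) = 1 and the D - 1 values at N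
    + 1, ..., D + N - 1, each equal to \<open>c\<close>.\<close>
  moreover have "(\<Sum>j<D + N. ?F j) = ?F 0 + (\<Sum>e<N. ?F (Suc e)) + (\<Sum>j\<in>{Suc N..<D + N}. ?F j)"
  proof -
    have "{..<D + N} = {..<Suc N} \<union> {Suc N..<D + N}" using assms(1) by auto
    moreover have "sum ?F ({..<Suc N} \<union> {Suc N..<D + N}) = sum ?F {..<Suc N} + sum ?F {Suc N..<D + N}"
      by (rule sum.union_disjoint) auto
    ultimately show ?thesis by (simp only: sum.lessThan_Suc_shift)
  qed
  moreover have "(\<Sum>j\<in>{Suc N..<D + N}. ?F j) = (int D - 1) * c"
    using assms(1) c by (simp add: of_nat_diff)
  moreover have "(\<Sum>j<D + N. ?G j) \<le> int D ^ Suc n"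
  proof -
    have pos: "pos_form_list n (entry_list n D g)"
      using g assms(1) by (auto simp: pos_form_list_def set_entry_list)
    have "(\<Sum>j\<le>D + N - 1. ?G j) \<le> int D ^ Suc n"
      using full by (intro bezout[OF pos]) (auto simp: entry_list_def)
    moreover have "{..D + N - 1} = {..<D + N}" using assms(1) by auto
    ultimately show ?thesis by simp
  qed
  ultimately show ?thesis using hf_eig_0 by linarith
qed

end

section \<open>Linear forms, stable Hilbert functions and eigenvectors\<close>

lemma sum_fun_apply: "(\<Sum>x\<in>A. f x) y = (\<Sum>x\<in>A. f x y)"
  by (induction A rule: infinite_finite_induct) auto

lemma linear_form_coeffs:
  assumes "u \<in> forms n 1"
  shows "\<exists>c. u = (\<Sum>j\<le>n. const (c j) * pvar j)"
proof -
  have "u \<in> forms n (Suc 0)" using assms by simp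
  then obtain q where q: "\<And>j. j \<le> n \<Longrightarrow> q j \<in> forms n 0" "u = (\<Sum>j\<le>n. pvar j * q j)"
    using forms_Suc_decompose by metis
  have "u = (\<Sum>j\<le>n. const (Poly_Mapping.lookup (q j) 0) * pvar j)"
    unfolding q(2) using forms_0[OF q(1)] by (intro sum.cong) (auto simp: mult.commute)
  then show ?thesis by (rule exI[of "\<lambda>c. u = (\<Sum>j\<le>n. const (c j) * pvar j)"])
qed

lemma gideal_vanishing: "gideal n (\<lambda>e. {p \<in> forms n e. \<forall>v\<in>Z. poly_eval v p = 0})"
  unfolding gideal_def
  by (auto simp: mpoly_vs.subspace_def poly_eval_simps forms_zero forms_add forms_scale intro: forms_mult)

text \<open>The ideal contains that of a single point, so every form is a multiple of a power of x_i
  modulo \<open>J\<close>.\<close>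

lemma hf_le_1:
  assumes J: "gideal n J" and i: "i \<le> n" and v: "\<And>j. j \<le> n \<Longrightarrow> pvar j - const (v j) * pvar i \<in> J 1"
  shows "hf n J e \<le> 1"
proof -
  have "int (mpoly_vs.dim (forms n e)) - int (mpoly_vs.dim (J e))
      \<le> int (mpoly_vs.dim (forms n 0)) - int (mpoly_vs.dim {0::mpoly})"
  proof (rule codim_forms_image_covers[of "\<lambda>q. pvar i ^ e * q" _ _ n 0 _ _ n e])
    show "\<exists>x\<in>forms n 0. \<exists>w'\<in>J e. w = pvar i ^ e * x + w'" if w: "w \<in> forms n e" for w
      by (intro bexI[of _ "const (poly_eval v w)"] bexI[of _ "w - const (poly_eval v w) * pvar i ^ e"]
          eval_congruence[OF J i v w] const_in_forms) (simp add: mult.commute)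
  qed (use linear_mult gidealD(1,2,6)[OF J] in \<open>auto simp: forms_zero mpoly_vs.subspace_single_0\<close>)
  then show ?thesis by (simp add: hf_def dim_forms_0 dim_zero)
qed

lemma eventually_const_of_decreasing:
  fixes f :: "nat \<Rightarrow> int"
  assumes "\<And>e. 0 \<le> f e" "\<And>e. e \<ge> N \<Longrightarrow> f (Suc e) \<le> f e"
  shows "\<exists>M c. \<forall>e\<ge>M. f e = c"
proof -
  define A where "A = (\<lambda>e. nat (f e)) ` {N..}"
  define a where "a = (LEAST a. a \<in> A)"
  have "a \<in> A" unfolding a_def by (rule LeastI[of _ "nat (f N)"]) (auto simp: A_def)
  then obtain M where M: "M \<ge> N" "nat (f M) = a" by (auto simp: A_def)
  have "f e \<le> f M" if "e \<ge> M" for e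
    using that
  proof (induction e rule: dec_induct)
    case (step e)
    then show ?case using assms(2)[of e] M(1) by simp
  qed simp
  moreover have "f M \<le> f e" if "e \<ge> M" for e
  proof -
    have "nat (f e) \<in> A" using that M(1) by (auto simp: A_def)
    then have "a \<le> nat (f e)" unfolding a_def by (rule Least_le)
    then show ?thesis using M(2) assms(1)[of M] assms(1)[of e] by simp
  qed
  ultimately show ?thesis by (meson order_antisym)
qed

text \<open>Multiplication by a linear parameter is onto in large degrees, so the Hilbert function
  is eventually nonincreasing; being nonnegative, it stabilises.\<close>

lemma hf_eventually_const:
  assumes J: "gideal n J" and l: "l \<in> forms n 1" and full: "eventually_full n (gsum n J 1 l)"
  shows "\<exists>M c. \<forall>e\<ge>M. hf n J e = c"
proof -
  obtain N where N: "\<And>e. e \<ge> N \<Longrightarrow> forms n e \<subseteq> gsum n J 1 l e" using full by (auto simp: eventually_full_def)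
  have "hf n J (Suc e) \<le> hf n J e" if "e \<ge> N" for e
    using hf_le_gsum[OF J l, of "Suc e"] hf_eventually_full[OF gideal_gsum[OF J l] N, of "Suc e"] that by simp
  then show ?thesis by (intro eventually_const_of_decreasing[of _ N] hf_nonneg[OF J])
qed

text \<open>Argues with a polynomial annihilating the vector \<open>x\<close> instead of a
  determinant. Splitting off a root mu as \<open>p = (X - mu) q\<close>, either q already
  annihilates the vector, or q(T) applied to it is an eigenvector for mu.\<close>

lemma eigenvector_exists:
  fixes T :: "(nat \<Rightarrow> complex) \<Rightarrow> nat \<Rightarrow> complex"
  assumes T: "Vector_Spaces.linear (\<lambda>c v i. c * v i) (\<lambda>c v i. c * v i) T"
    and V: "cvec.subspace V" "\<And>v. v \<in> V \<Longrightarrow> T v \<in> V" "finite B" "V \<subseteq> cvec.span B"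
    and x: "x \<in> V" "x \<noteq> 0"
  shows "\<exists>w\<in>V. w \<noteq> 0 \<and> (\<exists>\<mu>. T w = (\<lambda>i. \<mu> * w i))"
proof -
  interpret T: Vector_Spaces.linear "\<lambda>c v i. c * v i" "\<lambda>c v i. c * v i" T by fact
  \<comment> \<open>This is p(T) applied to y.\<close>
  define ev where "ev p y = (\<lambda>j. \<Sum>i\<le>degree p. coeff p i * (T ^^ i) y j)" for p :: "complex poly" and y
  have ev_upto: "ev p y = (\<lambda>j. \<Sum>i\<le>N. coeff p i * (T ^^ i) y j)" if "degree p \<le> N" for p y N
    unfolding ev_def using that by (intro ext sum.mono_neutral_left) (auto simp: coeff_eq_0)
  have iter: "(T ^^ i) y \<in> V" if "y \<in> V" for i y using that by (induction i) (auto intro: V(2))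
  have evV: "ev p y \<in> V" if "y \<in> V" for p y
  proof -
    have "(\<Sum>i\<le>degree p. (\<lambda>j. coeff p i * (T ^^ i) y j)) \<in> V"
      by (intro cvec.subspace_sum V(1) cvec.subspace_scale iter that)
    also have "(\<Sum>i\<le>degree p. (\<lambda>j. coeff p i * (T ^^ i) y j)) = ev p y"
      by (simp add: fun_eq_iff ev_def sum_fun_apply)
    finally show ?thesis .
  qed
  have descend: "\<exists>w\<in>V. w \<noteq> 0 \<and> (\<exists>\<mu>. T w = (\<lambda>i. \<mu> * w i))"
    if "p \<noteq> 0" "ev p y = 0" "y \<in> V" "y \<noteq> 0" for p y
    using that(1,2)
  proof (induction "degree p" arbitrary: p)
    case 0
    then obtain c where c: "p = [:c:]" "c \<noteq> 0" by (metis degree_eq_zeroE pCons_0_0)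
    then have "y = 0" using 0(3) by (simp add: ev_def fun_eq_iff)
    then show ?case using that by simp
  next
    case (Suc d)
    then have "\<not> constant (poly p)" by (simp add: constant_degree)
    then obtain \<mu> where "poly p \<mu> = 0" using fundamental_theorem_of_algebra by blast
    then obtain q where q: "p = [:-\<mu>, 1:] * q" by (auto simp: poly_eq_0_iff_dvd)
    then have q0: "q \<noteq> 0" using Suc.prems by auto
    have deg: "degree p = Suc (degree q)" unfolding q using q0 by (subst degree_mult_eq) auto
    show ?case
    proof (cases "ev q y = 0")
      case True
      then show ?thesis using Suc.hyps(1)[of q] Suc.hyps(2) deg q0 by simp
    next
      case False
      have "ev p y j = T (ev q y) j - \<mu> * ev q y j" for j
      proof -
        have "ev p y j = (\<Sum>i\<le>Suc (degree q). coeff p i * (T ^^ i) y j)"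
          using ev_upto[of p "Suc (degree q)" y] deg by simp
        also have "\<dots> = (\<Sum>i\<le>Suc (degree q). coeff (pCons 0 q) i * (T ^^ i) y j)
            - \<mu> * (\<Sum>i\<le>Suc (degree q). coeff q i * (T ^^ i) y j)"
          unfolding q sum_distrib_left sum_subtractf[symmetric] by (intro sum.cong) (simp_all add: algebra_simps)
        also have "(\<Sum>i\<le>Suc (degree q). coeff q i * (T ^^ i) y j) = ev q y j"
          using ev_upto[of q "Suc (degree q)" y] by simp
        also have "(\<Sum>i\<le>Suc (degree q). coeff (pCons 0 q) i * (T ^^ i) y j)
            = (\<Sum>i\<le>degree q. coeff q i * T ((T ^^ i) y) j)"
          by (subst sum.atMost_Suc_shift) simp
        also have "\<dots> = T (ev q y) j"
        proof -
          have "ev q y = (\<Sum>i\<le>degree q. (\<lambda>j. coeff q i * (T ^^ i) y j))"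
            by (simp add: fun_eq_iff ev_def sum_fun_apply)
          then have "T (ev q y) = (\<Sum>i\<le>degree q. (\<lambda>j. coeff q i * T ((T ^^ i) y) j))"
            by (simp add: T.sum T.scale)
          then show ?thesis by (simp add: sum_fun_apply)
        qed
        finally show ?thesis .
      qed
      then have "T (ev q y) = (\<lambda>j. \<mu> * ev q y j)"
        using Suc.prems(2) by (simp add: fun_eq_iff)
      then show ?thesis using False evV that by blast
    qed
  qed
  \<comment> \<open>The N + 1 vectors x, T x, ..., T^N x lie in a space spanned by N vectors. Either
    two of them coincide or they are linearly dependent; both cases yield an annihilating
    polynomial.\<close>
  define N where "N = card B"
  have "\<exists>p. p \<noteq> 0 \<and> ev p x = 0"
  proof (cases "inj_on (\<lambda>i. (T ^^ i) x) {..N}")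
    case False
    then obtain i j where ij: "i \<noteq> j" "(T ^^ i) x = (T ^^ j) x" by (auto simp: inj_on_def)
    let ?p = "Polynomial.monom 1 i - Polynomial.monom 1 j :: complex poly"
    have "coeff ?p i = 1" using ij by simp
    then have "?p \<noteq> 0" by (metis coeff_0 zero_neq_one)
    moreover have "ev ?p x = 0"
    proof -
      have "degree ?p \<le> max i j" by (rule degree_diff_le) (auto intro: order.trans[OF degree_monom_le])
      then have "ev ?p x = (\<lambda>k. \<Sum>l\<le>max i j. coeff ?p l * (T ^^ l) x k)" by (rule ev_upto)
      also have "\<dots> = (\<lambda>k. (T ^^ i) x k - (T ^^ j) x k)"
        by (simp add: left_diff_distrib sum_subtractf if_distrib[of "\<lambda>c. c * _"] cong: if_cong)
      finally show ?thesis using ij by (simp add: fun_eq_iff)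
    qed
    ultimately show ?thesis by blast
  next
    case True
    let ?S = "(\<lambda>i. (T ^^ i) x) ` {..N}"
    have "card ?S = Suc N" using True by (simp add: card_image)
    moreover have "?S \<subseteq> cvec.span B" using iter[OF x(1)] V(4) by blast
    ultimately have "cvec.dependent ?S"
      using cvec.independent_span_bound[OF V(3), of ?S] by (auto simp: N_def)
    then obtain u where u: "\<exists>v\<in>?S. u v \<noteq> 0" "(\<Sum>v\<in>?S. (\<lambda>i. u v * v i)) = 0"
      using cvec.dependent_finite[of ?S] by auto
    define p where "p = (\<Sum>i\<le>N. Polynomial.monom (u ((T ^^ i) x)) i)"
    have coeff: "coeff p i = (if i \<le> N then u ((T ^^ i) x) else 0)" for i
      by (simp add: p_def coeff_sum)
    have "p \<noteq> 0" using u(1) coeff by (metis (no_types, lifting) atMost_iff coeff_0 imageE)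
    moreover have "degree p \<le> N" by (rule degree_le) (simp add: coeff)
    then have "ev p x = (\<Sum>i\<le>N. (\<lambda>j. u ((T ^^ i) x) * (T ^^ i) x j))"
      using ev_upto[of p N x] by (simp add: coeff fun_eq_iff sum_fun_apply)
    then have "ev p x = 0" using u(2) by (simp add: sum.reindex[OF True])
    ultimately show ?thesis by blast
  qed
  then show ?thesis using descend x by blast
qed

lemma coord_space_span: "coord_space n \<subseteq> cvec.span ((\<lambda>i j. if j = i then 1 else 0) ` {..n})"
proof
  fix x assume "x \<in> coord_space n"
  then have "x = (\<Sum>i\<le>n. (\<lambda>j. x i * (if j = i then 1 else 0)))"
    by (auto simp: fun_eq_iff sum_fun_apply coord_space_def if_distrib[of "\<lambda>c. _ * c"] cong: if_cong)
  also have "\<dots> \<in> cvec.span ((\<lambda>i j. if j = i then 1 else 0) ` {..n})"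
    by (intro cvec.span_sum cvec.span_scale cvec.span_base) auto
  finally show "x \<in> cvec.span ((\<lambda>i j. if j = i then 1 else 0) ` {..n})" .
qed

text \<open>Linear forms are dual to \<open>coord_space n\<close>: a functional that kills
  \<open>W\<close> but not some variable is evaluation at the point whose coordinates are its values
  on the variables.\<close>

lemma linear_functional_of_forms:
  assumes W: "mpoly_vs.subspace W" "W \<subseteq> forms n 1" "W \<noteq> forms n 1"
  shows "\<exists>v\<in>coord_space n. v \<noteq> 0 \<and> (\<forall>u\<in>W. poly_eval v u = 0)"
proof -
  interpret P: vector_space_pair "\<lambda>c p. const c * p" "\<lambda>a b. a * b :: complex"
    by (intro vector_space_pair.intro mpoly_vs.vector_space_axioms) (unfold_locales, auto simp: algebra_simps)
  have "\<exists>i\<le>n. pvar i \<notin> W"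
  proof (rule ccontr)
    assume "\<not> ?thesis"
    then have "(\<Sum>j\<le>n. const (c j) * pvar j) \<in> W" for c
      by (intro mpoly_vs.subspace_sum[OF W(1)] mpoly_vs.subspace_scale[OF W(1)]) auto
    then have "forms n 1 \<subseteq> W" using linear_form_coeffs by blast
    then show False using W by auto
  qed
  then obtain i where i: "i \<le> n" "pvar i \<notin> W" by blast
  obtain B where B: "B \<subseteq> W" "mpoly_vs.independent B" "W \<subseteq> mpoly_vs.span B"
    using mpoly_vs.basis_exists[of W] by metis
  then have spanB: "mpoly_vs.span B = W" using W(1) by (simp add: mpoly_vs.span_subspace)
  have "mpoly_vs.independent (insert (pvar i) B)" using B(2) i(2) spanB by (simp add: mpoly_vs.independent_insertI)
  then obtain f where f: "Vector_Spaces.linear (\<lambda>c p. const c * p) (\<lambda>a b. a * b :: complex) f"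
    "\<And>y. y \<in> insert (pvar i) B \<Longrightarrow> f y = (if y = pvar i then 1 else 0)"
    using P.linear_independent_extend[of "insert (pvar i) B" "\<lambda>y. if y = pvar i then 1 else 0"] by blast
  interpret f: Vector_Spaces.linear "\<lambda>c p. const c * p" "\<lambda>a b. a * b :: complex" f by fact
  have "f y = 0" if "y \<in> B" for y using f(2)[of y] that B(1) i(2) by auto
  then have fW: "f u = 0" if "u \<in> W" for u
    using f.eq_0_on_span[of B u] spanB that by blast
  define v where "v j = (if j \<le> n then f (pvar j) else 0)" for j
  have "poly_eval v u = f u" if "u \<in> forms n 1" for u
  proof -
    obtain c where "u = (\<Sum>j\<le>n. const (c j) * pvar j)" using linear_form_coeffs[OF \<open>u \<in> forms n 1\<close>] by blast
    then show ?thesis by (simp add: poly_eval_simps f.sum f.scale v_def)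
  qed
  then have "\<forall>u\<in>W. poly_eval v u = 0" using fW W(2) by auto
  moreover have "v i = 1" using f(2)[of "pvar i"] i by (simp add: v_def)
  then have "v \<noteq> 0" by auto
  moreover have "v \<in> coord_space n" by (simp add: coord_space_def v_def)
  ultimately show ?thesis by blast
qed

section \<open>The exceptional degrees D = 1 and D = 0, and the general bound\<close>

context eigen_tensor
begin

lemma phi_pvar: "phi (pvar j) = g j"
  using phi_single[of j j 0 0] by (simp add: pvar_def)

lemma phi_linear_form:
  assumes "D = 1" "u \<in> forms n 1"
  shows "phi u \<in> forms n 1"
proof -
  obtain c where c: "u = (\<Sum>j\<le>n. const (c j) * pvar j)" using linear_form_coeffs[OF assms(2)] by blast
  have "phi u = (\<Sum>j\<le>n. const (c j) * g j)"
    unfolding c mpoly_linearD(5)[OF linear_phi] mpoly_linearD(2)[OF linear_phi] by (simp add: phi_pvar)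
  then show ?thesis using g assms(1) by (auto intro!: forms_sum forms_scale)
qed

text \<open>Both terms are congruent to \<open>phi (u * q)\<close>, since modulo the minors either
  linear factor of the product may be the one replaced.\<close>

lemma phi_self_adjoint:
  assumes "D = 1" "u \<in> forms n 1" "q \<in> forms n 1"
  shows "phi u * q - u * phi q \<in> eig n D g 2"
proof -
  have *: "phi (u * q) - phi u * q \<in> eig n D g 2" if u: "u \<in> forms n 1" "q \<in> forms n 1" for u q
  proof -
    obtain c where c: "u = (\<Sum>j\<le>n. const (c j) * pvar j)" using linear_form_coeffs[OF u(1)] by blast
    have "const (c j) * (phi (pvar j * q) - g j * q) \<in> eig n D g 2" if j: "j \<le> n" for j
      using gidealD(9)[OF gideal_eig phi_var[OF u(2) j]] assms(1) by (simp add: numeral_2_eq_2)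
    then have "(\<Sum>j\<le>n. const (c j) * (phi (pvar j * q) - g j * q)) \<in> eig n D g 2"
      by (intro gidealD(10)[OF gideal_eig]) auto
    also have "(\<Sum>j\<le>n. const (c j) * (phi (pvar j * q) - g j * q)) = phi (u * q) - phi u * q"
      by (simp add: c right_diff_distrib sum_subtractf mpoly_linearD(2,5)[OF linear_phi] phi_pvar
          sum_distrib_right mult.assoc)
    finally show ?thesis .
  qed
  have "(phi (q * u) - phi q * u) - (phi (u * q) - phi u * q) \<in> eig n D g 2"
    by (rule gidealD(8)[OF gideal_eig *[OF assms(3,2)] *[OF assms(2,3)]])
  then show ?thesis by (simp add: algebra_simps)
qed

text \<open>
  The linear forms whose multiples by linear forms all lie in the ideal of the minors and \<open>l\<close>
  are stable under \<open>phi\<close>. If there were others, these would have a common zero that is an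
  eigenvector, although \<open>l\<close> vanishes at no eigenvector.
\<close>

lemma hf_eig_matrix:
  assumes D: "D = 1" and l: "l \<in> forms n 1" and full: "eventually_full n (gsum n (eig n D g) 1 l)" and "1 \<le> e"
  shows "hf n (eig n D g) e \<le> int n + 1"
proof -
  let ?K = "gsum n (eig n D g) 1 l"
  note K = gideal_gsum[OF gideal_eig l]
  define W where "W = {u \<in> forms n 1. \<forall>q\<in>forms n 1. u * q \<in> ?K 2}"
  have subW: "mpoly_vs.subspace W"
    using gidealD(6,7,9)[OF K] by (auto simp: W_def mpoly_vs.subspace_def forms_zero forms_add forms_scale distrib_right mult.assoc)
  have lW: "l \<in> W"
    using l gsum_gen[OF gideal_eig, of _ 1 l 1] by (auto simp: W_def numeral_2_eq_2)
  have phiW: "phi u \<in> W" if "u \<in> W" for u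
  proof -
    have u: "u \<in> forms n 1" using that by (simp add: W_def)
    have "phi u * q \<in> ?K 2" if q: "q \<in> forms n 1" for q
    proof -
      have "phi u * q - u * phi q \<in> ?K 2" using phi_self_adjoint[OF D u q] by (rule gsum_upper)
      moreover have "u * phi q \<in> ?K 2" using \<open>u \<in> W\<close> phi_linear_form[OF D q] by (simp add: W_def)
      ultimately show ?thesis using gidealD(7)[OF K] by fastforce
    qed
    then show ?thesis using phi_linear_form[OF D u] by (simp add: W_def)
  qed
  have "W = forms n 1"
  proof (rule ccontr)
    assume "W \<noteq> forms n 1"
    then obtain v where v: "v \<in> coord_space n" "v \<noteq> 0" "\<forall>u\<in>W. poly_eval v u = 0"
      using linear_functional_of_forms[OF subW] by (metis (no_types, lifting) W_def mem_Collect_eq subsetI)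
    define T where "T x = (\<lambda>i. if i \<le> n then poly_eval x (g i) else 0)" for x :: "nat \<Rightarrow> complex"
    define V where "V = {x \<in> coord_space n. \<forall>u\<in>W. poly_eval x u = 0}"
    have lin: "poly_eval (x + y) u = poly_eval x u + poly_eval y u"
      "poly_eval (\<lambda>i. c * x i) u = c * poly_eval x u" if "u \<in> forms n 1" for x y u c
    proof -
      obtain a where a: "u = (\<Sum>j\<le>n. const (a j) * pvar j)" using linear_form_coeffs[OF \<open>u \<in> forms n 1\<close>] by blast
      show "poly_eval (x + y) u = poly_eval x u + poly_eval y u"
        "poly_eval (\<lambda>i. c * x i) u = c * poly_eval x u"
        by (simp_all add: a poly_eval_simps distrib_left sum.distrib sum_distrib_left mult.left_commute)
    qed
    have "Vector_Spaces.linear (\<lambda>c v i. c * v i) (\<lambda>c v i. c * v i) T"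
      using g D lin by (auto simp: Vector_Spaces.linear_iff cvec.vector_space_axioms T_def fun_eq_iff)
    moreover have "cvec.subspace V"
    proof -
      have "poly_eval 0 u = 0" if "u \<in> W" for u
        using lin(2)[of u 0 0] that by (simp add: W_def zero_fun_def)
      then show ?thesis
        using lin by (auto simp: cvec.subspace_def V_def coord_space_def W_def)
    qed
    \<comment> \<open>On linear forms \<open>phi\<close> is the transpose of \<open>T\<close>, so
      stability of \<open>W\<close> under \<open>phi\<close> becomes stability of its zero space
      under \<open>T\<close>.\<close>
    moreover have "T x \<in> V" if "x \<in> V" for x
    proof -
      have "poly_eval (T x) u = 0" if u: "u \<in> W" for u
      proof -
        obtain a where a: "u = (\<Sum>j\<le>n. const (a j) * pvar j)" using linear_form_coeffs[of u n] u by (auto simp: W_def)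
        have "poly_eval x (phi u) = poly_eval (T x) u"
          unfolding a mpoly_linearD(5)[OF linear_phi] mpoly_linearD(2)[OF linear_phi]
          by (simp add: phi_pvar poly_eval_simps T_def)
        then show ?thesis using phiW[OF u] \<open>x \<in> V\<close> by (simp add: V_def)
      qed
      then show ?thesis by (auto simp: V_def coord_space_def T_def)
    qed
    moreover have "V \<subseteq> cvec.span ((\<lambda>i j. if j = i then 1 else 0) ` {..n})"
      using coord_space_span by (auto simp: V_def)
    moreover have "v \<in> V" using v by (simp add: V_def)
    ultimately obtain w \<mu> where w: "w \<in> V" "w \<noteq> 0" "T w = (\<lambda>i. \<mu> * w i)"
      using eigenvector_exists[of T V "(\<lambda>i j. if j = i then 1 else 0) ` {..n}" v] v(2) by blast
    \<comment> \<open>The forms vanishing at the eigenvector \<open>w\<close> include the minors and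
      \<open>l\<close>, hence all of \<open>?K\<close>. But \<open>?K\<close> contains powers of
      every variable, and some coordinate of \<open>w\<close> is nonzero.\<close>
    let ?Y = "\<lambda>e. {p \<in> forms n e. \<forall>v\<in>{w}. poly_eval v p = 0}"
    have ge: "poly_eval w (g i) = \<mu> * w i" if "i \<le> n" for i
      using fun_cong[OF w(3), of i] that by (simp add: T_def)
    have "eig n D g e \<subseteq> ?Y e" for e
    proof
      fix p assume "p \<in> eig n D g e"
      then show "p \<in> ?Y e"
      proof (rule gen_least[OF gideal_vanishing, rotated])
        show "f \<in> ?Y a" if "(a, f) \<in> set (minor_list n D g)" for a f
          using that ge minor_in_forms[of n g D, OF g] by (auto simp: set_minor_list poly_eval_simps)
      qed
    qed
    moreover have "l \<in> ?Y 1" using l lW w(1) by (simp add: V_def)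
    ultimately have KY: "p \<in> ?Y e" if "p \<in> ?K e" for p e
      using gsum_least[OF gideal_vanishing _ _ that, of "{w}"] by blast
    obtain i where i: "w i \<noteq> 0" using w(2) by (auto simp: fun_eq_iff)
    then have "i \<le> n" using w(1) by (auto simp: V_def coord_space_def simp flip: not_less)
    obtain N where "forms n N \<subseteq> ?K N" using full by (auto simp: eventually_full_def)
    then have "pvar i ^ N \<in> ?Y N" using forms_power[OF pvar_in_forms[OF \<open>i \<le> n\<close>], of N] KY by auto
    then show False using i by (simp add: poly_eval_simps)
  qed
  \<comment> \<open>Degree 2 is already full because every linear form is in \<open>W\<close>. Hence
    the Hilbert function of the minors does not increase from degree 1 on, where it is at most n +
    1.\<close>
  have fullK: "forms n e \<subseteq> ?K e" if "2 \<le> e" for e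
    using that
  proof (induction e rule: dec_induct)
    case base
    show ?case
    proof
      fix p assume "p \<in> forms n 2"
      then obtain q where q: "\<And>j. j \<le> n \<Longrightarrow> q j \<in> forms n 1" "p = (\<Sum>j\<le>n. pvar j * q j)"
        using forms_Suc_decompose[of p n 1] by (auto simp: numeral_2_eq_2)
      have "pvar j * q j \<in> ?K 2" if "j \<le> n" for j
        using q(1)[OF that] pvar_in_forms[OF that] \<open>W = forms n 1\<close> by (auto simp: W_def)
      then show "p \<in> ?K 2" unfolding q(2) by (intro gidealD(10)[OF K]) auto
    qed
  next
    case (step e)
    show ?case
    proof
      fix p assume "p \<in> forms n (Suc e)"
      then obtain q where q: "\<And>j. j \<le> n \<Longrightarrow> q j \<in> forms n e" "p = (\<Sum>j\<le>n. pvar j * q j)"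
        using forms_Suc_decompose[of p n e] by metis
      have "pvar j * q j \<in> ?K (1 + e)" if "j \<le> n" for j
        using gidealD(3)[OF K _ pvar_in_forms[OF that]] q(1)[OF that] step.IH by blast
      then show "p \<in> ?K (Suc e)" unfolding q(2) by (intro gidealD(10)[OF K]) auto
    qed
  qed
  show ?thesis using \<open>1 \<le> e\<close>
  proof (induction e rule: dec_induct)
    case base
    have "forms n 1 \<subseteq> mpoly_vs.span (pvar ` {..n})"
    proof
      fix u assume "u \<in> forms n 1"
      then obtain c where "u = (\<Sum>j\<le>n. const (c j) * pvar j)" using linear_form_coeffs by blast
      moreover have "(\<Sum>j\<le>n. const (c j) * pvar j) \<in> mpoly_vs.span (pvar ` {..n})"
        by (intro mpoly_vs.span_sum mpoly_vs.span_scale mpoly_vs.span_base) auto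
      ultimately show "u \<in> mpoly_vs.span (pvar ` {..n})" by simp
    qed
    then have "mpoly_vs.dim (forms n 1) \<le> card (pvar ` {..n})" by (intro mpoly_vs.dim_le_card) auto
    also have "\<dots> \<le> n + 1" using card_image_le[of "{..n}" pvar] by simp
    finally show ?case by (simp add: hf_def)
  next
    case (step e)
    then have "hf n (eig n D g) (Suc e) \<le> hf n ?K (Suc e) + hf n (eig n D g) e"
      using hf_le_gsum[OF gideal_eig l, of "Suc e"] by simp
    also have "hf n ?K (Suc e) = 0" using step by (intro hf_eventually_full[OF K fullK]) auto
    finally show ?case using step by simp
  qed
qed

text \<open>If the constants g_i are not all zero, the minors cut out the single point that they
  represent. If they all vanish, the ideal is zero, and a binary relation can only be demanded when
  n = 0.\<close>

lemma hf_eig_constant_tensor: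
  assumes D: "D = 0" and rel: "\<And>i j. i \<le> n \<Longrightarrow> j \<le> n \<Longrightarrow> i \<noteq> j \<Longrightarrow> brel n (eig n D g) i j"
  shows "hf n (eig n D g) e \<le> 1"
proof (cases "\<exists>i\<le>n. g i \<noteq> 0")
  case True
  define c where "c j = Poly_Mapping.lookup (g j) 0" for j
  have gc: "g j = const (c j)" if "j \<le> n" for j using forms_0[of "g j" n] g[OF that] D by (simp add: c_def)
  obtain i where i: "i \<le> n" "g i \<noteq> 0" using True by blast
  then have ci: "c i \<noteq> 0" using gc by auto
  show ?thesis
  proof (rule hf_le_1[OF gideal_eig i(1)])
    fix j assume j: "j \<le> n"
    have "const (inverse (c i)) * (pvar j * g i - pvar i * g j) \<in> eig n D g 1"
      using gidealD(9)[OF gideal_eig minor_in_eig[OF j i(1)]] D by simp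
    also have "const (inverse (c i)) * (pvar j * g i - pvar i * g j)
        = const (inverse (c i) * c i) * pvar j - const (inverse (c i) * c j) * pvar i"
      using gc i(1) j by (simp only: const_mult algebra_simps)
    finally show "pvar j - const (inverse (c i) * c j) * pvar i \<in> eig n D g 1" using ci by simp
  qed
next
  case False
  have trivial: "eig n D g e \<subseteq> {0}" for e
  proof
    fix p assume "p \<in> eig n D g e"
    show "p \<in> {0}"
    proof (rule gen_least_subspace[OF mpoly_vs.subspace_single_0 _ \<open>p \<in> eig n D g e\<close>])
      fix a f q assume "(a, f) \<in> set (minor_list n D g)"
      then have "f = 0" using False by (auto simp: set_minor_list)
      then show "f * q \<in> {0}" by simp
    qed
  qed
  have "n = 0"
  proof (rule ccontr)
    assume "n \<noteq> 0"
    then obtain e r where r: "r \<noteq> 0" "degree r \<le> e" "homog 0 1 e r \<in> eig n D g e"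
      using rel[of 0 1] by (auto simp: brel_def)
    then have "homog 0 1 e r = 0" using trivial by blast
    then have "poly r t = 0" for t
      using homog_eval_poly[OF r(2), of "\<lambda>i. if i = 0 then 1 else t" 0 1] by (simp add: poly_eval_simps)
    then show False using r(1) poly_all_0_iff_0 by blast
  qed
  show ?thesis
    by (rule hf_le_1[OF gideal_eig, of 0 "\<lambda>_. 1"]) (use \<open>n = 0\<close> gidealD(6)[OF gideal_eig] in auto)
qed

text \<open>The linear parameter is returned along with the bound because \<open>K_full\<close>
  carries it over to the intersection with \<open>L\<close>, where it shows that the degree is an
  eventual value of the Hilbert function.\<close>

theorem eig_degree_bound:
  assumes rel: "\<And>i j. i \<le> n \<Longrightarrow> j \<le> n \<Longrightarrow> i \<noteq> j \<Longrightarrow> brel n (eig n D g) i j"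
  shows "\<exists>l\<in>forms n 1. eventually_full n (gsum n (eig n D g) 1 l) \<and>
    (\<exists>N. \<forall>e\<ge>N. real_of_int (hf n (eig n D g) e) \<le>
       (if D = 1 then real (n + 1) else (real D ^ (n + 1) - 1) / (real D - 1)))"
proof -
  obtain X where X: "finite X" "\<forall>v\<in>X. \<exists>i\<le>n. v i \<noteq> 0"
    "\<forall>J. gideal n J \<longrightarrow> (\<forall>e. eig n D g e \<subseteq> J e) \<longrightarrow> \<not> eventually_full n J \<longrightarrow>
      (\<exists>v\<in>X. \<forall>e. \<forall>p\<in>J e. poly_eval v p = 0)"
    using finite_zero_directions[OF gideal_eig rel] by blast
  obtain l where l: "l \<in> forms n 1" "\<And>v. v \<in> X \<Longrightarrow> poly_eval v l \<noteq> 0"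
    using generic_linear_form[of X n] X(1,2) by metis
  have full: "eventually_full n (gsum n (eig n D g) 1 l)"
  proof (rule ccontr)
    assume "\<not> ?thesis"
    moreover have "\<forall>e. eig n D g e \<subseteq> gsum n (eig n D g) 1 l e" using gsum_upper by blast
    ultimately obtain v where "v \<in> X" "\<forall>e. \<forall>p\<in>gsum n (eig n D g) 1 l e. poly_eval v p = 0"
      using X(3) gideal_gsum[OF gideal_eig l(1)] by blast
    then show False using gsum_gen1[OF gideal_eig, of l 1] l(2) by blast
  qed
  obtain M c where c: "\<And>e. e \<ge> M \<Longrightarrow> hf n (eig n D g) e = c"
    using hf_eventually_const[OF gideal_eig l(1) full] by blast
  have "real_of_int c \<le> (if D = 1 then real (n + 1) else (real D ^ (n + 1) - 1) / (real D - 1))"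
  proof -
    consider "D = 0" | "D = 1" | "2 \<le> D" by linarith
    then show ?thesis
    proof cases
      case 1
      then have "c \<le> 1" using hf_eig_constant_tensor[OF _ rel, of M] c[of M] by simp
      then show ?thesis using 1 by simp
    next
      case 2
      then have "c \<le> int n + 1" using hf_eig_matrix[OF _ l(1) full, of "Suc M"] c[of "Suc M"] by simp
      then have "real_of_int c \<le> real_of_int (int n + 1)" by (simp only: of_int_le_iff)
      then show ?thesis using 2 by simp
    next
      case 3
      \<comment> \<open>For v_i nonzero this is the only scalar t at which
        \<open>g_i - t l^(D-1) x_i\<close> vanishes at \<open>v\<close>. Where v_i = 0 the quotient
        is 0, and excluding that value as well is harmless.\<close>
      define \<gamma> where "\<gamma> v i = poly_eval v (g i) / (poly_eval v l ^ (D - 1) * v i)" for v i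
      have "finite (\<Union>v\<in>X. \<gamma> v ` {..n})" using X(1) by blast
      then obtain t where t: "t \<notin> (\<Union>v\<in>X. \<gamma> v ` {..n})"
        using ex_new_if_finite[OF infinite_UNIV_char_0] by blast
      define g' where "g' i = g i - const t * (l ^ (D - 1) * pvar i)" for i
      have g'_forms: "g' i \<in> forms n D" if "i \<le> n" for i
        using forms_mult[OF forms_power[OF l(1), of "D - 1"] pvar_in_forms[OF that]] 3 g[OF that]
        unfolding g'_def by (intro forms_diff forms_scale) auto
      interpret g': eigen_tensor n D g' by unfold_locales (rule g'_forms)
      have "minor_list n D g' = minor_list n D g"
        by (simp add: minor_list_def g'_def algebra_simps cong: map_cong)
      then have same: "eig n D g' = eig n D g" by simp
      have "eventually_full n (entries n D g')"
      proof (rule ccontr)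
        assume "\<not> ?thesis"
        moreover have "\<forall>e. eig n D g e \<subseteq> entries n D g' e" using g'.eig_subset_entries same by simp
        ultimately obtain v where v: "v \<in> X" "\<forall>e. \<forall>p\<in>entries n D g' e. poly_eval v p = 0"
          using X(3) g'.gideal_entries by blast
        obtain i where i: "i \<le> n" "v i \<noteq> 0" using X(2) v(1) by blast
        have "poly_eval v (g' i) = 0" using v(2) g'.entry_in_entries[OF i(1)] by blast
        then have "t = \<gamma> v i"
          using i(2) l(2)[OF v(1)] by (simp add: g'_def \<gamma>_def poly_eval_simps field_simps)
        then show False using t v(1) i(1) by blast
      qed
      then have "(int D - 1) * c + 1 \<le> int D ^ Suc n"
        using 3 c same by (intro g'.eig_bound_of_entries_full[of M]) auto
      then have "real_of_int ((int D - 1) * c + 1) \<le> real_of_int (int D ^ Suc n)" by (simp only: of_int_le_iff)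
      then have "(real D - 1) * real_of_int c + 1 \<le> real D ^ (n + 1)" by simp
      then show ?thesis using 3 by (simp add: field_simps)
    qed
  qed
  then show ?thesis using l(1) full c by (intro bexI[of _ l] conjI exI[of _ M]) auto
qed

end

section \<open>Derivatives and substitutions of forms\<close>

lemma partial_deriv_conv_lin_ext:
  "partial_deriv i = lin_ext (\<lambda>m. Poly_Mapping.single (m - Poly_Mapping.single i 1) (of_nat (Poly_Mapping.lookup m i)))"
  by (intro ext) (simp add: partial_deriv_def lin_ext_def const_def mult_single mult.commute)

lemma linear_partial_deriv: "mpoly_linear (partial_deriv i)"
  unfolding partial_deriv_conv_lin_ext by (rule linear_lin_ext)

lemmas partial_deriv_linear = mpoly_linearD[OF linear_partial_deriv]

lemma partial_deriv_single:
  "partial_deriv i (Poly_Mapping.single m c) =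
     Poly_Mapping.single (m - Poly_Mapping.single i 1) (of_nat (Poly_Mapping.lookup m i) * c)"
  unfolding partial_deriv_conv_lin_ext by (simp add: const_def mult_single mult.commute)

lemma exponent_shift:
  assumes "Poly_Mapping.lookup (m :: nat \<Rightarrow>\<^sub>0 nat) i \<noteq> 0"
  shows "m + m' - Poly_Mapping.single i 1 = (m - Poly_Mapping.single i 1) + m'"
  using assms by (intro poly_mapping_eqI) (auto simp: lookup_add lookup_minus lookup_single when_def)

lemma partial_deriv_mult: "partial_deriv i (p * q) = partial_deriv i p * q + p * partial_deriv i q"
proof (induction p rule: mpoly_induct)
  case (single m c)
  show ?case
  proof (induction q rule: mpoly_induct)
    case (single m' c')
    \<comment> \<open>If x_i does not occur in \<open>m\<close>, truncated subtraction makes the two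
      exponents differ, but then the coefficient is zero.\<close>
    have 1: "Poly_Mapping.single (m - Poly_Mapping.single i 1 + m') (of_nat (Poly_Mapping.lookup m i) * (c * c'))
       = Poly_Mapping.single (m + m' - Poly_Mapping.single i 1) (of_nat (Poly_Mapping.lookup m i) * (c * c'))"
      using exponent_shift[of m i m'] by (cases "Poly_Mapping.lookup m i = 0") simp_all
    have 2: "Poly_Mapping.single (m + (m' - Poly_Mapping.single i 1)) (of_nat (Poly_Mapping.lookup m' i) * (c * c'))
       = Poly_Mapping.single (m + m' - Poly_Mapping.single i 1) (of_nat (Poly_Mapping.lookup m' i) * (c * c'))"
      using exponent_shift[of m' i m] by (cases "Poly_Mapping.lookup m' i = 0") (simp_all add: add.commute)
    have "partial_deriv i (Poly_Mapping.single m c * Poly_Mapping.single m' c')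
       = Poly_Mapping.single (m + m' - Poly_Mapping.single i 1) (of_nat (Poly_Mapping.lookup m i) * (c * c'))
         + Poly_Mapping.single (m + m' - Poly_Mapping.single i 1) (of_nat (Poly_Mapping.lookup m' i) * (c * c'))"
      by (simp add: mult_single partial_deriv_single lookup_add distrib_right flip: single_add)
    also have "\<dots> = Poly_Mapping.single (m - Poly_Mapping.single i 1 + m') (of_nat (Poly_Mapping.lookup m i) * (c * c'))
         + Poly_Mapping.single (m + (m' - Poly_Mapping.single i 1)) (of_nat (Poly_Mapping.lookup m' i) * (c * c'))"
      by (simp only: 1 2)
    also have "\<dots> = partial_deriv i (Poly_Mapping.single m c) * Poly_Mapping.single m' c'
         + Poly_Mapping.single m c * partial_deriv i (Poly_Mapping.single m' c')"
      by (simp only: partial_deriv_single mult_single mult.assoc mult.left_commute)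
    finally show ?case .
  qed (simp add: partial_deriv_linear distrib_left)
qed (simp add: partial_deriv_linear distrib_right)

lemma partial_deriv_const [simp]: "partial_deriv i (const c) = 0"
  by (simp add: const_def partial_deriv_single)

lemma partial_deriv_pvar [simp]: "partial_deriv i (pvar j) = (if i = j then 1 else 0)"
  by (simp add: pvar_def partial_deriv_single lookup_single when_def)

lemma partial_deriv_in_forms:
  assumes "p \<in> forms n e"
  shows "partial_deriv i p \<in> forms n (e - 1)"
  using assms
proof (induction rule: subspace_forms_induct)
  case subspace
  show ?case
    by (simp add: mpoly_vs.subspace_def partial_deriv_linear forms_add forms_scale forms_zero)
next
  case (monomial m)
  show ?case
  proof (cases "i \<in> Poly_Mapping.keys m")
    case True
    then obtain m' where m': "m = Poly_Mapping.single i 1 + m'" using exponent_split by metis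
    then have "m' \<in> exponents n (e - 1)" using monomial by (auto simp: exponents_def keys_add_nat)
    moreover have "m - Poly_Mapping.single i 1 = m'" unfolding m' by (rule add_diff_cancel_left')
    ultimately show ?thesis unfolding partial_deriv_single by (simp only: single_in_forms)
  next
    case False
    then show ?thesis by (simp add: partial_deriv_single in_keys_iff forms_zero)
  qed
qed

lemma linear_substitute: "mpoly_linear (substitute \<sigma>)"
  by (rule mpoly_linearI) (simp_all add: substitute_simps)

lemma substitute_in_forms:
  assumes \<sigma>: "\<And>i. i \<le> n \<Longrightarrow> \<sigma> i \<in> forms k 1" and p: "p \<in> forms n e"
  shows "substitute \<sigma> p \<in> forms k e"
  using p
proof (induction e arbitrary: p)
  case 0
  then show ?case using forms_0[OF 0] by (metis const_in_forms substitute_const)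
next
  case (Suc e)
  then obtain q where q: "\<And>j. j \<le> n \<Longrightarrow> q j \<in> forms n e" "p = (\<Sum>j\<le>n. pvar j * q j)"
    using forms_Suc_decompose by metis
  have "\<sigma> j * substitute \<sigma> (q j) \<in> forms k (Suc e)" if "j \<le> n" for j
    using forms_mult[OF \<sigma>[OF that] Suc.IH[OF q(1)[OF that]]] by simp
  then show ?case unfolding q(2) by (auto simp: substitute_simps intro: forms_sum)
qed

text \<open>The chain rule, reduced to the product rule by writing a form as a combination of the
  variables with coefficients of lower degree.\<close>

lemma partial_deriv_substitute:
  assumes p: "p \<in> forms n e"
  shows "partial_deriv j (substitute \<sigma> p) = (\<Sum>m\<le>n. substitute \<sigma> (partial_deriv m p) * partial_deriv j (\<sigma> m))"
  using p
proof (induction e arbitrary: p)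
  case 0
  then have "p = const (Poly_Mapping.lookup p 0)" by (rule forms_0)
  then obtain c where "p = const c" by blast
  then show ?case by (simp add: substitute_simps)
next
  case (Suc e)
  then obtain q where q: "\<And>j. j \<le> n \<Longrightarrow> q j \<in> forms n e" "p = (\<Sum>j\<le>n. pvar j * q j)"
    using forms_Suc_decompose by metis
  let ?S = "substitute \<sigma>" and ?d = "\<lambda>m. partial_deriv j (\<sigma> m)"
  have "partial_deriv j (?S p) = (\<Sum>l\<le>n. ?d l * ?S (q l) + \<sigma> l * (\<Sum>m\<le>n. ?S (partial_deriv m (q l)) * ?d m))"
    unfolding q(2) using Suc.IH[OF q(1)]
    by (simp add: substitute_simps partial_deriv_linear partial_deriv_mult)
  also have "\<dots> = (\<Sum>m\<le>n. ?S (q m) * ?d m) + (\<Sum>m\<le>n. \<Sum>l\<le>n. \<sigma> l * ?S (partial_deriv m (q l)) * ?d m)"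
    by (simp add: sum.distrib sum_distrib_left mult.assoc mult.commute[of "?d _"])
      (rule sum.swap)
  also have "\<dots> = (\<Sum>m\<le>n. ((\<Sum>l\<le>n. (if m = l then ?S (q l) else 0)) + (\<Sum>l\<le>n. \<sigma> l * ?S (partial_deriv m (q l)))) * ?d m)"
    by (simp add: sum.distrib distrib_right sum_distrib_right)
  also have "\<dots> = (\<Sum>m\<le>n. ?S (partial_deriv m p) * ?d m)"
  proof (intro sum.cong refl arg_cong2[where f = "(*)"])
    fix m
    have "?S (partial_deriv m p) = (\<Sum>l\<le>n. (if m = l then ?S (q l) else 0) + \<sigma> l * ?S (partial_deriv m (q l)))"
      unfolding q(2) partial_deriv_linear(5) partial_deriv_mult
      by (simp add: substitute_simps) (intro sum.cong refl, simp add: substitute_simps)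
    then show "(\<Sum>l\<le>n. (if m = l then ?S (q l) else 0)) + (\<Sum>l\<le>n. \<sigma> l * ?S (partial_deriv m (q l))) = ?S (partial_deriv m p)"
      by (simp only: sum.distrib)
  qed
  finally show ?case .
qed

section \<open>The forms attached to a tensor\<close>

lemma prod_list_pvar_in_forms: "set js \<subseteq> {..n} \<Longrightarrow> prod_list (map pvar js) \<in> forms n (length js)"
proof (induction js)
  case Nil
  then show ?case by (simp add: one_in_forms)
next
  case (Cons j js)
  then show ?case using forms_mult[OF pvar_in_forms[of j n], of "prod_list (map pvar js)" "length js"] by simp
qed

lemma multi_index_in_forms: "js \<in> multi_indices n e \<Longrightarrow> prod_list (map pvar js) \<in> forms n e"
  using prod_list_pvar_in_forms[of js n] by (simp add: multi_indices_def)

lemma tensor_forms_in_forms: "tensor_forms n d T i \<in> forms n (d - 1)"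
  unfolding tensor_forms_def by (intro forms_sum forms_scale multi_index_in_forms)

lemma tensor_poly_in_forms: "tensor_poly n d T \<in> forms n d"
  unfolding tensor_poly_def by (intro forms_sum forms_scale multi_index_in_forms)

section \<open>Graded pieces of ideals of the coordinate ring\<close>

definition pieces :: "nat \<Rightarrow> mpoly set \<Rightarrow> nat \<Rightarrow> mpoly set" where
  "pieces n I e = I \<inter> forms n e"

lemma gideal_pieces:
  assumes "ideal I (coord_ring n)"
  shows "gideal n (pieces n I)"
  unfolding gideal_def pieces_def
  using ideal_coord_ringD[OF assms] forms_carrier forms_mult
  by (auto simp: mpoly_vs.subspace_def forms_zero forms_add forms_scale)

context eigen_tensor
begin

lemma minors_carrier: "{pvar i * g j - pvar j * g i | i j. i \<le> n \<and> j \<le> n} \<subseteq> carrier (coord_ring n)"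
  using forms_carrier minor_in_forms[of n g D, OF g] by blast

lemma ideal_minors: "ideal (minors_ideal n g) (coord_ring n)"
  unfolding minors_ideal_def by (intro ring.genideal_ideal cring.axioms(1) cring_coord_ring minors_carrier)

lemma minor_in_minors_ideal: "i \<le> n \<Longrightarrow> j \<le> n \<Longrightarrow> pvar i * g j - pvar j * g i \<in> minors_ideal n g"
  unfolding minors_ideal_def
  using ring.genideal_self[OF cring.axioms(1)[OF cring_coord_ring] minors_carrier] by blast

lemma minors_ideal_least:
  assumes "ideal I (coord_ring n)" "\<And>i j. i \<le> n \<Longrightarrow> j \<le> n \<Longrightarrow> pvar i * g j - pvar j * g i \<in> I"
  shows "minors_ideal n g \<subseteq> I"
  unfolding minors_ideal_def
  by (rule ring.genideal_minimal[OF cring.axioms(1)[OF cring_coord_ring] assms(1)]) (use assms(2) in blast)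

lemma minors_ideal_subset_tot:
  assumes J: "gideal n J" and "\<And>i j. i \<le> n \<Longrightarrow> j \<le> n \<Longrightarrow> pvar i * g j - pvar j * g i \<in> J (Suc D)"
  shows "minors_ideal n g \<subseteq> tot n J"
  using assms tot_forms_iff[OF J minor_in_forms[of n g D, OF g]] by (intro minors_ideal_least ideal_tot) auto

lemma scheme_dim_0_brel:
  assumes "scheme_dim n (minors_ideal n g) = 0" "i \<le> n" "j \<le> n" "i \<noteq> j"
  shows "brel n (eig n D g) i j"
  using scheme_dim_ne_0[OF gideal_eig minors_ideal_subset_tot[OF gideal_eig minor_in_eig]] assms by blast

end

text \<open>The parameter \<open>l\<close> makes the Hilbert function eventually constant. The
  definite description in \<open>hilbert_poly\<close> then denotes that constant, since polynomials
  agreeing at infinitely many integers coincide, and the factorial in the degree is that of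
  0.\<close>

lemma scheme_degree_eq:
  assumes K: "ideal K (coord_ring n)" and l: "l \<in> forms n 1"
    and full: "eventually_full n (gsum n (pieces n K) 1 l)"
  shows "\<exists>N. \<forall>e\<ge>N. scheme_degree n K = real_of_int (hf n (pieces n K) e)"
proof -
  note gK = gideal_pieces[OF K]
  obtain N c where c: "\<And>e. e \<ge> N \<Longrightarrow> hf n (pieces n K) e = c"
    using hf_eventually_const[OF gK l full] by blast
  have hilb: "real (hilbert_function n K e) = real_of_int (hf n (pieces n K) e)" for e
    using hf_nonneg[OF gK, of e] by (simp add: hilbert_function_def hf_def pieces_def of_nat_diff)
  have unique: "h = [:real_of_int c:]"
    if h: "eventually (\<lambda>e. poly h (real e) = real (hilbert_function n K e)) sequentially" for h
  proof -
    obtain M where M: "\<And>e. e \<ge> M \<Longrightarrow> poly h (real e) = real (hilbert_function n K e)"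
      using h by (auto simp: eventually_sequentially)
    have "real ` {max M N..} \<subseteq> {x. poly (h - [:real_of_int c:]) x = 0}"
      using M c hilb by auto
    moreover have "infinite (real ` {max M N..})"
      by (subst finite_image_iff) (auto simp: infinite_Ici)
    ultimately have "infinite {x. poly (h - [:real_of_int c:]) x = 0}" by (meson finite_subset)
    then have "h - [:real_of_int c:] = 0" using poly_roots_finite by blast
    then show ?thesis by simp
  qed
  have "hilbert_poly n K = [:real_of_int c:]"
    unfolding hilbert_poly_def
  proof (rule the_equality)
    show "eventually (\<lambda>e. poly [:real_of_int c:] (real e) = real (hilbert_function n K e)) sequentially"
      unfolding eventually_sequentially using c hilb by auto
  qed (rule unique)
  then show ?thesis using c by (intro exI[of _ N]) (simp add: scheme_degree_def)
qed

text \<open>A parameter modulo the smaller ideal is one modulo the larger, so both degrees are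
  eventual values of Hilbert functions and can be compared in one degree.\<close>

lemma scheme_degree_antimono:
  assumes K: "ideal K (coord_ring n)" "ideal K' (coord_ring n)" "K \<subseteq> K'" and l: "l \<in> forms n 1"
    and full: "eventually_full n (gsum n (pieces n K) 1 l)"
  shows "scheme_degree n K' \<le> scheme_degree n K"
proof -
  have full': "eventually_full n (gsum n (pieces n K') 1 l)"
  proof (rule eventually_full_mono[OF full])
    show "p \<in> gsum n (pieces n K') 1 l e" if "p \<in> gsum n (pieces n K) 1 l e" for e p
      using gsum_mono[OF _ that, of "pieces n K'"] K(3) by (auto simp: pieces_def)
  qed
  obtain N where N: "\<And>e. e \<ge> N \<Longrightarrow> scheme_degree n K = real_of_int (hf n (pieces n K) e)"
    using scheme_degree_eq[OF K(1) l full] by blast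
  obtain N' where N': "\<And>e. e \<ge> N' \<Longrightarrow> scheme_degree n K' = real_of_int (hf n (pieces n K') e)"
    using scheme_degree_eq[OF K(2) l full'] by blast
  have "hf n (pieces n K') (max N N') \<le> hf n (pieces n K) (max N N')"
    using K by (intro hf_mono gideal_pieces) (auto simp: pieces_def)
  then show ?thesis using N[of "max N N'"] N'[of "max N N'"] by simp
qed

lemma ideal_colon:
  assumes "ideal I (coord_ring n)" "J \<subseteq> carrier (coord_ring n)"
  shows "ideal (colon_ideal n I J) (coord_ring n)"
proof (rule idealI_coord_ring)
  show "0 \<in> colon_ideal n I J"
    using ideal_coord_ringD(2)[OF assms(1)] by (auto simp: colon_ideal_def coord_ring_def)
  show "p + q \<in> colon_ideal n I J" if "p \<in> colon_ideal n I J" "q \<in> colon_ideal n I J" for p q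
    using that ideal_coord_ringD(3)[OF assms(1)] coord_ring_closed by (auto simp: colon_ideal_def distrib_right)
  show "q * p \<in> colon_ideal n I J" if "p \<in> colon_ideal n I J" "q \<in> carrier (coord_ring n)" for p q
    using that ideal_coord_ringD(5)[OF assms(1)] coord_ring_closed by (auto simp: colon_ideal_def mult.assoc)
qed (auto simp: colon_ideal_def)

text \<open>Powers of \<open>J\<close> decrease, so the colon ideals form an increasing chain and
  their union is an ideal. The power with exponent 0 is the whole ring, which puts \<open>I\<close>
  into the union.\<close>

lemma ideal_saturation_is_ideal:
  assumes I: "ideal I (coord_ring n)" and J: "ideal J (coord_ring n)"
  shows "ideal (ideal_saturation n I J) (coord_ring n)" "I \<subseteq> ideal_saturation n I J"
proof -
  interpret R: cring "coord_ring n" by (rule cring_coord_ring)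
  have pow: "ideal (ideal_power n J N) (coord_ring n)" for N
    by (induction N) (auto intro: R.oneideal R.ideal_prod_is_ideal[OF J])
  have step: "ideal_power n J (Suc N) \<subseteq> ideal_power n J N" for N
    using R.ideal_prod_inter[OF J pow[of N]] by auto
  have anti: "ideal_power n J N \<subseteq> ideal_power n J M" if "M \<le> N" for M N
    using that by (induction N rule: dec_induct) (use step in blast)+
  have carrier: "ideal_power n J N \<subseteq> carrier (coord_ring n)" for N
    using ideal_coord_ringD(1)[OF pow] .
  have colon: "ideal (colon_ideal n I (ideal_power n J N)) (coord_ring n)" for N
    by (rule ideal_colon[OF I carrier])
  have mono: "colon_ideal n I (ideal_power n J M) \<subseteq> colon_ideal n I (ideal_power n J N)" if "M \<le> N" for M N
    using anti[OF that] by (auto simp: colon_ideal_def)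
  show "ideal (ideal_saturation n I J) (coord_ring n)"
  proof (rule idealI_coord_ring)
    show "ideal_saturation n I J \<subseteq> carrier (coord_ring n)"
      using ideal_coord_ringD(1)[OF colon] by (auto simp: ideal_saturation_def)
    show "0 \<in> ideal_saturation n I J"
      using ideal_coord_ringD(2)[OF colon] by (auto simp: ideal_saturation_def)
    show "p + q \<in> ideal_saturation n I J" if "p \<in> ideal_saturation n I J" "q \<in> ideal_saturation n I J" for p q
    proof -
      obtain M N where "p \<in> colon_ideal n I (ideal_power n J M)" "q \<in> colon_ideal n I (ideal_power n J N)"
        using \<open>p \<in> _\<close> \<open>q \<in> _\<close> by (auto simp: ideal_saturation_def)
      then have "p \<in> colon_ideal n I (ideal_power n J (max M N))" "q \<in> colon_ideal n I (ideal_power n J (max M N))"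
        using mono[of M "max M N"] mono[of N "max M N"] by auto
      then show ?thesis
        using ideal_coord_ringD(3)[OF colon] unfolding ideal_saturation_def by blast
    qed
    show "q * p \<in> ideal_saturation n I J" if "p \<in> ideal_saturation n I J" "q \<in> carrier (coord_ring n)" for p q
      using that ideal_coord_ringD(5)[OF colon] by (auto simp: ideal_saturation_def)
  qed
  have "I \<subseteq> colon_ideal n I (ideal_power n J 0)"
    using ideal_coord_ringD(1)[OF I] ideal_coord_ringD(5)[OF I]
    by (auto simp: colon_ideal_def mult.commute)
  then show "I \<subseteq> ideal_saturation n I J" unfolding ideal_saturation_def by blast
qed

lemma set_add_coord_ring: "I <+>\<^bsub>coord_ring n\<^esub> J = {p + q | p q. p \<in> I \<and> q \<in> J}"
  by (auto simp: set_add_def' )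

section \<open>Collinear eigenpoints\<close>

lemma linear_space_dim_le:
  assumes "linear_space n k L"
  shows "k \<le> n"
proof -
  have "L \<subseteq> cvec.span ((\<lambda>i j. if j = i then 1 else 0) ` {..n})"
    using assms coord_space_span by (auto simp: linear_space_def)
  then have "cvec.dim L \<le> card ((\<lambda>i j. if j = i then 1 else (0::complex)) ` {..n})"
    by (intro cvec.dim_le_card) auto
  also have "\<dots> \<le> Suc n" using card_image_le[of "{..n}"] by (metis card_atMost finite_atMost)
  finally show ?thesis using assms by (simp add: linear_space_def)
qed

lemma linear_space_basis:
  assumes "linear_space n k L"
  obtains B where "B \<subseteq> L" "cvec.independent B" "cvec.span B = L" "card B = Suc k" "finite B"
proof -
  obtain B where B: "B \<subseteq> L" "cvec.independent B" "L \<subseteq> cvec.span B" "card B = cvec.dim L"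
    using cvec.basis_exists[of L] by metis
  moreover from B have "cvec.span B = L" using assms by (simp add: cvec.span_subspace linear_space_def)
  moreover have "card B = Suc k" using B assms by (simp add: linear_space_def)
  moreover from this have "finite B" by (metis card.infinite nat.distinct(1))
  ultimately show thesis using that by blast
qed

text \<open>The form is evaluated in the ring of polynomials in t, at x_i + t y_i.\<close>

lemma restrict_to_line_degree:
  assumes p: "p \<in> forms n e"
  obtains r where "degree r \<le> e" "\<And>t. poly r t = poly_eval (\<lambda>i. x i + t * y i) p"
proof
  let ?r = "meval (\<lambda>c. [:c:]) (\<lambda>i. [:x i, y i:]) p"
  have "poly ?r t = meval (\<lambda>c. poly [:c:] t) (\<lambda>i. poly [:x i, y i:] t) p" for t
    by (rule ring_map_comp_meval[of "\<lambda>q. poly q t"]) (simp add: ring_map_def)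
  then show "poly ?r t = poly_eval (\<lambda>i. x i + t * y i) p" for t
    by (simp add: poly_eval_conv_meval)
  have "degree (monom_val (\<lambda>i. [:x i, y i:]) m) \<le> e" if "m \<in> Poly_Mapping.keys p" for m
  proof -
    have "degree (monom_val (\<lambda>i. [:x i, y i:]) m) \<le> (\<Sum>i\<in>Poly_Mapping.keys m. degree ([:x i, y i:] ^ Poly_Mapping.lookup m i))"
      unfolding monom_val_def
      using degree_prod_sum_le[of "Poly_Mapping.keys m" "\<lambda>i. [:x i, y i:] ^ Poly_Mapping.lookup m i"]
      by (simp add: o_def)
    also have "\<dots> \<le> (\<Sum>i\<in>Poly_Mapping.keys m. Poly_Mapping.lookup m i)"
    proof (rule sum_mono)
      fix i
      have "degree ([:x i, y i:] ^ Poly_Mapping.lookup m i) \<le> degree [:x i, y i:] * Poly_Mapping.lookup m i"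
        by (rule degree_power_le)
      also have "\<dots> \<le> Poly_Mapping.lookup m i" by simp
      finally show "degree ([:x i, y i:] ^ Poly_Mapping.lookup m i) \<le> Poly_Mapping.lookup m i" .
    qed
    also have "\<dots> = e" using p that by (auto simp: in_forms_iff exponents_def mon_degree_def)
    finally show ?thesis .
  qed
  then show "degree ?r \<le> e"
    unfolding meval_def by (intro degree_sum_le) (auto intro: order.trans[OF degree_smult_le])
qed

text \<open>With a nonzero minor, the ratio of coordinates j and i is injective in t where it is
  defined. It therefore takes infinitely many values, all of them roots of the supposed
  relation.\<close>

lemma no_binary_relation_on_line:
  assumes \<Delta>: "x i * y j \<noteq> x j * y i"
  shows "\<not> brel n (\<lambda>e. {p \<in> forms n e. \<forall>v\<in>range (\<lambda>t i. x i + t * y i). poly_eval v p = 0}) i j"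
proof
  assume "brel n (\<lambda>e. {p \<in> forms n e. \<forall>v\<in>range (\<lambda>t i. x i + t * y i). poly_eval v p = 0}) i j"
  then obtain e r where r: "r \<noteq> 0" "degree r \<le> e" "\<And>t. poly_eval (\<lambda>i. x i + t * y i) (homog i j e r) = 0"
    by (auto simp: brel_def)
  define A where "A = {t. x i + t * y i \<noteq> 0}"
  have "{t. x i + t * y i = 0} = {t. poly [:x i, y i:] t = 0}" by simp
  moreover have "[:x i, y i:] \<noteq> 0" using \<Delta> by auto
  ultimately have "finite {t. x i + t * y i = 0}" using poly_roots_finite by metis
  moreover have "UNIV = A \<union> {t. x i + t * y i = 0}" by (auto simp: A_def)
  ultimately have "infinite A" using infinite_UNIV_char_0[where 'a = complex] by (metis finite_UnI)
  moreover have "inj_on (\<lambda>t. (x j + t * y j) / (x i + t * y i)) A"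
  proof (rule inj_onI)
    fix s t assume st: "s \<in> A" "t \<in> A" "(x j + s * y j) / (x i + s * y i) = (x j + t * y j) / (x i + t * y i)"
    then have "(x j + s * y j) * (x i + t * y i) = (x j + t * y j) * (x i + s * y i)"
      by (simp add: A_def divide_simps)
    then have "(s - t) * (x i * y j - x j * y i) = 0" by (simp add: algebra_simps)
    then show "s = t" using \<Delta> by simp
  qed
  ultimately have "infinite ((\<lambda>t. (x j + t * y j) / (x i + t * y i)) ` A)"
    by (simp add: finite_image_iff)
  moreover have "(\<lambda>t. (x j + t * y j) / (x i + t * y i)) ` A \<subseteq> {s. poly r s = 0}"
    using homog_eval_poly[OF r(2), of "\<lambda>l. x l + t * y l" i j for t] r(3) by (auto simp: A_def)
  ultimately show False using poly_roots_finite[OF r(1)] finite_subset by blast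
qed

text \<open>On a parametrised line each minor is a polynomial of degree at most \<open>d\<close>,
  and the \<open>d + 1\<close> points give distinct roots, so it vanishes identically. The ideal of
  the line admits no relation between two suitable coordinates, against dimension zero.\<close>

lemma eigenpoints_not_collinear:
  assumes dim: "scheme_dim n (tensor_eigenscheme n d T) = 0" and "1 \<le> d"
    and Q: "Q \<subseteq> closed_points n (tensor_eigenscheme n d T)" "card Q = d + 1" "collinear_points n Q"
  shows False
proof -
  interpret eigen_tensor n "d - 1" "tensor_forms n d T"
    by unfold_locales (rule tensor_forms_in_forms)
  obtain M where M: "linear_space n 1 M" "\<And>P. P \<in> Q \<Longrightarrow> P \<subseteq> M" using Q(3) by (auto simp: collinear_points_def)
  obtain B where B: "B \<subseteq> M" "cvec.independent B" "cvec.span B = M" "card B = Suc 1" "finite B"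
    by (rule linear_space_basis[OF M(1)])
  then obtain a b where ab: "B = {a, b}" "a \<noteq> b" by (auto simp: card_Suc_eq)
  have Mab: "\<exists>s t. v = (\<lambda>i. s * a i + t * b i)" if "v \<in> M" for v
    using that unfolding B(3)[symmetric] ab(1) cvec.span_insert cvec.span_singleton
    by (auto simp: fun_eq_iff algebra_simps)
  have indep: "s = 0 \<and> t = 0" if "\<And>i. s * a i + t * b i = 0" for s t
  proof -
    have b0: "b \<noteq> 0" "a \<notin> cvec.span {b}"
      using B(2) ab cvec.independent_insert[of a "{b}"] by (auto simp: cvec.dependent_single)
    have "s = 0"
    proof (rule ccontr)
      assume "s \<noteq> 0"
      then have "a = (\<lambda>i. (- t / s) * b i)"
        using that by (auto simp: fun_eq_iff field_simps eq_neg_iff_add_eq_0 add.commute)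
      then have "a \<in> cvec.span {b}" by (metis cvec.span_base cvec.span_scale singletonI)
      then show False using b0 by blast
    qed
    then show ?thesis using that b0(1) by (auto simp: fun_eq_iff)
  qed
  have finQ: "finite Q" using Q(2) by (metis card.infinite add_is_0 one_neq_zero)
  define spans where "spans P s t \<longleftrightarrow> (s \<noteq> 0 \<or> t \<noteq> 0) \<and> P = range (\<lambda>c i. c * (s * a i + t * b i))" for P s t
  have "\<exists>s t. spans P s t" if PQ: "P \<in> Q" for P
  proof -
    have P: "linear_space n 0 P" using Q(1) PQ by (auto simp: closed_points_def)
    obtain C where C: "C \<subseteq> P" "cvec.independent C" "cvec.span C = P" "card C = Suc 0"
      by (rule linear_space_basis[OF P])
    then obtain v where v: "C = {v}" by (auto simp: card_Suc_eq)
    then have "v \<noteq> 0" using C(2) by simp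
    obtain s t where st: "v = (\<lambda>i. s * a i + t * b i)" using Mab M(2)[OF PQ] C(1) v by blast
    moreover have "s \<noteq> 0 \<or> t \<noteq> 0" using \<open>v \<noteq> 0\<close> st by (auto simp: fun_eq_iff)
    moreover have "P = range (\<lambda>c i. c * v i)" using C(3) v by (simp add: cvec.span_singleton)
    ultimately have "spans P s t" by (simp add: spans_def)
    then show ?thesis by blast
  qed
  then obtain S U where "\<And>P. P \<in> Q \<Longrightarrow> spans P (S P) (U P)" by metis
  then have SU: "S P \<noteq> 0 \<or> U P \<noteq> 0" "P = range (\<lambda>c i. c * (S P * a i + U P * b i))" if "P \<in> Q" for P
    using that unfolding spans_def by blast+
  \<comment> \<open>Where \<open>S P = 0\<close> the quotient is 0, which merely forbids one more
    value; then \<open>U P\<close> is nonzero and \<beta> is nonzero anyway.\<close>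
  obtain \<tau> where \<tau>: "\<tau> \<notin> (\<lambda>P. U P / S P) ` Q"
    using ex_new_if_finite[OF infinite_UNIV_char_0] finQ by blast
  text \<open>In the basis \<open>x = b\<close>, \<open>y = a + \<tau> b\<close> of the line, no point of \<open>Q\<close> is spanned by \<open>y\<close>.\<close>
  define y where "y i = a i + \<tau> * b i" for i
  \<comment> \<open>The coordinate along b in the new basis:
    \<open>S a + U b = S y + (U - \<tau> S) b\<close>.\<close>
  define \<beta> where "\<beta> P = U P - \<tau> * S P" for P
  have \<beta>: "\<beta> P \<noteq> 0" if "P \<in> Q" for P
  proof
    assume "\<beta> P = 0"
    then have "U P = \<tau> * S P" by (simp add: \<beta>_def)
    moreover from this have "S P \<noteq> 0" using SU(1)[OF that] by auto
    ultimately have "\<tau> = U P / S P" by simp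
    then show False using \<tau> that by blast
  qed
  define t where "t P = S P / \<beta> P" for P
  have vec: "(\<lambda>i. S P * a i + U P * b i) = (\<lambda>i. \<beta> P * (b i + t P * y i))" if "P \<in> Q" for P
  proof
    fix i
    have "\<beta> P * (b i + t P * y i) = \<beta> P * b i + S P * y i"
      using \<beta>[OF that] by (simp add: t_def distrib_left)
    also have "\<dots> = S P * a i + U P * b i" by (simp add: \<beta>_def y_def algebra_simps)
    finally show "S P * a i + U P * b i = \<beta> P * (b i + t P * y i)" by simp
  qed
  have Pt: "P = range (\<lambda>c i. c * (b i + t P * y i))" if "P \<in> Q" for P
  proof -
    have "P = range (\<lambda>c i. c * (\<beta> P * (b i + t P * y i)))"
      by (rule trans[OF SU(2)[OF that] arg_cong[where f = range]])
        (intro ext arg_cong2[where f = "(*)"] refl fun_cong[OF vec[OF that]])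
    also have "\<dots> = range (\<lambda>c i. c * (b i + t P * y i))"
    proof -
      have "(\<lambda>c i. c * (\<beta> P * (b i + t P * y i))) = (\<lambda>c i. c * (b i + t P * y i)) \<circ> (\<lambda>c. c * \<beta> P)"
        by (intro ext) (simp only: comp_def mult.assoc)
      moreover have "range (\<lambda>c. c * \<beta> P) = UNIV"
        by (rule surjI[where f = "\<lambda>c. c / \<beta> P"]) (simp add: \<beta>[OF that])
      ultimately show ?thesis by (simp only: image_comp[symmetric])
    qed
    finally show ?thesis .
  qed
  have inj: "inj_on t Q"
  proof (rule inj_onI)
    fix P P' assume PP: "P \<in> Q" "P' \<in> Q" "t P = t P'"
    have "P = range (\<lambda>c i. c * (b i + t P' * y i))" using Pt[OF PP(1)] unfolding PP(3) .
    also have "\<dots> = P'" by (rule Pt[OF PP(2), symmetric])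
    finally show "P = P'" .
  qed
  have mem: "(\<lambda>i. b i + t P * y i) \<in> P" if "P \<in> Q" for P
    by (subst Pt[OF that]) (rule range_eqI[of _ _ 1], simp)
  let ?J = "\<lambda>e. {p \<in> forms n e. \<forall>v\<in>range (\<lambda>t i. b i + t * y i). poly_eval v p = 0}"
  let ?g = "tensor_forms n d T"
  have "pvar l * ?g m - pvar m * ?g l \<in> ?J (Suc (d - 1))" if lm: "l \<le> n" "m \<le> n" for l m
  proof -
    let ?q = "pvar l * ?g m - pvar m * ?g l"
    have q: "?q \<in> forms n (Suc (d - 1))" by (rule minor_in_forms[of n ?g, OF g lm])
    obtain r where r: "degree r \<le> Suc (d - 1)" "\<And>t. poly r t = poly_eval (\<lambda>i. b i + t * y i) ?q"
      using restrict_to_line_degree[OF q] by metis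
    have "poly r (t P) = 0" if "P \<in> Q" for P
    proof -
      have "\<forall>v\<in>P. \<forall>p\<in>minors_ideal n ?g. poly_eval v p = 0"
        using Q(1) that by (auto simp: closed_points_def tensor_eigenscheme_def)
      then show ?thesis using mem[OF that] minor_in_minors_ideal[OF lm] r(2) by simp
    qed
    then have sub: "t ` Q \<subseteq> {x. poly r x = 0}" by auto
    have "r = 0"
    proof (rule ccontr)
      assume "r \<noteq> 0"
      then have "card (t ` Q) \<le> degree r"
        using sub card_mono[OF poly_roots_finite[of r] sub] card_poly_roots_bound[of r] by linarith
      then show False using r(1) Q(2) \<open>1 \<le> d\<close> by (simp add: card_image[OF inj])
    qed
    then show ?thesis using q r(2) by auto
  qed
  then have sub: "tensor_eigenscheme n d T \<subseteq> tot n ?J"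
    unfolding tensor_eigenscheme_def by (intro minors_ideal_subset_tot gideal_vanishing) auto
  have ab_coord: "a \<in> coord_space n" "b \<in> coord_space n" using B(1) ab M(1) by (auto simp: linear_space_def)
  have "\<exists>i j. b i * a j \<noteq> b j * a i"
  proof (rule ccontr)
    assume *: "\<not> ?thesis"
    have "a \<noteq> 0" using B(2) ab cvec.dependent_zero by blast
    then obtain j where j: "a j \<noteq> 0" by (auto simp: fun_eq_iff)
    have "b j * a i + (- a j) * b i = 0" for i
    proof -
      have "b i * a j = b j * a i" using * by blast
      then show ?thesis by (simp add: mult.commute)
    qed
    then have "b j = 0 \<and> - a j = 0" by (rule indep)
    then show False using j by simp
  qed
  then obtain i j where ij: "b i * a j \<noteq> b j * a i" by blast
  then have "i \<le> n" "j \<le> n" "i \<noteq> j" using ab_coord by (auto simp: coord_space_def simp flip: not_less)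
  \<comment> \<open>Passing from a to y = a + \<tau> b adds a multiple of b, so the minor of b and y
    equals that of b and a.\<close>
  moreover have "\<not> brel n ?J i j"
    using ij by (intro no_binary_relation_on_line) (auto simp: y_def algebra_simps)
  ultimately show False using scheme_dim_ne_0[OF gideal_vanishing sub] dim by blast
qed


section \<open>Restriction to a linear space\<close>

locale adapted_restriction =
  fixes n k d :: nat and L :: "(nat \<Rightarrow> complex) set" and A :: "nat \<Rightarrow> nat \<Rightarrow> complex" and f :: mpoly
  assumes L: "linear_space n k L" and A: "adapted_coords n k L A" and f: "f \<in> forms n d"
begin

text \<open>The coordinates of the parametrisation y -> A (y, 0) of \<open>L\<close>. Its
  counterpart \<sigma> is built from the transpose of A, which by orthogonality recovers y on
  \<open>L\<close>.\<close>

definition \<tau> :: "nat \<Rightarrow> mpoly" where "\<tau> i = (\<Sum>j\<le>k. const (A i j) * pvar j)"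

definition \<sigma> :: "nat \<Rightarrow> mpoly" where "\<sigma> i = (\<Sum>l\<le>n. const (A l i) * pvar l)"

lemma k_le_n: "k \<le> n" by (rule linear_space_dim_le[OF L])

lemma restriction_eq: "restriction n k A = substitute \<tau>"
proof
  fix p
  have \<tau>: "restrict_coords k (\<Sum>j\<le>n. const (A i j) * pvar j) = \<tau> i" for i
  proof -
    have "restrict_coords k (\<Sum>j\<le>n. const (A i j) * pvar j) = (\<Sum>j\<le>n. const (A i j) * (if j \<le> k then pvar j else 0))"
      by (simp add: restrict_coords_def substitute_simps)
    also have "\<dots> = \<tau> i"
      unfolding \<tau>_def using k_le_n by (intro sum.mono_neutral_cong_right) auto
    finally show ?thesis .
  qed
  have "restriction n k A p = meval const (\<lambda>i. restrict_coords k (\<Sum>j\<le>n. const (A i j) * pvar j)) p"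
    unfolding restriction_def change_coords_def restrict_coords_def substitute_conv_meval
    by (subst ring_map_comp_meval) (simp_all add: ring_map_meval ring_map_const meval_const)
  then show "restriction n k A p = substitute \<tau> p" by (simp add: \<tau> substitute_conv_meval)
qed

lemma \<tau>_forms: "\<tau> i \<in> forms k 1"
  unfolding \<tau>_def by (intro forms_sum forms_scale pvar_in_forms) auto

lemma \<sigma>_forms: "\<sigma> i \<in> forms n 1"
  unfolding \<sigma>_def by (intro forms_sum forms_scale pvar_in_forms) auto

lemmas \<tau>_substitute_forms = substitute_in_forms[of n \<tau> k, OF \<tau>_forms]
lemmas \<sigma>_substitute_forms = substitute_in_forms[of k \<sigma> n, OF \<sigma>_forms]

abbreviation "h \<equiv> restriction n k A f"
abbreviation "IL \<equiv> linear_space_ideal n L"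

lemma h_forms: "h \<in> forms k d"
  unfolding restriction_eq by (rule \<tau>_substitute_forms[OF f])

sublocale ambient: eigen_tensor n "d - 1" "\<lambda>i. partial_deriv i f"
  by unfold_locales (rule partial_deriv_in_forms[OF f])

sublocale restricted: eigen_tensor k "d - 1" "\<lambda>i. partial_deriv i h"
  by unfold_locales (rule partial_deriv_in_forms[OF h_forms])

lemma IL_generators: "{l \<in> forms n 1. \<forall>v\<in>L. poly_eval v l = 0} \<subseteq> carrier (coord_ring n)"
  using forms_carrier by blast

lemma ideal_IL: "ideal IL (coord_ring n)"
  unfolding linear_space_ideal_def
  by (intro ring.genideal_ideal cring.axioms(1) cring_coord_ring IL_generators)

lemma linear_form_in_IL: "l \<in> forms n 1 \<Longrightarrow> (\<And>v. v \<in> L \<Longrightarrow> poly_eval v l = 0) \<Longrightarrow> l \<in> IL"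
  unfolding linear_space_ideal_def
  using ring.genideal_self[OF cring.axioms(1)[OF cring_coord_ring] IL_generators] by blast

text \<open>The substitution \<open>x \<mapsto> \<sigma> (\<tau> x)\<close> is the orthogonal projection to \<open>L\<close>.\<close>

lemma projection_pvar:
  assumes i: "i \<le> n"
  shows "pvar i - substitute \<sigma> (\<tau> i) \<in> IL"
proof (rule linear_form_in_IL)
  show "pvar i - substitute \<sigma> (\<tau> i) \<in> forms n 1"
    by (intro forms_diff pvar_in_forms i \<sigma>_substitute_forms \<tau>_forms)
  fix v assume "v \<in> L"
  then obtain y where y: "y \<in> coord_space k" "v = mat_apply n A y" using A by (auto simp: adapted_coords_def)
  have y0: "y j = 0" if "j > k" for j using y(1) that by (simp add: coord_space_def)
  \<comment> \<open>Here A^T A = 1 is used: the adapted coordinates of A y are those of y.\<close>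
  have \<sigma>v: "poly_eval v (\<sigma> j) = y j" if j: "j \<le> n" for j
  proof -
    have "poly_eval v (\<sigma> j) = (\<Sum>l\<le>n. A l j * (\<Sum>m\<le>n. A l m * y m))"
      by (simp add: \<sigma>_def poly_eval_simps y(2) mat_apply_def)
    also have "\<dots> = (\<Sum>m\<le>n. (\<Sum>l\<le>n. A l j * A l m) * y m)"
      unfolding sum_distrib_left sum_distrib_right by (subst sum.swap) (simp add: mult.assoc)
    also have "\<dots> = (\<Sum>m\<le>n. if j = m then y m else 0)"
      using A j by (intro sum.cong) (auto simp: adapted_coords_def complex_orthogonal_def)
    also have "\<dots> = y j" using j by simp
    finally show ?thesis .
  qed
  have "poly_eval v (substitute \<sigma> (\<tau> i)) = (\<Sum>j\<le>k. A i j * y j)"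
    using k_le_n by (simp add: \<tau>_def substitute_simps poly_eval_simps \<sigma>v)
  also have "\<dots> = (\<Sum>j\<le>n. A i j * y j)"
    using k_le_n y0 by (intro sum.mono_neutral_left) auto
  also have "\<dots> = v i" using i by (simp add: y(2) mat_apply_def)
  finally show "poly_eval v (pvar i - substitute \<sigma> (\<tau> i)) = 0" by (simp add: poly_eval_simps)
qed

text \<open>Restricting to \<open>L\<close> and pulling back along the projection does not change a
  form on \<open>L\<close>; the case of variables extends to all forms by induction on the
  degree.\<close>

lemma projection_congruence:
  assumes "p \<in> forms n e"
  shows "p - substitute \<sigma> (substitute \<tau> p) \<in> IL"
  using assms
proof (induction e arbitrary: p)
  case 0
  then have "p = const (Poly_Mapping.lookup p 0)" by (rule forms_0)
  then obtain c where "p = const c" by blast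
  then show ?case using ideal_coord_ringD(2)[OF ideal_IL] by simp
next
  case (Suc e)
  then obtain q where q: "\<And>j. j \<le> n \<Longrightarrow> q j \<in> forms n e" "p = (\<Sum>j\<le>n. pvar j * q j)"
    using forms_Suc_decompose by metis
  let ?S = "\<lambda>p. substitute \<sigma> (substitute \<tau> p)"
  have summand: "pvar j * q j - ?S (pvar j * q j) \<in> IL" if j: "j \<le> n" for j
  proof -
    have "q j * (pvar j - substitute \<sigma> (\<tau> j)) \<in> IL"
      by (rule ideal_coord_ringD(5)[OF ideal_IL projection_pvar[OF j] forms_carrier[OF q(1)[OF j]]])
    moreover have "substitute \<sigma> (\<tau> j) * (q j - ?S (q j)) \<in> IL"
      by (rule ideal_coord_ringD(5)[OF ideal_IL Suc.IH[OF q(1)[OF j]]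
          forms_carrier[OF \<sigma>_substitute_forms[OF \<tau>_forms]]])
    ultimately have "q j * (pvar j - substitute \<sigma> (\<tau> j)) + substitute \<sigma> (\<tau> j) * (q j - ?S (q j)) \<in> IL"
      by (rule ideal_coord_ringD(3)[OF ideal_IL])
    then show ?thesis by (simp add: substitute_simps algebra_simps)
  qed
  have "(\<Sum>j\<in>B. pvar j * q j - ?S (pvar j * q j)) \<in> IL" if "finite B" "B \<subseteq> {..n}" for B
    using that by (induction B) (auto simp: ideal_coord_ringD(2)[OF ideal_IL] intro: ideal_coord_ringD(3)[OF ideal_IL] summand)
  from this[of "{..n}"] show ?case
    by (simp add: q(2) substitute_simps sum_subtractf)
qed

section \<open>The ideal of the intersection of \<open>L\<close> with the eigenscheme of f\<close>

definition K :: "mpoly set" where "K = IL <+>\<^bsub>coord_ring n\<^esub> eigenscheme n f"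

lemma ideal_K: "ideal K (coord_ring n)"
  unfolding K_def eigenscheme_def
  by (intro ring.add_ideals cring.axioms(1) cring_coord_ring ideal_IL ambient.ideal_minors)

lemma IL_subset_K: "IL \<subseteq> K" and E_subset_K: "eigenscheme n f \<subseteq> K"
proof -
  have "0 \<in> eigenscheme n f" "0 \<in> IL"
    using ideal_coord_ringD(2) ambient.ideal_minors ideal_IL by (auto simp: eigenscheme_def)
  then show "IL \<subseteq> K" "eigenscheme n f \<subseteq> K"
    unfolding K_def set_add_coord_ring by force+
qed

lemma sum_in_K: "finite B \<Longrightarrow> (\<And>x. x \<in> B \<Longrightarrow> F x \<in> K) \<Longrightarrow> sum F B \<in> K"
  by (induction B rule: finite_induct)
    (auto simp: ideal_coord_ringD(2)[OF ideal_K] intro: ideal_coord_ringD(3)[OF ideal_K])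

text \<open>The point and the gradient are both transformed by the transpose of A, so modulo the
  ideal of \<open>L\<close> the minors of h become linear combinations of the minors of f. The chain
  rule identifies the pulled-back derivatives of h.\<close>

lemma \<sigma>_minor:
  assumes ij: "i \<le> k" "j \<le> k"
  shows "substitute \<sigma> (pvar i * partial_deriv j h - pvar j * partial_deriv i h) \<in> K"
proof -
  \<comment> \<open>The j-th entry of A^T applied to the gradient of f.\<close>
  define y where "y j = (\<Sum>m\<le>n. const (A m j) * partial_deriv m f)" for j
  have dh: "substitute \<sigma> (partial_deriv j h) - y j \<in> IL" if j: "j \<le> k" for j
  proof -
    have "partial_deriv j (\<tau> m) = const (A m j)" for m
      using j by (simp add: \<tau>_def partial_deriv_linear if_distrib[of "\<lambda>c. _ * c"] cong: if_cong)
    then have "substitute \<sigma> (partial_deriv j h)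
        = (\<Sum>m\<le>n. const (A m j) * substitute \<sigma> (substitute \<tau> (partial_deriv m f)))"
      unfolding restriction_eq partial_deriv_substitute[OF f] by (simp add: substitute_simps mult.commute)
    then have "y j - substitute \<sigma> (partial_deriv j h)
        = (\<Sum>m\<le>n. const (A m j) * (partial_deriv m f - substitute \<sigma> (substitute \<tau> (partial_deriv m f))))"
      by (simp add: y_def right_diff_distrib sum_subtractf)
    also have "\<dots> \<in> IL"
    proof -
      have "(\<Sum>m\<in>B. const (A m j) * (partial_deriv m f - substitute \<sigma> (substitute \<tau> (partial_deriv m f)))) \<in> IL"
        if "finite B" for B
        using that by (induction B) (auto simp: ideal_coord_ringD(2)[OF ideal_IL]
            intro: ideal_coord_ringD(3,6)[OF ideal_IL] projection_congruence[OF partial_deriv_in_forms[OF f]])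
      then show ?thesis by simp
    qed
    finally have "const (-1) * (y j - substitute \<sigma> (partial_deriv j h)) \<in> IL"
      by (rule ideal_coord_ringD(6)[OF ideal_IL])
    then show ?thesis by (simp add: const_uminus)
  qed
  have "\<sigma> i * y j - \<sigma> j * y i = (\<Sum>l\<le>n. \<Sum>m\<le>n. const (A l i * A m j) *
      (pvar l * partial_deriv m f - pvar m * partial_deriv l f))"
  proof -
    have 1: "\<sigma> i * y j = (\<Sum>l\<le>n. \<Sum>m\<le>n. const (A l i * A m j) * (pvar l * partial_deriv m f))" for i j
      by (simp add: \<sigma>_def y_def sum_product const_mult mult_ac)
    have "\<sigma> j * y i = (\<Sum>l\<le>n. \<Sum>m\<le>n. const (A l i * A m j) * (pvar m * partial_deriv l f))"
      unfolding 1 by (subst sum.swap) (simp add: mult.commute)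
    then show ?thesis by (simp add: 1 right_diff_distrib sum_subtractf)
  qed
  also have "\<dots> \<in> K"
    using ambient.minor_in_minors_ideal E_subset_K
    by (intro sum_in_K ideal_coord_ringD(6)[OF ideal_K]) (auto simp: eigenscheme_def)
  finally have 1: "\<sigma> i * y j - \<sigma> j * y i \<in> K" .
  have 2: "\<sigma> a * (substitute \<sigma> (partial_deriv b h) - y b) \<in> K" if "b \<le> k" for a b
    using ideal_coord_ringD(5)[OF ideal_K _ forms_carrier[OF \<sigma>_forms]] dh[OF that] IL_subset_K by blast
  have "(\<sigma> i * y j - \<sigma> j * y i) + (\<sigma> i * (substitute \<sigma> (partial_deriv j h) - y j)
      - \<sigma> j * (substitute \<sigma> (partial_deriv i h) - y i)) \<in> K"
    by (intro ideal_coord_ringD(3,4)[OF ideal_K] 1 2 ij)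
  then show ?thesis by (simp add: substitute_simps algebra_simps)
qed

lemma \<sigma>_eig:
  assumes "p \<in> eig k (d - 1) (\<lambda>i. partial_deriv i h) e"
  shows "substitute \<sigma> p \<in> K"
proof -
  have "p \<in> {p. substitute \<sigma> p \<in> K}"
    using _ _ assms
  proof (rule gen_least_subspace)
    show "mpoly_vs.subspace {p. substitute \<sigma> p \<in> K}"
      using ideal_coord_ringD(2,3,6)[OF ideal_K]
      by (simp add: mpoly_vs.subspace_def substitute_simps)
    fix a x q assume x: "(a, x) \<in> set (minor_list k (d - 1) (\<lambda>i. partial_deriv i h))" and q: "q \<in> shifted_forms k e a"
    have "substitute \<sigma> x \<in> K" using x \<sigma>_minor by (auto simp: set_minor_list)
    moreover have "substitute \<sigma> q \<in> carrier (coord_ring n)"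
      using q forms_carrier[OF \<sigma>_substitute_forms, of q "e - a"] forms_carrier[OF forms_zero]
      by (auto simp: shifted_forms_def substitute_simps split: if_splits)
    ultimately show "x * q \<in> {p. substitute \<sigma> p \<in> K}"
      using ideal_coord_ringD(5)[OF ideal_K, of "substitute \<sigma> x" "substitute \<sigma> q"]
      by (simp add: substitute_simps mult.commute[of "substitute \<sigma> x"])
  qed
  then show ?thesis by simp
qed

text \<open>Substituting \<tau> is injective from the quotient by \<open>K\<close> to the quotient
  by the minors of h: a form v is congruent modulo \<open>IL\<close> to its pull-back, which lies in
  \<open>K\<close> whenever the restriction of v is in the ideal of minors.\<close>

lemma hf_K_le: "hf n (pieces n K) e \<le> hf k (eig k (d - 1) (\<lambda>i. partial_deriv i h)) e"
  unfolding hf_def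
proof (rule codim_forms_preimage[OF linear_substitute[of \<tau>], of _ _ n e _ _ k e])
  show "v \<in> pieces n K e" if v: "v \<in> forms n e" "substitute \<tau> v \<in> eig k (d - 1) (\<lambda>i. partial_deriv i h) e" for v
  proof -
    have "(v - substitute \<sigma> (substitute \<tau> v)) + substitute \<sigma> (substitute \<tau> v) \<in> K"
      using projection_congruence[OF v(1)] \<sigma>_eig[OF v(2)] IL_subset_K
      by (intro ideal_coord_ringD(3)[OF ideal_K]) auto
    then show ?thesis using v(1) by (simp add: pieces_def)
  qed
qed (use \<tau>_substitute_forms subspace_forms gidealD(1,2)[OF restricted.gideal_eig]
      gidealD(1,2)[OF gideal_pieces[OF ideal_K]] in auto)

lemma K_full:
  assumes l: "l \<in> forms k 1" and full: "eventually_full k (gsum k (eig k (d - 1) (\<lambda>i. partial_deriv i h)) 1 l)"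
  shows "eventually_full n (gsum n (pieces n K) 1 (substitute \<sigma> l))"
proof -
  obtain N where N: "\<And>e. e \<ge> N \<Longrightarrow> forms k e \<subseteq> gsum k (eig k (d - 1) (\<lambda>i. partial_deriv i h)) 1 l e"
    using full by (auto simp: eventually_full_def)
  \<comment> \<open>The successor keeps e positive, so that the cofactor of the linear form is a
    genuine form of degree e - 1.\<close>
  have "p \<in> gsum n (pieces n K) 1 (substitute \<sigma> l) e" if e: "e \<ge> Suc N" and p: "p \<in> forms n e" for e p
  proof -
    have "substitute \<tau> p \<in> gsum k (eig k (d - 1) (\<lambda>i. partial_deriv i h)) 1 l e"
      using N[of e] e \<tau>_substitute_forms[OF p] by auto
    then obtain x q where xq: "x \<in> eig k (d - 1) (\<lambda>i. partial_deriv i h) e" "q \<in> shifted_forms k e 1"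
      "substitute \<tau> p = x + l * q" by (elim gsumE)
    have q: "q \<in> forms k (e - 1)" using xq(2) e by (simp add: shifted_forms_def)
    have q': "substitute \<sigma> q \<in> shifted_forms n e 1"
      using \<sigma>_substitute_forms[OF q] e by (simp add: shifted_forms_def)
    have "(p - substitute \<sigma> (substitute \<tau> p)) + substitute \<sigma> x \<in> K"
      using projection_congruence[OF p] \<sigma>_eig[OF xq(1)] IL_subset_K
      by (intro ideal_coord_ringD(3)[OF ideal_K]) auto
    then have "p - substitute \<sigma> l * substitute \<sigma> q \<in> K"
      by (simp add: xq(3) substitute_simps)
    moreover have "p - substitute \<sigma> l * substitute \<sigma> q \<in> forms n e"
      using mult_shifted_forms[OF q' \<sigma>_substitute_forms[OF l]] p by (intro forms_diff)
    ultimately show ?thesis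
      using q' by (intro gsumI[of "p - substitute \<sigma> l * substitute \<sigma> q" _ _ "substitute \<sigma> q"]) (auto simp: pieces_def)
  qed
  then show ?thesis unfolding eventually_full_def by blast
qed

text \<open>The saturation contains the eigenscheme ideal, which gives the first inequality. The
  second compares the eventual Hilbert function of \<open>K\<close> with that of the restricted
  eigenscheme in a common large degree.\<close>

lemma degree_bounds:
  assumes dim: "scheme_dim k (eigenscheme k h) = 0" and d: "1 \<le> d"
  shows "scheme_degree n (IL <+>\<^bsub>coord_ring n\<^esub> regular_eigenscheme n f) \<le> scheme_degree n K"
    "scheme_degree n K \<le> (if d = 2 then real (k + 1) else ((real d - 1) ^ (k + 1) - 1) / (real d - 2))"
proof -
  obtain l N where l: "l \<in> forms k 1" "eventually_full k (gsum k (eig k (d - 1) (\<lambda>i. partial_deriv i h)) 1 l)"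
    and N: "\<And>e. e \<ge> N \<Longrightarrow> real_of_int (hf k (eig k (d - 1) (\<lambda>i. partial_deriv i h)) e) \<le>
       (if d - 1 = 1 then real (k + 1) else (real (d - 1) ^ (k + 1) - 1) / (real (d - 1) - 1))"
    using restricted.eig_degree_bound[OF restricted.scheme_dim_0_brel[OF dim[unfolded eigenscheme_def]]] by blast
  note l' = \<sigma>_substitute_forms[OF l(1)] K_full[OF l]
  have sing: "ideal (singular_scheme n f) (coord_ring n)"
    unfolding singular_scheme_def
    using forms_carrier[OF partial_deriv_in_forms[OF f]]
    by (intro ring.genideal_ideal cring.axioms(1) cring_coord_ring) blast
  have E: "ideal (eigenscheme n f) (coord_ring n)" unfolding eigenscheme_def by (rule ambient.ideal_minors)
  note R = ideal_saturation_is_ideal[OF E sing]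
  show "scheme_degree n (IL <+>\<^bsub>coord_ring n\<^esub> regular_eigenscheme n f) \<le> scheme_degree n K"
  proof (rule scheme_degree_antimono[OF ideal_K _ _ l'])
    show "ideal (IL <+>\<^bsub>coord_ring n\<^esub> regular_eigenscheme n f) (coord_ring n)"
      unfolding regular_eigenscheme_def
      by (intro ring.add_ideals cring.axioms(1) cring_coord_ring ideal_IL R(1))
    show "K \<subseteq> IL <+>\<^bsub>coord_ring n\<^esub> regular_eigenscheme n f"
      using R(2) unfolding K_def set_add_coord_ring regular_eigenscheme_def by blast
  qed
  obtain M where M: "\<And>e. e \<ge> M \<Longrightarrow> scheme_degree n K = real_of_int (hf n (pieces n K) e)"
    using scheme_degree_eq[OF ideal_K l'] by blast
  have "scheme_degree n K \<le> real_of_int (hf k (eig k (d - 1) (\<lambda>i. partial_deriv i h)) (max M N))"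
    using M[of "max M N"] hf_K_le[of "max M N"] by simp
  also have "\<dots> \<le> (if d - 1 = 1 then real (k + 1) else (real (d - 1) ^ (k + 1) - 1) / (real (d - 1) - 1))"
    by (rule N) simp
  also have "\<dots> = (if d = 2 then real (k + 1) else ((real d - 1) ^ (k + 1) - 1) / (real d - 2))"
    using d by (auto simp: of_nat_diff)
  finally show "scheme_degree n K \<le> (if d = 2 then real (k + 1) else ((real d - 1) ^ (k + 1) - 1) / (real d - 2))" .
qed

end

text \<open>For \<open>d = 2\<close> the bound is read as the geometric sum of the powers of d - 1
  with exponents 0 to k, which is k + 1, since the quotient would divide by zero.\<close>

theorem proposition2p6:
  fixes n d :: nat and T :: "nat list \<Rightarrow> complex"
  assumes "d \<ge> 1"
  shows
    "(scheme_dim n (tensor_eigenscheme n d T) = 0 \<longrightarrow>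
        \<not> (\<exists>Q \<subseteq> closed_points n (tensor_eigenscheme n d T).
             card Q = d + 1 \<and> collinear_points n Q))
     \<and>
     (\<forall>f k L A.
        symmetric_tensor n d T \<longrightarrow> f = tensor_poly n d T \<longrightarrow>
        linear_space n k L \<longrightarrow> adapted_coords n k L A \<longrightarrow>
        scheme_dim k (eigenscheme k (restriction n k A f)) = 0 \<longrightarrow>
          scheme_degree n (linear_space_ideal n L <+>\<^bsub>coord_ring n\<^esub> regular_eigenscheme n f)
            \<le> scheme_degree n (linear_space_ideal n L <+>\<^bsub>coord_ring n\<^esub> eigenscheme n f)
        \<and> scheme_degree n (linear_space_ideal n L <+>\<^bsub>coord_ring n\<^esub> eigenscheme n f)
            \<le> (if d = 2 then real (k + 1)
                else ((real d - 1) ^ (k + 1) - 1) / (real d - 2)))"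
proof (intro conjI impI allI notI)
  assume "scheme_dim n (tensor_eigenscheme n d T) = 0"
    and "\<exists>Q \<subseteq> closed_points n (tensor_eigenscheme n d T). card Q = d + 1 \<and> collinear_points n Q"
  then show False using eigenpoints_not_collinear[OF _ assms] by blast
next
  fix f k L A
  assume f: "f = tensor_poly n d T" and L: "linear_space n k L" "adapted_coords n k L A"
    and dim: "scheme_dim k (eigenscheme k (restriction n k A f)) = 0"
  interpret adapted_restriction n k d L A f
    by unfold_locales (use L f tensor_poly_in_forms in auto)
  show "scheme_degree n (linear_space_ideal n L <+>\<^bsub>coord_ring n\<^esub> regular_eigenscheme n f)
      \<le> scheme_degree n (linear_space_ideal n L <+>\<^bsub>coord_ring n\<^esub> eigenscheme n f)"
    "scheme_degree n (linear_space_ideal n L <+>\<^bsub>coord_ring n\<^esub> eigenscheme n f)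
      \<le> (if d = 2 then real (k + 1) else ((real d - 1) ^ (k + 1) - 1) / (real d - 2))"
    using degree_bounds[OF dim assms] by (simp_all only: K_def)
qed

end
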